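(* Let $1\le p<\infty$. If $X$ is a dual Banach space with the weak Radon–Nikodym property (wRNP), then the Banach lattice $H_{w^*}^{p}[X]$ is $1$-monotonically bounded.
   Context: All Banach spaces are real. Let $1/p+1/p'=1$. For $z_1,\dots,z_n$ in a Banach space, $\|(z_i)_{i=1}^n\|_{p,\mathrm{weak}}=\sup\{\|\sum_i\alpha_i z_i\| : \|(\alpha_i)_i\|_{\ell_{p'}}\le 1\}$. For a Banach space $X$, $H_{w^*}[X]$ is the vector lattice (pointwise operations and order) of positively homogeneous functions $f:X^*\to\mathbb R$ that are weak$^*$-continuous on bounded sets. For $f\in H_{w^*}[X]$, $\|f\|_p$ is the infimum of all $C\ge 0$ such that $(\sum_{i=1}^n|f(x_i^* )|^p)^{1/p}\le C\|(x_i^* )_{i=1}^n\|_{p,\mathrm{weak}}$ for all $n$ and all $x_1^*,\dots,x_n^*\in X^*$. $H_{w^*}^p[X]=\{f\in H_{w^*}[X]:\|f\|_p<\infty\}$, normed by $\|\cdot\|_p$. A Banach lattice $Z$ is $\lambda$-monotonically bounded ($\lambda\ge1$) if every norm-bounded increasing net $(z_\alpha)\subset Z_+$ has an upper bound $z_0\in Z$ with $\|z_0\|\le\lambda\sup_\alpha\|z_\alpha\|$. A Banach space $X$ has the wRNP if for every complete finite measure space $(\Omega,\Sigma,\mu)$ and every $\mu$-continuous vector measure $m:\Sigma\to X$ of bounded variation there is a Pettis integrable $f:\Omega\to X$ with $m(E)=\text{Pettis-}\int_E f\,d\mu$ for all $E\in\Sigma$. *)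

theory Defs
  imports "HOL-Analysis.Analysis" "HOL-Library.Function_Algebras"
begin

type_synonym 'x dual = "'x \<Rightarrow>\<^sub>L real"


text \<open>
  The norm of (a_0, ..., a_{n-1}) in l_q^n, for q in [1, \<infinity>].  The exponent is
  extended because p = 1 has conjugate exponent \<infinity>; 0 is inserted only to
  give the maximum a meaning for n = 0.
\<close>

definition lq_norm :: "ereal \<Rightarrow> nat \<Rightarrow> (nat \<Rightarrow> real) \<Rightarrow> real" where
  "lq_norm q n a =
     (if q = \<infinity> then Max (insert 0 ((\<lambda>i. \<bar>a i\<bar>) ` {..<n}))
      else (\<Sum>i<n. \<bar>a i\<bar> powr real_of_ereal q) powr (1 / real_of_ereal q))"

definition conjugate_exponent :: "real \<Rightarrow> ereal" where
  "conjugate_exponent p = (if p = 1 then \<infinity> else ereal (p / (p - 1)))"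

definition weak_norm :: "real \<Rightarrow> nat \<Rightarrow> (nat \<Rightarrow> 'z::real_normed_vector) \<Rightarrow> real" where
  "weak_norm p n z =
     Sup {norm (\<Sum>i<n. a i *\<^sub>R z i) | a. lq_norm (conjugate_exponent p) n a \<le> 1}"


text \<open>
  For functionals (operators into the reals) the strong operator topology is the topology of
  pointwise convergence on 'x, that is, the weak* topology of the dual.
\<close>

abbreviation weak_star_topology :: "'x::real_normed_vector dual topology" where
  "weak_star_topology \<equiv> strong_operator_topology"

definition H_wstar :: "('x::real_normed_vector dual \<Rightarrow> real) set" where
  "H_wstar = {f. (\<forall>c\<ge>0. \<forall>u. f (c *\<^sub>R u) = c * f u) \<and>
                 (\<forall>B. bounded B \<longrightarrow>
                    continuous_map (subtopology weak_star_topology B) euclideanreal f)}"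

definition p_bounds :: "real \<Rightarrow> ('x::real_normed_vector dual \<Rightarrow> real) \<Rightarrow> real set" where
  "p_bounds p f =
     {C. 0 \<le> C \<and>
         (\<forall>n u. (\<Sum>i<n. \<bar>f (u i)\<bar> powr p) powr (1 / p) \<le> C * weak_norm p n u)}"

text \<open>
  The real infimum below is the norm only if some bound C exists; otherwise the norm is
  infinite, so finiteness is expressed in \<open>Hp_wstar\<close> by nonemptiness of the set of bounds.
\<close>

definition Hp_norm :: "real \<Rightarrow> ('x::real_normed_vector dual \<Rightarrow> real) \<Rightarrow> real" where
  "Hp_norm p f = Inf (p_bounds p f)"

definition Hp_wstar :: "real \<Rightarrow> ('x::real_normed_vector dual \<Rightarrow> real) set" where
  "Hp_wstar p = {f \<in> H_wstar. p_bounds p f \<noteq> {}}"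


text \<open>
  A Banach lattice is given by its carrier Z and its norm; order and zero are those of the
  ambient type (for functions: pointwise).  Nets are indexed by a directed preorder on a subset
  I of a type 'i, which is a parameter, so that a theorem polymorphic in 'i covers all nets.
\<close>

definition directed_preorder :: "'i set \<Rightarrow> ('i \<Rightarrow> 'i \<Rightarrow> bool) \<Rightarrow> bool" where
  "directed_preorder I le \<longleftrightarrow>
     I \<noteq> {} \<and>
     (\<forall>i\<in>I. le i i) \<and>
     (\<forall>i\<in>I. \<forall>j\<in>I. \<forall>k\<in>I. le i j \<longrightarrow> le j k \<longrightarrow> le i k) \<and>
     (\<forall>i\<in>I. \<forall>j\<in>I. \<exists>k\<in>I. le i k \<and> le j k)"

definition monotonically_bounded ::
    "'i itself \<Rightarrow> real \<Rightarrow> 'z::{order, zero} set \<Rightarrow> ('z \<Rightarrow> real) \<Rightarrow> bool" where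
  "monotonically_bounded (_ :: 'i itself) l Z nrm \<longleftrightarrow>
     1 \<le> l \<and>
     (\<forall>(I :: 'i set) le z.
        directed_preorder I le \<and>
        (\<forall>i\<in>I. z i \<in> Z \<and> 0 \<le> z i) \<and>
        (\<forall>i\<in>I. \<forall>j\<in>I. le i j \<longrightarrow> z i \<le> z j) \<and>
        bdd_above ((\<lambda>i. nrm (z i)) ` I) \<longrightarrow>
        (\<exists>z0\<in>Z. (\<forall>i\<in>I. z i \<le> z0) \<and> nrm z0 \<le> l * (SUP i\<in>I. nrm (z i))))"


definition vector_measure :: "'o measure \<Rightarrow> ('o set \<Rightarrow> 'x::real_normed_vector) \<Rightarrow> bool" where
  "vector_measure M m \<longleftrightarrow>
     (\<forall>A :: nat \<Rightarrow> 'o set. range A \<subseteq> sets M \<and> disjoint_family A \<longrightarrow>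
        (\<lambda>n. m (A n)) sums m (\<Union>n. A n))"

definition continuous_wrt :: "'o measure \<Rightarrow> ('o set \<Rightarrow> 'x::real_normed_vector) \<Rightarrow> bool" where
  "continuous_wrt M m \<longleftrightarrow>
     (\<forall>e>0. \<exists>d>0. \<forall>E\<in>sets M. measure M E < d \<longrightarrow> norm (m E) < e)"

definition has_bounded_variation :: "'o measure \<Rightarrow> ('o set \<Rightarrow> 'x::real_normed_vector) \<Rightarrow> bool" where
  "has_bounded_variation M m \<longleftrightarrow>
     (\<exists>K. \<forall>P. finite P \<and> P \<subseteq> sets M \<and> partition_on (space M) P \<longrightarrow>
        (\<Sum>E\<in>P. norm (m E)) \<le> K)"

definition has_Pettis_integral ::
    "'o measure \<Rightarrow> 'o set \<Rightarrow> ('o \<Rightarrow> 'x::real_normed_vector) \<Rightarrow> 'x \<Rightarrow> bool" where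
  "has_Pettis_integral M E f x \<longleftrightarrow>
     (\<forall>u :: 'x dual. set_integrable M E (\<lambda>w. u (f w)) \<and>
        u x = set_lebesgue_integral M E (\<lambda>w. u (f w)))"

definition Pettis_integrable :: "'o measure \<Rightarrow> ('o \<Rightarrow> 'x::real_normed_vector) \<Rightarrow> bool" where
  "Pettis_integrable M f \<longleftrightarrow> (\<forall>E\<in>sets M. \<exists>x. has_Pettis_integral M E f x)"

text \<open>
  The weak Radon-Nikodym property with respect to all complete finite measure spaces whose
  points are taken from the type 'o.

  HOL cannot quantify over all types inside a hypothesis, so 'o has to be fixed.  No generality
  is lost with the bidual \<open>'x dual dual\<close>: let \<open>(S, \<mu>)\<close> be any complete finite
  measure space and m a vector measure as below.  Splitting S into countably many pieces on which
  the density of the variation of m is bounded, assume \<open>norm (m E) \<le> c * \<mu> E\<close>.  For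
  each functional u let \<open>h u\<close> be the density of \<open>u \<circ> m\<close>, let r be a linear
  lifting for \<open>\<mu>\<close>, and put \<open>g w = (\<lambda>u. r (h u) w)\<close>, an element of the bidual of
  norm at most c.  If f is a Pettis density of the image of m under g with respect to the image of
  \<open>\<mu>\<close> under g (on the largest sigma-algebra making g measurable, which keeps it complete),
  then \<open>f \<circ> g\<close> is a Pettis density of m.
\<close>

definition wRNP_over :: "'o itself \<Rightarrow> 'x::real_normed_vector itself \<Rightarrow> bool" where
  "wRNP_over (_ :: 'o itself) (_ :: 'x itself) \<longleftrightarrow>
     (\<forall>(M :: 'o measure) (m :: 'o set \<Rightarrow> 'x).
        finite_measure M \<and> complete_measure M \<and>
        vector_measure M m \<and> continuous_wrt M m \<and> has_bounded_variation M m \<longrightarrow>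
        (\<exists>f. Pettis_integrable M f \<and> (\<forall>E\<in>sets M. has_Pettis_integral M E f (m E))))"

definition wRNP :: "'x::real_normed_vector itself \<Rightarrow> bool" where
  "wRNP (_ :: 'x itself) \<longleftrightarrow> wRNP_over TYPE('x dual dual) TYPE('x)"


definition isometric_isomorphism ::
    "('x::real_normed_vector \<Rightarrow> 'y::real_normed_vector) \<Rightarrow> bool" where
  "isometric_isomorphism J \<longleftrightarrow> linear J \<and> (\<forall>x. norm (J x) = norm x) \<and> surj J"

end

theory Submission
  imports Defs "HOL-Probability.Probability"
begin

text \<open>
  Identify \<open>X\<close> with the dual of \<open>Y\<close>.  If the norms of an increasing net are bounded by
  \<open>S\<close>, Pietsch domination gives a probability measure \<open>\<mu>\<close> such that every member of the
  net is at most \<open>S (\<integral>|y|\<^sup>p d\<mu>)\<^sup>1\<^sup>/\<^sup>p\<close> at \<open>y \<in> Y\<close>.  Since \<open>X\<close> is a dual, each density \<open>\<phi>\<close>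
  has a barycentre \<open>V \<phi> \<in> X\<close> with respect to \<open>\<mu>\<close>, so each \<open>u \<in> X\<^sup>*\<close> has a density \<open>h u\<close>
  with \<open>u (V \<phi>) = \<integral>\<phi> h u d\<mu>\<close>.  The upper bound is \<open>g u = S (\<integral>|h u|\<^sup>p d\<mu>)\<^sup>1\<^sup>/\<^sup>p\<close>: once \<open>g\<close>
  is weak* continuous on bounded sets, Goldstine's theorem extends the domination from \<open>Y\<close>
  to \<open>X\<^sup>*\<close>.

  Continuity of \<open>g\<close> is where the wRNP enters.  If it fails, there are functionals \<open>u\<close> in the unit
  ball tending weak* to 0 with \<open>\<integral>(h u)\<^sup>2\<close> bounded below.  For a lacunary choice
  \<open>u\<^sub>0, u\<^sub>1, \<dots>\<close> of them the Riesz products \<open>\<Prod>k<n. (1 \<plusminus> h u\<^sub>k)\<close> form a bounded martingale on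
  the space of coin tossings, hence \<open>V\<close> of them a vector measure of bounded variation.  Along its
  weak density \<open>f\<close> the numbers \<open>u\<^sub>k (f t)\<close> stay away from 0, whereas every
  weak* cluster point of the \<open>u\<^sub>k\<close> annihilates the measure and so vanishes on \<open>f\<close> almost
  everywhere.
\<close>

section \<open>Ultrafilters\<close>

definition ultrafilter :: "'a filter \<Rightarrow> bool" where
  "ultrafilter F \<longleftrightarrow> F \<noteq> bot \<and> (\<forall>P. eventually P F \<or> eventually (\<lambda>x. \<not> P x) F)"

lemma ultrafilter_not_bot: "ultrafilter F \<Longrightarrow> F \<noteq> bot"
  by (simp add: ultrafilter_def)

lemma ultrafilter_cases:
  assumes "ultrafilter F" "\<not> eventually P F"
  shows "eventually (\<lambda>x. \<not> P x) F"
  using assms by (auto simp: ultrafilter_def)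

lemma ultrafilter_exists:
  fixes G :: "'a filter"
  assumes "G \<noteq> bot"
  obtains F where "F \<le> G" "ultrafilter F"
proof -
  define A where "A = {F. F \<noteq> bot \<and> F \<le> G}"
  have "\<exists>m\<in>A. \<forall>a\<in>A. (\<lambda>F F'. F' \<le> F) m a \<longrightarrow> a = m"
  proof (rule predicate_Zorn)
    show "partial_order_on A (relation_of (\<lambda>F F'. F' \<le> F) A)"
      by (rule partial_order_on_relation_ofI) auto
  next
    fix C assume C: "C \<in> Chains (relation_of (\<lambda>F F'. F' \<le> F) A)"
    show "\<exists>u\<in>A. \<forall>a\<in>C. u \<le> a"
    proof (cases "C = {}")
      case True
      then show ?thesis using assms by (auto simp: A_def)
    next
      case False
      have CA: "C \<subseteq> A" and chain: "\<And>F F'. F \<in> C \<Longrightarrow> F' \<in> C \<Longrightarrow> F \<le> F' \<or> F' \<le> F"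
        using C by (auto simp: Chains_def relation_of_def)
      have "eventually P (Inf C) \<longleftrightarrow> (\<exists>b\<in>C. eventually P b)" for P
        using False chain by (intro eventually_Inf_base) (metis inf.absorb1 inf.absorb2 order_refl)+
      then have "Inf C \<noteq> bot"
        using CA by (auto simp: trivial_limit_def A_def)
      moreover have "Inf C \<le> G"
        using False CA by (auto simp: A_def intro: Inf_lower2)
      ultimately show ?thesis
        by (intro bexI[of _ "Inf C"]) (auto simp: A_def intro: Inf_lower)
    qed
  qed
  then obtain F where F: "F \<in> A" and max: "\<And>F'. F' \<in> A \<Longrightarrow> F' \<le> F \<Longrightarrow> F' = F"
    by blast
  have "eventually P F \<or> eventually (\<lambda>x. \<not> P x) F" for P
  proof (rule disjCI)
    assume n: "\<not> eventually (\<lambda>x. \<not> P x) F"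
    have "inf F (principal {x. P x}) \<noteq> bot"
      using n by (simp add: trivial_limit_def eventually_inf_principal)
    then have "inf F (principal {x. P x}) = F"
      using F by (intro max) (auto simp: A_def intro: le_infI1)
    then have "F \<le> principal {x. P x}"
      by (metis inf.cobounded2)
    then show "eventually P F"
      by (simp add: le_principal)
  qed
  then have "ultrafilter F"
    using F by (auto simp: A_def ultrafilter_def)
  then show ?thesis
    using F that by (auto simp: A_def)
qed

lemma ultrafilter_bounded_limit:
  fixes f :: "'a \<Rightarrow> real"
  assumes F: "ultrafilter F" and ev: "eventually (\<lambda>x. \<bar>f x\<bar> \<le> C) F"
  obtains L where "(f \<longlongrightarrow> L) F" "\<bar>L\<bar> \<le> C"
proof -
  have "compact {-C..C}" by simp
  moreover have "filtermap f F \<noteq> bot"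
    using F by (simp add: ultrafilter_def filtermap_bot_iff)
  moreover have "eventually (\<lambda>x. x \<in> {-C..C}) (filtermap f F)"
    using ev by (auto simp: eventually_filtermap abs_le_iff elim: eventually_mono)
  ultimately obtain L where L: "L \<in> {-C..C}" "inf (nhds L) (filtermap f F) \<noteq> bot"
    unfolding compact_filter by blast
  have "(f \<longlongrightarrow> L) F"
  proof (rule topological_tendstoI)
    fix S assume S: "open S" "L \<in> S"
    show "eventually (\<lambda>x. f x \<in> S) F"
    proof (rule ccontr)
      assume "\<not> eventually (\<lambda>x. f x \<in> S) F"
      then have "eventually (\<lambda>x. f x \<notin> S) F"
        using F ultrafilter_cases by blast
      then have "eventually (\<lambda>y. y \<notin> S) (filtermap f F)"
        by (simp add: eventually_filtermap)
      moreover have "eventually (\<lambda>y. y \<in> S) (nhds L)"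
        using S eventually_nhds by blast
      ultimately have "eventually (\<lambda>y. False) (inf (nhds L) (filtermap f F))"
        unfolding eventually_inf by blast
      then show False
        using L(2) by (simp add: trivial_limit_def)
    qed
  qed
  then show ?thesis using L(1) that by auto
qed

lemma tendsto_if_ultrafilters:
  fixes f :: "'a \<Rightarrow> 'b::topological_space"
  assumes "\<And>U. ultrafilter U \<Longrightarrow> U \<le> F \<Longrightarrow> (f \<longlongrightarrow> l) U"
  shows "(f \<longlongrightarrow> l) F"
proof (rule topological_tendstoI, rule ccontr)
  fix S assume S: "open S" "l \<in> S" and no: "\<not> eventually (\<lambda>x. f x \<in> S) F"
  have "inf F (principal {x. f x \<notin> S}) \<noteq> bot"
    using no by (simp add: trivial_limit_def eventually_inf_principal)
  then obtain U where U: "U \<le> inf F (principal {x. f x \<notin> S})" "ultrafilter U"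
    using ultrafilter_exists by blast
  have "eventually (\<lambda>x. f x \<notin> S) U"
    using U(1) by (simp add: le_principal)
  moreover have "eventually (\<lambda>x. f x \<in> S) U"
    using assms[OF U(2)] U(1) S by (auto dest: topological_tendstoD)
  ultimately have "eventually (\<lambda>x. False) U" by eventually_elim simp
  then show False using ultrafilter_not_bot[OF U(2)] by (simp add: trivial_limit_def)
qed

lemma ultrafilter_filtermap: "ultrafilter F \<Longrightarrow> ultrafilter (filtermap f F)"
  by (simp add: ultrafilter_def eventually_filtermap filtermap_bot_iff)

section \<open>The Hahn-Banach theorem\<close>

lemma le_scaled_cINF:
  fixes f :: "'i \<Rightarrow> real"
  assumes "I \<noteq> {}" "0 \<le> c" "\<And>i. i \<in> I \<Longrightarrow> b \<le> c * f i"
  shows "b \<le> c * (INF i\<in>I. f i)"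
proof (cases "c = 0")
  case True
  then show ?thesis using assms by auto
next
  case False
  then have "b / c \<le> (INF i\<in>I. f i)"
    using assms by (intro cINF_greatest) (auto simp: field_simps)
  then show ?thesis using False assms(2) by (simp add: field_simps)
qed

lemma le_add_cINF:
  fixes f :: "'i \<Rightarrow> real" and g :: "'j \<Rightarrow> real"
  assumes "I \<noteq> {}" "J \<noteq> {}" "\<And>i j. i \<in> I \<Longrightarrow> j \<in> J \<Longrightarrow> b \<le> f i + g j"
  shows "b \<le> (INF i\<in>I. f i) + (INF j\<in>J. g j)"
proof -
  have "b - f i \<le> (INF j\<in>J. g j)" if "i \<in> I" for i
    using assms that by (intro cINF_greatest) (auto simp: algebra_simps)
  then have "b - (INF j\<in>J. g j) \<le> (INF i\<in>I. f i)"
    using assms(1) by (intro cINF_greatest) (auto simp: algebra_simps)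
  then show ?thesis by simp
qed

definition sublinear_on :: "'v::real_vector set \<Rightarrow> ('v \<Rightarrow> real) \<Rightarrow> bool" where
  "sublinear_on V q \<longleftrightarrow>
     (\<forall>x\<in>V. \<forall>y\<in>V. q (x + y) \<le> q x + q y) \<and> (\<forall>x\<in>V. \<forall>c\<ge>0. q (c *\<^sub>R x) \<le> c * q x)"

lemma sublinear_on_zero:
  assumes "subspace V" "sublinear_on V q"
  shows "q 0 = 0"
proof -
  have V: "0 \<in> V" using assms(1) subspace_0 by blast
  have "q (0 + 0) \<le> q 0 + q 0"
    using assms(2) V unfolding sublinear_on_def by blast
  moreover have "q (0 *\<^sub>R 0) \<le> 0 * q 0"
    using assms(2) V unfolding sublinear_on_def by blast
  ultimately show ?thesis by simp
qed

lemma sublinear_on_scale: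
  assumes V: "subspace V" "sublinear_on V q" and x: "x \<in> V" "0 \<le> c"
  shows "q (c *\<^sub>R x) = c * q x"
proof (cases "c = 0")
  case True
  then show ?thesis using sublinear_on_zero[OF V] by simp
next
  case False
  then have c: "0 < c" using x by simp
  have "q (inverse c *\<^sub>R (c *\<^sub>R x)) \<le> inverse c * q (c *\<^sub>R x)"
    using V(2) subspace_scale[OF V(1) x(1), of c] c unfolding sublinear_on_def
    by (meson inverse_nonnegative_iff_nonnegative less_imp_le)
  then have "c * q x \<le> q (c *\<^sub>R x)"
    using c by (simp add: field_simps)
  moreover have "q (c *\<^sub>R x) \<le> c * q x"
    using V(2) x unfolding sublinear_on_def by blast
  ultimately show ?thesis by simp
qed

lemma sublinear_on_minus:
  assumes V: "subspace V" "sublinear_on V q" and x: "x \<in> V"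
  shows "- q (- x) \<le> q x"
proof -
  have "q (x + - x) \<le> q x + q (- x)"
    using V x subspace_neg[OF V(1) x] unfolding sublinear_on_def by blast
  then show ?thesis using sublinear_on_zero[OF V] by simp
qed

text \<open>The directional derivative of a sublinear functional at infinity in direction \<open>v\<close>:
  it stays below the functional, and it is strictly smaller somewhere unless the functional is additive in
  direction \<open>v\<close>.\<close>

definition sublinear_shift :: "('v::real_vector \<Rightarrow> real) \<Rightarrow> 'v \<Rightarrow> 'v \<Rightarrow> real" where
  "sublinear_shift q v x = (INF t\<in>{0..}. q (x + t *\<^sub>R v) - t * q v)"

lemma sublinear_shift_bdd:
  assumes V: "subspace V" "sublinear_on V q" and x: "x \<in> V" and v: "v \<in> V"
  shows "bdd_below ((\<lambda>t. q (x + t *\<^sub>R v) - t * q v) ` {0..})"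
proof (rule bdd_belowI2)
  fix t :: real assume t: "t \<in> {0..}"
  have "q ((x + t *\<^sub>R v) + - x) \<le> q (x + t *\<^sub>R v) + q (- x)"
    using V x v subspace_add[OF V(1)] subspace_scale[OF V(1)] subspace_neg[OF V(1)]
    unfolding sublinear_on_def by meson
  then show "- q (- x) \<le> q (x + t *\<^sub>R v) - t * q v"
    using sublinear_on_scale[OF V v] t by simp
qed

lemma sublinear_shift_le:
  assumes V: "subspace V" "sublinear_on V q" and "x \<in> V" "v \<in> V" "0 \<le> t"
  shows "sublinear_shift q v x \<le> q (x + t *\<^sub>R v) - t * q v"
  unfolding sublinear_shift_def using assms by (intro cINF_lower sublinear_shift_bdd[OF V]) auto

lemma sublinear_on_shift:
  assumes V: "subspace V" "sublinear_on V q" and v: "v \<in> V"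
  shows "sublinear_on V (sublinear_shift q v)"
  unfolding sublinear_on_def
proof (intro conjI ballI allI impI)
  fix x y assume x: "x \<in> V" and y: "y \<in> V"
  have "sublinear_shift q v (x + y) \<le> (q (x + t *\<^sub>R v) - t * q v) + (q (y + s *\<^sub>R v) - s * q v)"
    if "0 \<le> t" "0 \<le> s" for t s
  proof -
    have "sublinear_shift q v (x + y) \<le> q ((x + y) + (t + s) *\<^sub>R v) - (t + s) * q v"
      using x y v that V subspace_add by (intro sublinear_shift_le[OF V]) auto
    moreover have "q ((x + t *\<^sub>R v) + (y + s *\<^sub>R v)) \<le> q (x + t *\<^sub>R v) + q (y + s *\<^sub>R v)"
      using V x y v subspace_add[OF V(1)] subspace_scale[OF V(1)]
      unfolding sublinear_on_def by meson
    ultimately show ?thesis by (simp add: algebra_simps)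
  qed
  then show "sublinear_shift q v (x + y) \<le> sublinear_shift q v x + sublinear_shift q v y"
    unfolding sublinear_shift_def[of q v x] sublinear_shift_def[of q v y]
    by (intro le_add_cINF) auto
next
  fix x and c :: real assume x: "x \<in> V" and c: "0 \<le> c"
  have "sublinear_shift q v (c *\<^sub>R x) \<le> c * (q (x + t *\<^sub>R v) - t * q v)" if "0 \<le> t" for t
  proof -
    have "sublinear_shift q v (c *\<^sub>R x) \<le> q (c *\<^sub>R x + (c * t) *\<^sub>R v) - (c * t) * q v"
      using x v c that V subspace_scale by (intro sublinear_shift_le[OF V]) auto
    also have "c *\<^sub>R x + (c * t) *\<^sub>R v = c *\<^sub>R (x + t *\<^sub>R v)"
      by (simp add: algebra_simps)
    also have "q \<dots> = c * q (x + t *\<^sub>R v)"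
      using x v c subspace_add[OF V(1)] subspace_scale[OF V(1)]
      by (intro sublinear_on_scale[OF V]) auto
    finally show ?thesis by (simp add: algebra_simps)
  qed
  then show "sublinear_shift q v (c *\<^sub>R x) \<le> c * sublinear_shift q v x"
    unfolding sublinear_shift_def[of q v x] using c by (intro le_scaled_cINF) auto
qed

lemma exists_minimal_sublinear:
  fixes q :: "'v::real_vector \<Rightarrow> real"
  assumes V: "subspace V" and q: "sublinear_on V q"
  obtains m where "sublinear_on V m" "\<And>x. x \<in> V \<Longrightarrow> m x \<le> q x"
    "\<And>r x. sublinear_on V r \<Longrightarrow> (\<And>x. x \<in> V \<Longrightarrow> r x \<le> m x) \<Longrightarrow> x \<in> V \<Longrightarrow> r x = m x"
proof -
  define A where "A = {r. sublinear_on V r \<and> (\<forall>x\<in>V. r x \<le> q x) \<and> (\<forall>x. x \<notin> V \<longrightarrow> r x = 0)}"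
  let ?P = "\<lambda>f g :: 'v \<Rightarrow> real. \<forall>x. g x \<le> f x"
  have ext: "sublinear_on V (\<lambda>x. if x \<in> V then r x else 0)" if "sublinear_on V r" for r
    using that V unfolding sublinear_on_def by (simp add: subspace_add subspace_scale)
  have "\<exists>m\<in>A. \<forall>a\<in>A. ?P m a \<longrightarrow> a = m"
  proof (rule predicate_Zorn)
    show "partial_order_on A (relation_of ?P A)"
      by (rule partial_order_on_relation_ofI) (auto intro: order_trans simp: fun_eq_iff antisym)
  next
    fix C assume C: "C \<in> Chains (relation_of ?P A)"
    show "\<exists>u\<in>A. \<forall>a\<in>C. ?P a u"
    proof (cases "C = {}")
      case True
      have "(\<lambda>x. if x \<in> V then q x else 0) \<in> A"
        using ext[OF q] by (simp add: A_def)
      then show ?thesis using True by blast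
    next
      case False
      have CA: "C \<subseteq> A" and chain: "\<And>f g. f \<in> C \<Longrightarrow> g \<in> C \<Longrightarrow> ?P f g \<or> ?P g f"
        using C by (auto simp: Chains_def relation_of_def)
      define u where "u x = (INF r\<in>C. r x)" for x
      have bdd: "bdd_below ((\<lambda>r. r x) ` C)" for x
      proof (cases "x \<in> V")
        case True
        show ?thesis
        proof (rule bdd_belowI2)
          fix r assume "r \<in> C"
          then have "r \<in> A" using CA by auto
          then have "- r (- x) \<le> r x" "r (- x) \<le> q (- x)"
            using sublinear_on_minus[OF V _ True] subspace_neg[OF V True] by (auto simp: A_def)
          then show "- q (- x) \<le> r x" by simp
        qed
      next
        case False
        then show ?thesis
          using CA by (intro bdd_belowI2[of _ 0]) (auto simp: A_def subset_iff)
      qed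
      have ule: "u x \<le> r x" if "r \<in> C" for r x
        unfolding u_def using that bdd by (intro cINF_lower) auto
      have "sublinear_on V u"
        unfolding sublinear_on_def
      proof (intro conjI ballI allI impI)
        fix x y assume x: "x \<in> V" and y: "y \<in> V"
        have "u (x + y) \<le> f x + g y" if "f \<in> C" "g \<in> C" for f g
        proof -
          obtain h where h: "h \<in> C" "h x \<le> f x" "h y \<le> g y"
            using chain[OF \<open>f \<in> C\<close> \<open>g \<in> C\<close>] \<open>f \<in> C\<close> \<open>g \<in> C\<close> by (metis order_refl)
          then have "h (x + y) \<le> h x + h y"
            using CA x y by (auto simp: A_def sublinear_on_def)
          then show ?thesis using h ule[OF h(1), of "x + y"] by simp
        qed
        then show "u (x + y) \<le> u x + u y"
          unfolding u_def[of x] u_def[of y] using False by (intro le_add_cINF) auto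
      next
        fix x and c :: real assume x: "x \<in> V" and c: "0 \<le> c"
        have "u (c *\<^sub>R x) \<le> c * f x" if "f \<in> C" for f
        proof -
          have "f (c *\<^sub>R x) \<le> c * f x"
            using CA x c that by (auto simp: A_def sublinear_on_def)
          then show ?thesis using ule[OF that, of "c *\<^sub>R x"] by simp
        qed
        then show "u (c *\<^sub>R x) \<le> c * u x"
          unfolding u_def[of x] using False c by (intro le_scaled_cINF) auto
      qed
      moreover have "u x \<le> q x" if "x \<in> V" for x
      proof -
        obtain f where "f \<in> C" using \<open>C \<noteq> {}\<close> by blast
        then show ?thesis using ule[of f x] CA that by (fastforce simp: A_def)
      qed
      moreover have "u x = 0" if "x \<notin> V" for x
      proof -
        have "(\<lambda>r. r x) ` C = {0}"
          using False CA that by (auto simp: A_def image_iff subset_iff)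
        then show ?thesis by (simp add: u_def)
      qed
      ultimately have "u \<in> A" by (simp add: A_def)
      then show ?thesis using ule by blast
    qed
  qed
  then obtain m where m: "m \<in> A" and min: "\<And>a. a \<in> A \<Longrightarrow> ?P m a \<Longrightarrow> a = m"
    by blast
  show ?thesis
  proof (rule that[of m])
    show "sublinear_on V m" "\<And>x. x \<in> V \<Longrightarrow> m x \<le> q x"
      using m by (auto simp: A_def)
    fix r x assume r: "sublinear_on V r" "\<And>x. x \<in> V \<Longrightarrow> r x \<le> m x" and x: "x \<in> V"
    have "(\<lambda>x. if x \<in> V then r x else 0) = m"
    proof (rule min)
      show "(\<lambda>x. if x \<in> V then r x else 0) \<in> A"
        using ext[OF r(1)] r(2) m by (fastforce simp: A_def)
      show "\<forall>x. (if x \<in> V then r x else 0) \<le> m x"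
        using r(2) m by (auto simp: A_def)
    qed
    then show "r x = m x" using x by (metis (mono_tags))
  qed
qed

theorem Hahn_Banach_sublinear:
  fixes q :: "'v::real_vector \<Rightarrow> real"
  assumes V: "subspace V" and q: "sublinear_on V q" and v0: "v0 \<in> V"
  obtains L where "\<And>x y. x \<in> V \<Longrightarrow> y \<in> V \<Longrightarrow> L (x + y) = L x + L y"
    "\<And>c x. x \<in> V \<Longrightarrow> L (c *\<^sub>R x) = c * L x" "\<And>x. x \<in> V \<Longrightarrow> L x \<le> q x" "L v0 = q v0"
proof -
  obtain L where L: "sublinear_on V L" "\<And>x. x \<in> V \<Longrightarrow> L x \<le> sublinear_shift q v0 x"
    and min: "\<And>r x. sublinear_on V r \<Longrightarrow> (\<And>x. x \<in> V \<Longrightarrow> r x \<le> L x) \<Longrightarrow> x \<in> V \<Longrightarrow> r x = L x"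
    using exists_minimal_sublinear[OF V sublinear_on_shift[OF V q v0]] by blast
  have add: "L (x + y) = L x + L y" if x: "x \<in> V" and y: "y \<in> V" for x y
  proof -
    have le: "sublinear_shift L y x \<le> L x" if "x \<in> V" for x
      using sublinear_shift_le[OF V L(1) that y, of 0] by simp
    have "L x = sublinear_shift L y x"
      using min[OF sublinear_on_shift[OF V L(1) y] le x] by simp
    also have "\<dots> \<le> L (x + y) - L y"
      using sublinear_shift_le[OF V L(1) x y, of 1] by simp
    finally show ?thesis
      using L(1) x y unfolding sublinear_on_def by (simp add: antisym)
  qed
  have neg: "L (- x) = - L x" if "x \<in> V" for x
    using add[OF that subspace_neg[OF V that]] sublinear_on_zero[OF V L(1)] by simp
  have scale: "L (c *\<^sub>R x) = c * L x" if "x \<in> V" for c x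
  proof (cases "0 \<le> c")
    case True
    then show ?thesis using sublinear_on_scale[OF V L(1) that] by simp
  next
    case False
    then have "L ((- c) *\<^sub>R x) = (- c) * L x"
      using sublinear_on_scale[OF V L(1) that, of "- c"] by simp
    then show ?thesis using neg[OF subspace_scale[OF V that, of c]] by simp
  qed
  have le: "L x \<le> q x" if "x \<in> V" for x
    using L(2)[OF that] sublinear_shift_le[OF V q that v0, of 0] by simp
  have "L (- v0) \<le> q (- v0 + 1 *\<^sub>R v0) - 1 * q v0"
    using L(2)[OF subspace_neg[OF V v0]] sublinear_shift_le[OF V q subspace_neg[OF V v0] v0, of 1]
    by simp
  then have "L v0 = q v0"
    using neg[OF v0] le[OF v0] sublinear_on_zero[OF V q] by simp
  then show ?thesis using that add scale le by blast
qed

instantiation "fun" :: (type, real_vector) real_vector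
begin
definition scaleR_fun_def: "c *\<^sub>R f = (\<lambda>x. c *\<^sub>R f x)"
instance
  by standard (auto simp: scaleR_fun_def algebra_simps plus_fun_def)
end

section \<open>Measures on the Stone space of a power set\<close>

definition stone_space :: "'a set \<Rightarrow> 'a filter set" where
  "stone_space B = {F. ultrafilter F \<and> eventually (\<lambda>x. x \<in> B) F}"

definition stone_set :: "'a set \<Rightarrow> 'a set \<Rightarrow> 'a filter set" where
  "stone_set B A = {F\<in>stone_space B. eventually (\<lambda>x. x \<in> A) F}"

lemma eventually_ultrafilter_not:
  assumes F: "ultrafilter F"
  shows "eventually (\<lambda>x. \<not> P x) F \<longleftrightarrow> \<not> eventually P F"
proof
  assume n: "eventually (\<lambda>x. \<not> P x) F"
  show "\<not> eventually P F"
  proof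
    assume "eventually P F"
    with n have "eventually (\<lambda>x. False) F" by eventually_elim blast
    then show False using ultrafilter_not_bot[OF F] by (simp add: trivial_limit_def)
  qed
next
  assume "\<not> eventually P F"
  then show "eventually (\<lambda>x. \<not> P x) F" by (rule ultrafilter_cases[OF F])
qed

lemma stone_set_Un: "stone_set B (A \<union> A') = stone_set B A \<union> stone_set B A'"
proof -
  have "eventually (\<lambda>x. x \<in> A \<or> x \<in> A') F \<longleftrightarrow> eventually (\<lambda>x. x \<in> A) F \<or> eventually (\<lambda>x. x \<in> A') F"
    if F: "ultrafilter F" for F
    using eventually_ultrafilter_not[OF F, of "\<lambda>x. x \<in> A \<or> x \<in> A'"]
      eventually_ultrafilter_not[OF F, of "\<lambda>x. x \<in> A"] eventually_ultrafilter_not[OF F, of "\<lambda>x. x \<in> A'"]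
    by (auto simp: eventually_conj_iff)
  then show ?thesis by (auto simp: stone_set_def stone_space_def)
qed

lemma stone_set_Int: "stone_set B (A \<inter> A') = stone_set B A \<inter> stone_set B A'"
  by (auto simp: stone_set_def eventually_conj_iff)

lemma stone_set_Diff: "stone_set B (A - A') = stone_set B A - stone_set B A'"
  by (auto simp: stone_set_def stone_space_def eventually_conj_iff eventually_ultrafilter_not)

lemma stone_set_empty [simp]: "stone_set B {} = {}"
  by (auto simp: stone_set_def stone_space_def dest: ultrafilter_not_bot)

lemma stone_set_whole [simp]: "stone_set B B = stone_space B"
  by (auto simp: stone_set_def stone_space_def)

lemma stone_set_inj:
  assumes "A \<subseteq> B" "A' \<subseteq> B" "stone_set B A = stone_set B A'"
  shows "A = A'"
proof -
  have "principal {x} \<in> stone_set B C \<longleftrightarrow> x \<in> C" if "C \<subseteq> B" for x C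
    using that by (auto simp: stone_set_def stone_space_def ultrafilter_def eventually_principal
        trivial_limit_def)
  from this[OF assms(1)] this[OF assms(2)] show ?thesis
    unfolding assms(3) by (intro set_eqI) metis
qed

text \<open>Compactness of the Stone space: it makes every finitely additive set function on the
  subsets of \<open>B\<close> a premeasure.\<close>

lemma stone_set_decseq_empty:
  fixes A :: "nat \<Rightarrow> 'a set"
  assumes dec: "decseq A" and sub: "\<And>i. A i \<subseteq> B" and e: "(\<Inter>i. stone_set B (A i)) = {}"
  shows "\<exists>i. A i = {}"
proof (rule ccontr)
  assume "\<not> (\<exists>i. A i = {})"
  then have ne: "A i \<noteq> {}" for i by blast
  define G where "G = (INF i. principal (A i))"
  have ev: "eventually P G \<longleftrightarrow> (\<exists>i. eventually P (principal (A i)))" for P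
    unfolding G_def
  proof (subst eventually_INF_base)
    fix a b :: nat
    have "A (max a b) \<subseteq> A a \<inter> A b" using dec by (simp add: decseq_def)
    then show "\<exists>x\<in>UNIV. principal (A x) \<le> inf (principal (A a)) (principal (A b))"
      by (intro bexI[of _ "max a b"]) auto
  qed auto
  then have "G \<noteq> bot" using ne by (auto simp: trivial_limit_def eventually_principal)
  then obtain F where F: "F \<le> G" "ultrafilter F" using ultrafilter_exists by blast
  have "eventually (\<lambda>x. x \<in> A i) F" for i
    using F(1) ev by (auto simp: le_filter_def eventually_principal)
  moreover from this[of 0] have "eventually (\<lambda>x. x \<in> B) F"
    by (rule eventually_mono) (use sub[of 0] in blast)
  ultimately have "F \<in> (\<Inter>i. stone_set B (A i))"
    using F(2) by (auto simp: stone_set_def stone_space_def)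
  then show False using e by simp
qed

lemma stone_measure:
  fixes l :: "'a set \<Rightarrow> real"
  assumes nonneg: "\<And>A. A \<subseteq> B \<Longrightarrow> 0 \<le> l A"
    and add: "\<And>A A'. A \<subseteq> B \<Longrightarrow> A' \<subseteq> B \<Longrightarrow> A \<inter> A' = {} \<Longrightarrow> l (A \<union> A') = l A + l A'"
  obtains M where "space M = stone_space B" "finite_measure M"
    "\<And>A. A \<subseteq> B \<Longrightarrow> stone_set B A \<in> sets M" "\<And>A. A \<subseteq> B \<Longrightarrow> measure M (stone_set B A) = l A"
proof -
  define R where "R = stone_set B ` Pow B"
  define f where "f S = ennreal (l (the_inv_into (Pow B) (stone_set B) S))" for S
  have inj: "inj_on (stone_set B) (Pow B)"
    by (intro inj_onI stone_set_inj[of _ B]) auto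
  have f: "f (stone_set B A) = ennreal (l A)" if "A \<subseteq> B" for A
    unfolding f_def using that by (subst the_inv_into_f_f[OF inj]) auto
  have empty: "l {} = 0" using add[of "{}" "{}"] by simp
  interpret R: ring_of_sets "stone_space B" R
  proof (rule ring_of_setsI)
    show "R \<subseteq> Pow (stone_space B)" by (auto simp: R_def stone_set_def)
    show "{} \<in> R" unfolding R_def by (rule image_eqI[of _ _ "{}"]) auto
    fix a b assume "a \<in> R" "b \<in> R"
    then obtain A A' where "A \<subseteq> B" "A' \<subseteq> B" "a = stone_set B A" "b = stone_set B A'"
      by (auto simp: R_def)
    then show "a \<union> b \<in> R" "a - b \<in> R"
      by (auto simp: R_def simp flip: stone_set_Un stone_set_Diff)
  qed
  have "\<exists>\<mu>. (\<forall>s\<in>R. \<mu> s = f s) \<and> measure_space (stone_space B) (sigma_sets (stone_space B) R) \<mu>"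
  proof (rule R.caratheodory_empty_continuous)
    show "positive R f"
      using f[of "{}"] empty by (simp add: positive_def)
    show "additive R f"
      unfolding additive_def
    proof (intro ballI impI)
      fix a b assume "a \<in> R" "b \<in> R" and ab: "a \<inter> b = {}"
      then obtain A A' where A: "A \<subseteq> B" "A' \<subseteq> B" "a = stone_set B A" "b = stone_set B A'"
        by (auto simp: R_def)
      have "stone_set B (A \<inter> A') = stone_set B {}"
        using ab A by (simp add: stone_set_Int)
      then have "A \<inter> A' = {}"
        using A by (intro stone_set_inj[of _ B]) auto
      then show "f (a \<union> b) = f a + f b"
        using A f[of "A \<union> A'"] f add nonneg by (simp add: stone_set_Un)
    qed
    show "f A \<noteq> \<infinity>" if "A \<in> R" for A
      by (simp add: f_def)
    fix S :: "nat \<Rightarrow> 'a filter set" assume S: "range S \<subseteq> R" "decseq S" "(\<Inter>i. S i) = {}"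
    have "\<exists>A. A \<subseteq> B \<and> S i = stone_set B A" for i
    proof -
      have "S i \<in> R" using S(1) by auto
      then show ?thesis by (auto simp: R_def)
    qed
    then obtain A where A: "\<And>i. A i \<subseteq> B" "\<And>i. S i = stone_set B (A i)" by metis
    have "A j \<subseteq> A i" if "i \<le> j" for i j
    proof -
      have "S j \<subseteq> S i" using S(2) that by (simp add: decseq_def)
      then have "stone_set B (A i \<inter> A j) = stone_set B (A j)"
        unfolding A(2) stone_set_Int by blast
      moreover have "A i \<inter> A j \<subseteq> B" using A(1)[of i] by blast
      ultimately have "A i \<inter> A j = A j" using stone_set_inj A(1) by metis
      then show ?thesis by blast
    qed
    then have dec: "decseq A" by (simp add: decseq_def)
    have "(\<Inter>i. stone_set B (A i)) = {}"
      using S(3) A(2) by simp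
    then obtain i where i: "A i = {}"
      using stone_set_decseq_empty[OF dec A(1)] by blast
    have "f (S j) = 0" if "i \<le> j" for j
    proof -
      have "A j = {}" using dec that i unfolding decseq_def by blast
      then show ?thesis using f[of "{}"] empty A(2)[of j] by simp
    qed
    then have "eventually (\<lambda>j. f (S j) = 0) sequentially"
      unfolding eventually_sequentially by blast
    then show "(\<lambda>j. f (S j)) \<longlonglongrightarrow> 0"
      by (rule tendsto_eventually)
  qed
  then obtain \<mu> where mu: "\<And>s. s \<in> R \<Longrightarrow> \<mu> s = f s"
    and ms: "measure_space (stone_space B) (sigma_sets (stone_space B) R) \<mu>"
    by blast
  define M where "M = measure_of (stone_space B) R \<mu>"
  have RP: "R \<subseteq> Pow (stone_space B)" by (auto simp: R_def stone_set_def)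
  have em: "emeasure M S = \<mu> S" if "S \<in> R" for S
    unfolding M_def using that ms RP
    by (intro emeasure_measure_of[OF refl]) (auto simp: measure_space_def sets_measure_of)
  show ?thesis
  proof
    show sp: "space M = stone_space B" unfolding M_def using RP by (rule space_measure_of)
    have sR: "stone_set B A \<in> R" if "A \<subseteq> B" for A using that by (simp add: R_def)
    show "stone_set B A \<in> sets M" if "A \<subseteq> B" for A
      unfolding M_def using sR[OF that] RP by (simp add: sets_measure_of)
    show "measure M (stone_set B A) = l A" if "A \<subseteq> B" for A
      using em[OF sR[OF that]] mu[OF sR[OF that]] f[OF that] nonneg[OF that] by (simp add: measure_def)
    show "finite_measure M"
      using em[OF sR[of B]] mu[OF sR[of B]] f[of B] sp by (intro finite_measureI) simp
  qed
qed

lemma stone_limit_exists: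
  fixes \<phi> :: "'a \<Rightarrow> real"
  assumes "\<And>x. x \<in> B \<Longrightarrow> \<bar>\<phi> x\<bar> \<le> C" and F: "F \<in> stone_space B"
  shows "(\<phi> \<longlongrightarrow> Lim F \<phi>) F" "\<bar>Lim F \<phi>\<bar> \<le> C"
proof -
  have ev: "eventually (\<lambda>x. \<bar>\<phi> x\<bar> \<le> C) F"
    using F assms(1) by (auto simp: stone_space_def elim: eventually_mono)
  obtain L where L: "(\<phi> \<longlongrightarrow> L) F" "\<bar>L\<bar> \<le> C"
    using F ev ultrafilter_bounded_limit[of F \<phi> C] by (auto simp: stone_space_def)
  moreover have "Lim F \<phi> = L"
    using F L(1) by (intro tendsto_Lim) (auto simp: stone_space_def dest: ultrafilter_not_bot)
  ultimately show "(\<phi> \<longlongrightarrow> Lim F \<phi>) F" "\<bar>Lim F \<phi>\<bar> \<le> C" by auto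
qed

lemma stone_limit_measurable:
  fixes \<phi> :: "'a \<Rightarrow> real"
  assumes M: "space M = stone_space B" "\<And>A. A \<subseteq> B \<Longrightarrow> stone_set B A \<in> sets M"
    and b: "\<And>x. x \<in> B \<Longrightarrow> \<bar>\<phi> x\<bar> \<le> C"
  shows "(\<lambda>F. Lim F \<phi>) \<in> borel_measurable M"
proof (rule borel_measurableI_greater)
  fix y
  have "{F\<in>space M. y < Lim F \<phi>} = (\<Union>n. stone_set B {x\<in>B. y + 1 / real (Suc n) \<le> \<phi> x})"
  proof (intro set_eqI iffI)
    fix F assume F: "F \<in> {F\<in>space M. y < Lim F \<phi>}"
    then have FB: "F \<in> stone_space B" using M by simp
    obtain n where "1 / real (Suc n) < Lim F \<phi> - y"
      using F nat_approx_posE[of "Lim F \<phi> - y"] by auto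
    then have "eventually (\<lambda>x. y + 1 / real (Suc n) < \<phi> x) F"
      using stone_limit_exists(1)[of B \<phi> C, OF b FB] by (intro order_tendstoD(1)) auto
    moreover have "eventually (\<lambda>x. x \<in> B) F" using FB by (simp add: stone_space_def)
    ultimately have "eventually (\<lambda>x. x \<in> {x\<in>B. y + 1 / real (Suc n) \<le> \<phi> x}) F"
      by eventually_elim auto
    then show "F \<in> (\<Union>n. stone_set B {x\<in>B. y + 1 / real (Suc n) \<le> \<phi> x})"
      using FB by (auto simp: stone_set_def)
  next
    fix F assume "F \<in> (\<Union>n. stone_set B {x\<in>B. y + 1 / real (Suc n) \<le> \<phi> x})"
    then obtain n where FB: "F \<in> stone_space B"
      and ev: "eventually (\<lambda>x. x \<in> {x\<in>B. y + 1 / real (Suc n) \<le> \<phi> x}) F"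
      by (auto simp: stone_set_def)
    have "F \<noteq> bot" using FB ultrafilter_not_bot by (auto simp: stone_space_def)
    moreover have "eventually (\<lambda>x. y + 1 / real (Suc n) \<le> \<phi> x) F"
      using ev by eventually_elim simp
    ultimately have "y + 1 / real (Suc n) \<le> Lim F \<phi>"
      using stone_limit_exists(1)[of B \<phi> C, OF b FB] by (intro tendsto_lowerbound)
    moreover have "0 < 1 / real (Suc n)" by simp
    ultimately have "y < Lim F \<phi>" by linarith
    then show "F \<in> {F\<in>space M. y < Lim F \<phi>}" using FB M by simp
  qed
  also have "\<dots> \<in> sets M" using M by (intro sets.countable_UN) auto
  finally show "{F\<in>space M. y < Lim F \<phi>} \<in> sets M" .
qed

section \<open>Means and Goldstine's theorem\<close>

lemma sum_fun_apply:
  fixes f :: "'i \<Rightarrow> 'a \<Rightarrow> 'b::comm_monoid_add"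
  shows "(\<Sum>i\<in>I. f i) x = (\<Sum>i\<in>I. f i x)"
  by (induction I rule: infinite_finite_induct) auto

lemma Goldstine_finite:
  fixes J :: "'x::real_normed_vector \<Rightarrow> 'y::real_normed_vector dual" and u :: "'x dual"
  assumes J: "linear J" "\<And>x. norm (J x) = norm x" and F: "finite F" and e: "0 < e"
  obtains y where "norm y \<le> norm u + 1" "\<And>x. x \<in> F \<Longrightarrow> \<bar>u x - J x y\<bar> < e"
proof -
  define K where "K = (norm u + 1) / e"
  have K: "0 < K" using e by (simp add: K_def add_nonneg_pos)
  define r where "r v y = norm y + K * (\<Sum>x\<in>F. \<bar>v x - J x y\<bar>)" for v :: "'x \<Rightarrow> real" and y
  define q where "q v = (INF y. r v y)" for v
  have r0: "0 \<le> r v y" for v y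
    using K by (auto simp: r_def intro!: add_nonneg_nonneg mult_nonneg_nonneg sum_nonneg)
  have ql: "q v \<le> r v y" for v y
    unfolding q_def using r0 by (intro cINF_lower bdd_belowI2[of _ 0]) auto
  have "sublinear_on UNIV q"
    unfolding sublinear_on_def
  proof (intro conjI ballI allI impI)
    fix v w
    have "q (v + w) \<le> r v y + r w z" for y z
    proof -
      have "q (v + w) \<le> r (v + w) (y + z)" by (rule ql)
      also have "\<dots> \<le> (norm y + norm z) + K * (\<Sum>x\<in>F. \<bar>v x - J x y\<bar> + \<bar>w x - J x z\<bar>)"
        unfolding r_def using K
        by (intro add_mono norm_triangle_ineq mult_left_mono sum_mono)
          (auto simp: blinfun.add_right)
      finally show ?thesis by (simp add: r_def sum.distrib algebra_simps)
    qed
    then show "q (v + w) \<le> q v + q w"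
      unfolding q_def[of v] q_def[of w] by (intro le_add_cINF) auto
  next
    fix v and c :: real assume c: "0 \<le> c"
    have "q (c *\<^sub>R v) \<le> c * r v y" for y
    proof -
      have "\<bar>c * v x - J x (c *\<^sub>R y)\<bar> = c * \<bar>v x - J x y\<bar>" for x
        using c by (simp add: blinfun.scaleR_right abs_mult flip: right_diff_distrib)
      then have "r (c *\<^sub>R v) (c *\<^sub>R y) = c * r v y"
        using c by (simp add: r_def scaleR_fun_def algebra_simps sum_distrib_left)
      then show ?thesis using ql by metis
    qed
    then show "q (c *\<^sub>R v) \<le> c * q v"
      unfolding q_def[of v] using c by (intro le_scaled_cINF) auto
  qed
  then obtain L where L: "\<And>v w. L (v + w) = L v + L w" "\<And>c v. L (c *\<^sub>R v) = c * L v"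
    "\<And>v. L v \<le> q v" "L (blinfun_apply u) = q (blinfun_apply u)"
    by (rule Hahn_Banach_sublinear[OF subspace_UNIV _ UNIV_I]) auto
  have Lneg: "L (- v) = - L v" for v using L(2)[of "-1" v] by simp
  define b where "b x = L (indicator {x})" for x
  define z where "z = (\<Sum>x\<in>F. b x *\<^sub>R x)"
  have Lsum: "L (\<Sum>x\<in>G. g x) = (\<Sum>x\<in>G. L (g x))" if "finite G" for G and g :: "'x \<Rightarrow> 'x \<Rightarrow> real"
    using that
  proof induction
    case empty
    then show ?case using L(2)[of 0 0] by (simp add: zero_fun_def)
  next
    case (insert x F)
    then show ?case unfolding sum.insert[OF insert(1,2)] L(1) by simp
  qed
  have Lzero: "L v \<le> 0" if "\<And>x. x \<in> F \<Longrightarrow> v x = 0" for v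
    using L(3)[of v] ql[of v 0] that by (simp add: r_def)
  have Lrep: "L v = (\<Sum>x\<in>F. v x * b x)" for v
  proof -
    let ?w = "\<Sum>x\<in>F. v x *\<^sub>R indicator {x} :: 'x \<Rightarrow> real"
    have w: "?w x = v x" if "x \<in> F" for x
    proof -
      have "?w x = (\<Sum>y\<in>F. v y * indicator {y} x)"
        by (simp add: sum_fun_apply scaleR_fun_def)
      also have "\<dots> = (\<Sum>y\<in>F. if y = x then v y else 0)"
        by (intro sum.cong) (auto simp: indicator_def)
      finally show ?thesis using F that by simp
    qed
    have "L (v + - ?w) \<le> 0" "L (- (v + - ?w)) \<le> 0"
      using w by (intro Lzero; simp)+
    then have "L v = L ?w"
      unfolding Lneg L(1) by simp
    then show ?thesis using F by (simp add: Lsum L(2) b_def)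
  qed
  have Jz: "J z y = (\<Sum>x\<in>F. J x y * b x)" for y
    by (simp add: z_def linear_sum[OF J(1)] linear_scale[OF J(1)] blinfun.sum_left
        blinfun.scaleR_left mult.commute)
  have le: "J z y \<le> norm y" for y
    using L(3)[of "\<lambda>x. J x y"] ql[of "\<lambda>x. J x y" y] Lrep[of "\<lambda>x. J x y"] by (simp add: Jz r_def)
  have "norm (J z) \<le> 1"
  proof (rule norm_blinfun_bound)
    show "norm (J z y) \<le> 1 * norm y" for y
      using le[of y] le[of "- y"] by (simp add: blinfun.minus_right abs_le_iff)
  qed simp
  then have z: "norm z \<le> 1" by (simp add: J(2))
  have "q u = u z"
    using L(4) Lrep[of u] by (simp add: z_def blinfun.sum_right blinfun.scaleR_right mult.commute)
  also have "\<dots> \<le> norm u * norm z"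
    using norm_blinfun[of u z] by (simp add: abs_le_iff)
  also have "\<dots> \<le> norm u" using z by (simp add: mult_left_le)
  finally have "q u < norm u + 1" by simp
  then obtain y where y: "r u y < norm u + 1"
    unfolding q_def using cINF_greatest[of UNIV "norm u + 1" "r u"] by (meson UNIV_not_empty linorder_not_less)
  have s: "0 \<le> (\<Sum>x\<in>F. \<bar>u x - J x y\<bar>)" by (simp add: sum_nonneg)
  show ?thesis
  proof
    show "norm y \<le> norm u + 1"
      using y mult_nonneg_nonneg[OF less_imp_le[OF K] s] by (simp add: r_def)
    fix x assume "x \<in> F"
    then have "\<bar>u x - J x y\<bar> \<le> (\<Sum>x\<in>F. \<bar>u x - J x y\<bar>)"
      using F by (intro member_le_sum) auto
    then have "K * \<bar>u x - J x y\<bar> \<le> K * (\<Sum>x\<in>F. \<bar>u x - J x y\<bar>)"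
      using K by (intro mult_left_mono) auto
    moreover have "K * (\<Sum>x\<in>F. \<bar>u x - J x y\<bar>) < norm u + 1"
      using y norm_ge_zero[of y] unfolding r_def by linarith
    ultimately have "K * \<bar>u x - J x y\<bar> < norm u + 1"
      by linarith
    also have "norm u + 1 = K * e" using e by (simp add: K_def)
    finally show "\<bar>u x - J x y\<bar> < e" using K by simp
  qed
qed

definition bounded_functions :: "'a set \<Rightarrow> ('a \<Rightarrow> real) set" where
  "bounded_functions B = {\<phi>. \<exists>C. \<forall>x\<in>B. \<bar>\<phi> x\<bar> \<le> C}"

lemma bounded_functionsI: "(\<And>x. x \<in> B \<Longrightarrow> \<bar>\<phi> x\<bar> \<le> C) \<Longrightarrow> \<phi> \<in> bounded_functions B"
  by (auto simp: bounded_functions_def)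

lemma bounded_functions_bdd:
  "\<phi> \<in> bounded_functions B \<Longrightarrow> bdd_above (\<phi> ` B)"
  by (force simp: bounded_functions_def abs_le_iff intro: bdd_aboveI2)

lemma subspace_bounded_functions: "subspace (bounded_functions B)"
  unfolding subspace_def
proof (intro conjI ballI allI)
  show "0 \<in> bounded_functions B" by (rule bounded_functionsI[of _ _ 0]) simp
next
  fix \<phi> \<psi> assume "\<phi> \<in> bounded_functions B" "\<psi> \<in> bounded_functions B"
  then obtain C D where "\<forall>x\<in>B. \<bar>\<phi> x\<bar> \<le> C" "\<forall>x\<in>B. \<bar>\<psi> x\<bar> \<le> D"
    by (auto simp: bounded_functions_def)
  then show "\<phi> + \<psi> \<in> bounded_functions B"
    by (intro bounded_functionsI[of _ _ "C + D"]) (fastforce intro: abs_triangle_ineq[THEN order_trans] add_mono)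
next
  fix c :: real and \<phi> assume "\<phi> \<in> bounded_functions B"
  then obtain C where "\<forall>x\<in>B. \<bar>\<phi> x\<bar> \<le> C" by (auto simp: bounded_functions_def)
  then show "c *\<^sub>R \<phi> \<in> bounded_functions B"
    by (intro bounded_functionsI[of _ _ "\<bar>c\<bar> * C"]) (auto simp: scaleR_fun_def abs_mult intro: mult_left_mono)
qed

definition mean_on :: "'a set \<Rightarrow> (('a \<Rightarrow> real) \<Rightarrow> real) \<Rightarrow> bool" where
  "mean_on B L \<longleftrightarrow>
     (\<forall>\<phi>\<in>bounded_functions B. \<forall>\<psi>\<in>bounded_functions B. L (\<phi> + \<psi>) = L \<phi> + L \<psi>) \<and>
     (\<forall>\<phi>\<in>bounded_functions B. \<forall>c. L (c *\<^sub>R \<phi>) = c * L \<phi>) \<and>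
     (\<forall>\<phi>\<in>bounded_functions B. \<forall>c. (\<forall>x\<in>B. \<phi> x \<le> c) \<longrightarrow> L \<phi> \<le> c)"

lemma mean_onD:
  assumes "mean_on B L" "\<phi> \<in> bounded_functions B"
  shows "\<psi> \<in> bounded_functions B \<Longrightarrow> L (\<phi> + \<psi>) = L \<phi> + L \<psi>"
    "L (c *\<^sub>R \<phi>) = c * L \<phi>" "(\<And>x. x \<in> B \<Longrightarrow> \<phi> x \<le> c) \<Longrightarrow> L \<phi> \<le> c"
  using assms unfolding mean_on_def by blast+

lemma exists_mean:
  fixes K :: "('a \<Rightarrow> real) set"
  assumes B: "B \<noteq> {}" and KV: "K \<subseteq> bounded_functions B" and K0: "0 \<in> K"
    and Kadd: "\<And>\<phi> \<psi>. \<phi> \<in> K \<Longrightarrow> \<psi> \<in> K \<Longrightarrow> \<phi> + \<psi> \<in> K"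
    and Kscale: "\<And>c \<phi>. 0 \<le> c \<Longrightarrow> \<phi> \<in> K \<Longrightarrow> c *\<^sub>R \<phi> \<in> K"
    and Ksup: "\<And>\<phi>. \<phi> \<in> K \<Longrightarrow> 0 \<le> (SUP x\<in>B. \<phi> x)"
  shows "\<exists>L. mean_on B L \<and> (\<forall>\<phi>\<in>K. 0 \<le> L \<phi>)"
proof -
  let ?V = "bounded_functions B"
  note V = subspace_bounded_functions[of B]
  define s where "s \<phi> = (SUP x\<in>B. \<phi> x)" for \<phi> :: "'a \<Rightarrow> real"
  have s_le: "s \<phi> \<le> c" if "\<And>x. x \<in> B \<Longrightarrow> \<phi> x \<le> c" for \<phi> c
    unfolding s_def using B that by (intro cSUP_least) auto
  have s_ge: "\<phi> x \<le> s \<phi>" if "\<phi> \<in> ?V" "x \<in> B" for \<phi> x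
    unfolding s_def using that by (intro cSUP_upper bounded_functions_bdd) auto
  define q where "q \<phi> = (INF \<kappa>\<in>K. s (\<phi> + \<kappa>))" for \<phi>
  have bdd: "bdd_below ((\<lambda>\<kappa>. s (\<phi> + \<kappa>)) ` K)" if phi: "\<phi> \<in> ?V" for \<phi>
  proof -
    obtain C where C: "\<And>x. x \<in> B \<Longrightarrow> \<bar>\<phi> x\<bar> \<le> C" using phi by (auto simp: bounded_functions_def)
    have "- C \<le> s (\<phi> + \<kappa>)" if k: "\<kappa> \<in> K" for \<kappa>
    proof -
      have "s \<kappa> \<le> s (\<phi> + \<kappa>) + C"
      proof (rule s_le)
        fix x assume x: "x \<in> B"
        have "(\<phi> + \<kappa>) x \<le> s (\<phi> + \<kappa>)"
          by (intro s_ge subspace_add[OF V]) (use k KV phi x in auto)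
        then show "\<kappa> x \<le> s (\<phi> + \<kappa>) + C" using C[OF x] by (simp add: abs_le_iff)
      qed
      then show ?thesis using Ksup[OF k] by (simp add: s_def)
    qed
    then show ?thesis by (rule bdd_belowI2)
  qed
  have ql: "q \<phi> \<le> s (\<phi> + \<kappa>)" if "\<phi> \<in> ?V" "\<kappa> \<in> K" for \<phi> \<kappa>
    unfolding q_def using that bdd by (intro cINF_lower) auto
  have sub: "sublinear_on ?V q"
    unfolding sublinear_on_def
  proof (intro conjI ballI allI impI)
    fix \<phi> \<psi> assume p: "\<phi> \<in> ?V" "\<psi> \<in> ?V"
    have "q (\<phi> + \<psi>) \<le> s (\<phi> + \<kappa>) + s (\<psi> + \<kappa>')" if k: "\<kappa> \<in> K" "\<kappa>' \<in> K" for \<kappa> \<kappa>'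
    proof -
      have "q (\<phi> + \<psi>) \<le> s ((\<phi> + \<psi>) + (\<kappa> + \<kappa>'))"
        by (intro ql subspace_add[OF V] Kadd) (use p k in auto)
      also have "\<dots> \<le> s (\<phi> + \<kappa>) + s (\<psi> + \<kappa>')"
      proof (rule s_le)
        fix x assume x: "x \<in> B"
        have "(\<phi> + \<kappa>) x \<le> s (\<phi> + \<kappa>)" "(\<psi> + \<kappa>') x \<le> s (\<psi> + \<kappa>')"
          by (intro s_ge subspace_add[OF V]; use k KV p x in auto)+
        then show "(\<phi> + \<psi> + (\<kappa> + \<kappa>')) x \<le> s (\<phi> + \<kappa>) + s (\<psi> + \<kappa>')" by simp
      qed
      finally show ?thesis .
    qed
    then show "q (\<phi> + \<psi>) \<le> q \<phi> + q \<psi>"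
      unfolding q_def[of \<phi>] q_def[of \<psi>] using K0 by (intro le_add_cINF) auto
  next
    fix \<phi> and c :: real assume p: "\<phi> \<in> ?V" "0 \<le> c"
    have "q (c *\<^sub>R \<phi>) \<le> c * s (\<phi> + \<kappa>)" if k: "\<kappa> \<in> K" for \<kappa>
    proof -
      have "q (c *\<^sub>R \<phi>) \<le> s (c *\<^sub>R \<phi> + c *\<^sub>R \<kappa>)"
        by (intro ql subspace_scale[OF V] Kscale) (use p k in auto)
      also have "\<dots> \<le> c * s (\<phi> + \<kappa>)"
      proof (rule s_le)
        fix x assume x: "x \<in> B"
        have "(\<phi> + \<kappa>) x \<le> s (\<phi> + \<kappa>)"
          by (intro s_ge subspace_add[OF V]) (use k KV p x in auto)
        then show "(c *\<^sub>R \<phi> + c *\<^sub>R \<kappa>) x \<le> c * s (\<phi> + \<kappa>)"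
          using p(2) by (simp add: scaleR_fun_def mult_left_mono flip: distrib_left)
      qed
      finally show ?thesis .
    qed
    then show "q (c *\<^sub>R \<phi>) \<le> c * q \<phi>"
      unfolding q_def[of \<phi>] using K0 p by (intro le_scaled_cINF) auto
  qed
  obtain L where L: "\<And>\<phi> \<psi>. \<phi> \<in> ?V \<Longrightarrow> \<psi> \<in> ?V \<Longrightarrow> L (\<phi> + \<psi>) = L \<phi> + L \<psi>"
    "\<And>c \<phi>. \<phi> \<in> ?V \<Longrightarrow> L (c *\<^sub>R \<phi>) = c * L \<phi>" "\<And>\<phi>. \<phi> \<in> ?V \<Longrightarrow> L \<phi> \<le> q \<phi>"
    using Hahn_Banach_sublinear[OF V sub subspace_0[OF V]] by metis
  have "L \<phi> \<le> c" if p: "\<phi> \<in> ?V" "\<forall>x\<in>B. \<phi> x \<le> c" for \<phi> c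
  proof -
    have "L \<phi> \<le> s (\<phi> + 0)" using L(3)[OF p(1)] ql[OF p(1) K0] by simp
    also have "\<dots> \<le> c" using p(2) by (intro s_le) auto
    finally show ?thesis .
  qed
  then have "mean_on B L"
    unfolding mean_on_def using L(1,2) by blast
  moreover have "0 \<le> L \<phi>" if k: "\<phi> \<in> K" for \<phi>
  proof -
    have p: "\<phi> \<in> ?V" using k KV by auto
    have "L ((-1) *\<^sub>R \<phi>) \<le> s ((-1) *\<^sub>R \<phi> + \<phi>)"
      using L(3)[OF subspace_scale[OF V p]] ql[OF subspace_scale[OF V p] k] by (rule order_trans)
    also have "\<dots> \<le> 0" by (intro s_le) (simp add: scaleR_fun_def)
    finally show ?thesis using L(2)[OF p, of "-1"] by simp
  qed
  ultimately show ?thesis by blast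
qed

lemma level_count:
  fixes t C :: real
  assumes C: "0 < C" and t: "0 \<le> t" "t \<le> C" and n: "0 < n"
  shows "C / real n * (\<Sum>j=1..n. of_bool (real j * C / real n \<le> t)) \<le> t"
    "t \<le> C / real n * (1 + (\<Sum>j=1..n. of_bool (real j * C / real n \<le> t)))"
proof -
  define s where "s = t * real n / C"
  have s: "0 \<le> s" "s \<le> real n"
    using assms by (auto simp: s_def field_simps)
  have "real j * C / real n \<le> t \<longleftrightarrow> j \<le> nat \<lfloor>s\<rfloor>" for j
  proof -
    have "real j * C / real n \<le> t \<longleftrightarrow> real j \<le> s"
      using C n by (auto simp: s_def field_simps)
    also have "\<dots> \<longleftrightarrow> j \<le> nat \<lfloor>s\<rfloor>" using s(1) by linarith
    finally show ?thesis .
  qed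
  then have "(\<Sum>j=1..n. of_bool (real j * C / real n \<le> t)) = (\<Sum>j=1..n. of_bool (j \<le> nat \<lfloor>s\<rfloor>) :: real)"
    by simp
  also have "\<dots> = real (card ({1..n} \<inter> {j. j \<le> nat \<lfloor>s\<rfloor>}))"
    by (simp add: sum.If_cases of_bool_def)
  also have "{1..n} \<inter> {j. j \<le> nat \<lfloor>s\<rfloor>} = {1..nat \<lfloor>s\<rfloor>}"
    using s by (auto simp: nat_le_iff floor_le_iff) linarith
  finally have eq: "(\<Sum>j=1..n. of_bool (real j * C / real n \<le> t)) = real (nat \<lfloor>s\<rfloor>)"
    by simp
  have ts: "t = C / real n * s" using C n by (simp add: s_def)
  have "real (nat \<lfloor>s\<rfloor>) \<le> s" "s \<le> 1 + real (nat \<lfloor>s\<rfloor>)" using s(1) by linarith+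
  then have "C / real n * real (nat \<lfloor>s\<rfloor>) \<le> C / real n * s"
    "C / real n * s \<le> C / real n * (1 + real (nat \<lfloor>s\<rfloor>))"
    using C by (auto intro!: mult_left_mono simp del: times_divide_eq_left)
  then show "C / real n * (\<Sum>j=1..n. of_bool (real j * C / real n \<le> t)) \<le> t"
    "t \<le> C / real n * (1 + (\<Sum>j=1..n. of_bool (real j * C / real n \<le> t)))"
    unfolding eq ts[symmetric] by auto
qed

text \<open>Equality holds as well, but the inequality suffices for Pietsch domination and follows from
  approximating \<open>\<phi>\<close> from above by its level sets.\<close>

lemma mean_stone_measure:
  fixes L :: "('a \<Rightarrow> real) \<Rightarrow> real"
  assumes L: "mean_on B L"
  shows "\<exists>M. space M = stone_space B \<and> prob_space M \<and> (\<forall>A\<subseteq>B. stone_set B A \<in> sets M) \<and>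
    (\<forall>\<phi> C. (\<forall>x\<in>B. 0 \<le> \<phi> x \<and> \<phi> x \<le> C) \<longrightarrow> L \<phi> \<le> (\<integral>F. Lim F \<phi> \<partial>M))"
proof -
  let ?V = "bounded_functions B"
  note add = mean_onD(1)[OF L] and scale = mean_onD(2)[OF L] and le = mean_onD(3)[OF L]
  note V = subspace_bounded_functions[of B]
  have ge: "c \<le> L \<phi>" if "\<phi> \<in> ?V" "\<And>x. x \<in> B \<Longrightarrow> c \<le> \<phi> x" for \<phi> c
    using le[OF subspace_scale[OF V that(1), of "-1"], of "- c"] that(2) scale[OF that(1), of "-1"]
    by (simp add: scaleR_fun_def)
  have mono: "L \<phi> \<le> L \<psi>" if "\<phi> \<in> ?V" "\<psi> \<in> ?V" "\<And>x. x \<in> B \<Longrightarrow> \<phi> x \<le> \<psi> x" for \<phi> \<psi>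
  proof -
    have "L (\<phi> + (-1) *\<^sub>R \<psi>) \<le> 0"
      using that by (intro le subspace_add[OF V] subspace_scale[OF V]) (auto simp: scaleR_fun_def)
    then show ?thesis using add[OF that(1) subspace_scale[OF V that(2)], of "-1"] scale[OF that(2), of "-1"]
      by simp
  qed
  have ind: "(indicator A :: 'a \<Rightarrow> real) \<in> ?V" for A
    by (rule bounded_functionsI[of _ _ 1]) (auto simp: indicator_def)
  obtain M where M: "space M = stone_space B" "finite_measure M"
    and sM: "\<And>A. A \<subseteq> B \<Longrightarrow> stone_set B A \<in> sets M"
    and mM: "\<And>A. A \<subseteq> B \<Longrightarrow> measure M (stone_set B A) = L (indicator A)"
  proof (rule stone_measure[of B "\<lambda>A. L (indicator A)"])
    show "0 \<le> L (indicator A)" for A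
      by (rule ge[OF ind]) simp
    fix A A' :: "'a set" assume "A \<inter> A' = {}"
    then have "indicator (A \<union> A') = (indicator A + indicator A' :: 'a \<Rightarrow> real)"
      by (auto simp: fun_eq_iff indicator_def)
    then show "L (indicator (A \<union> A')) = L (indicator A) + L (indicator A')"
      using add[OF ind ind] by simp
  qed auto
  interpret finite_measure M by fact
  have one: "L (indicator B) = 1"
    by (intro antisym le[OF ind] ge[OF ind]) auto
  have prob: "prob_space M"
    using mM[of B] one M(1) emeasure_eq_measure by (intro prob_spaceI) simp
  show ?thesis
  proof (intro exI[of _ M] conjI allI impI M(1) prob sM)
    fix \<phi> and C :: real assume phi: "\<forall>x\<in>B. 0 \<le> \<phi> x \<and> \<phi> x \<le> C"
    define D where "D = max C 1"
    have D: "0 < D" "\<And>x. x \<in> B \<Longrightarrow> \<phi> x \<le> D"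
      using phi by (fastforce simp: D_def)+
    have abs: "\<And>x. x \<in> B \<Longrightarrow> \<bar>\<phi> x\<bar> \<le> D" using D phi by (auto simp: abs_le_iff intro: order_trans[of _ 0])
    have phiV: "\<phi> \<in> ?V" using abs by (rule bounded_functionsI)
    let ?h = "\<lambda>F. Lim F \<phi>"
    have hm: "?h \<in> borel_measurable M"
      using stone_limit_measurable[OF M(1) sM abs] .
    have hb: "\<bar>?h F\<bar> \<le> D" if "F \<in> space M" for F
      using stone_limit_exists(2)[OF abs] that M(1) by simp
    have hge: "a \<le> ?h F" if "F \<in> stone_set B {x\<in>B. a \<le> \<phi> x}" for a F
    proof -
      have F: "F \<in> stone_space B" and ev: "eventually (\<lambda>x. x \<in> {x\<in>B. a \<le> \<phi> x}) F"
        using that by (auto simp: stone_set_def)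
      have "F \<noteq> bot" using F ultrafilter_not_bot by (auto simp: stone_space_def)
      moreover have "eventually (\<lambda>x. a \<le> \<phi> x) F" using ev by eventually_elim simp
      ultimately show ?thesis
        using stone_limit_exists(1)[of B \<phi> D, OF abs F] by (intro tendsto_lowerbound)
    qed
    have h0: "0 \<le> ?h F" if "F \<in> space M" for F
    proof (rule hge)
      have "{x\<in>B. 0 \<le> \<phi> x} = B" using phi by auto
      then show "F \<in> stone_set B {x\<in>B. 0 \<le> \<phi> x}" using that M(1) by simp
    qed
    have hint: "integrable M ?h"
      using hm hb by (intro integrable_const_bound[of _ D]) auto
    have main: "L \<phi> \<le> D / real n + integral\<^sup>L M ?h" if n: "0 < n" for n
    proof -
      define A where "A j = {x\<in>B. real j * D / real n \<le> \<phi> x}" for j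
      let ?g = "(D / real n) *\<^sub>R (indicator B + (\<Sum>j=1..n. indicator (A j))) :: 'a \<Rightarrow> real"
      have AB: "A j \<subseteq> B" for j by (auto simp: A_def)
      have sumV: "(\<Sum>j\<in>I. indicator (A j) :: 'a \<Rightarrow> real) \<in> ?V" for I
        using subspace_sum[OF V, of I "\<lambda>j. indicator (A j)"] ind by simp
      have "L \<phi> \<le> L ?g"
      proof (rule mono[OF phiV])
        show "?g \<in> ?V" by (intro subspace_scale[OF V] subspace_add[OF V] sumV ind)
        fix x assume x: "x \<in> B"
        have "indicator (A j) x = (of_bool (real j * D / real n \<le> \<phi> x) :: real)" for j
          using x by (simp add: A_def indicator_def)
        then show "\<phi> x \<le> ?g x"
          using level_count(2)[of D "\<phi> x" n] D phi x n by (simp add: scaleR_fun_def sum_fun_apply)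
      qed
      also have "L ?g = D / real n * (L (indicator B) + L (\<Sum>j=1..n. indicator (A j)))"
        by (subst scale[OF subspace_add[OF V ind sumV]], subst add[OF ind sumV]) simp
      also have "L (\<Sum>j\<in>{1..n}. indicator (A j)) = (\<Sum>j=1..n. L (indicator (A j)))"
      proof (induction n)
        case 0
        then show ?case using scale[OF subspace_0[OF V], of 0] by (simp add: zero_fun_def)
      next
        case (Suc n)
        have "L (\<Sum>j=1..Suc n. indicator (A j)) = L ((\<Sum>j=1..n. indicator (A j)) + indicator (A (Suc n)))"
          by simp
        also have "\<dots> = L (\<Sum>j=1..n. indicator (A j)) + L (indicator (A (Suc n)))"
          by (rule add[OF sumV ind])
        also have "\<dots> = (\<Sum>j=1..Suc n. L (indicator (A j)))"
          unfolding Suc by simp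
        finally show ?case .
      qed
      also have "\<dots> = (\<Sum>j=1..n. measure M (stone_set B (A j)))" using mM[OF AB] by simp
      also have "\<dots> = (\<integral>F. (\<Sum>j=1..n. indicator (stone_set B (A j)) F) \<partial>M)"
        using sM[OF AB] by (subst Bochner_Integration.integral_sum) (auto intro!: integrable_real_indicator simp: less_top[symmetric])
      finally have "L \<phi> \<le> D / real n + D / real n * (\<integral>F. (\<Sum>j=1..n. indicator (stone_set B (A j)) F) \<partial>M)"
        using one by (simp add: algebra_simps)
      also have "D / real n * (\<integral>F. (\<Sum>j=1..n. indicator (stone_set B (A j)) F) \<partial>M)
          = (\<integral>F. D / real n * (\<Sum>j=1..n. indicator (stone_set B (A j)) F) \<partial>M)"
        by simp
      also have "\<dots> \<le> integral\<^sup>L M ?h"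
      proof (rule integral_mono)
        show "integrable M (\<lambda>F. D / real n * (\<Sum>j=1..n. indicator (stone_set B (A j)) F))"
          using sM[OF AB] by (intro integrable_mult_right Bochner_Integration.integrable_sum integrable_real_indicator)
            (auto simp: less_top[symmetric])
        fix F assume F: "F \<in> space M"
        have "(\<Sum>j=1..n. indicator (stone_set B (A j)) F :: real) \<le> (\<Sum>j=1..n. of_bool (real j * D / real n \<le> ?h F))"
          using hge by (intro sum_mono) (auto simp: indicator_def A_def)
        then have "D / real n * (\<Sum>j=1..n. indicator (stone_set B (A j)) F)
            \<le> D / real n * (\<Sum>j=1..n. of_bool (real j * D / real n \<le> ?h F))"
          using D by (intro mult_left_mono) auto
        also have "\<dots> \<le> ?h F"
          using level_count(1)[of D "?h F" n] D h0[OF F] hb[OF F] n by (simp add: abs_le_iff)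
        finally show "D / real n * (\<Sum>j=1..n. indicator (stone_set B (A j)) F) \<le> ?h F" .
      qed (rule hint)
      finally show ?thesis by simp
    qed
    have "(\<lambda>n. D / real n + integral\<^sup>L M ?h) \<longlonglongrightarrow> 0 + integral\<^sup>L M ?h"
      by (intro tendsto_add tendsto_const lim_const_over_n)
    then have "L \<phi> \<le> 0 + integral\<^sup>L M ?h"
      by (rule LIMSEQ_le_const) (use main in \<open>auto intro!: exI[of _ 1]\<close>)
    then show "L \<phi> \<le> integral\<^sup>L M ?h" by simp
  qed auto
qed

section \<open>The dual of L1\<close>

lemma (in finite_measure) integrable_indicator_real:
  "E \<in> sets M \<Longrightarrow> integrable M (indicator E :: 'a \<Rightarrow> real)"
  by (intro integrable_real_indicator) (auto simp: less_top[symmetric])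

lemma (in finite_measure) AE_ge_if_set_integrals_ge:
  fixes g :: "'a \<Rightarrow> real"
  assumes g: "integrable M g" and G: "G \<in> sets M"
    and ge: "\<And>E. E \<in> sets M \<Longrightarrow> E \<subseteq> G \<Longrightarrow> c * measure M E \<le> (\<integral>x. indicator E x * g x \<partial>M)"
  shows "AE x in M. x \<in> G \<longrightarrow> c \<le> g x"
proof -
  define E where "E = {x\<in>space M. g x < c} \<inter> G"
  have E: "E \<in> sets M" unfolding E_def using g G by measurable
  have iE: "integrable M (indicator E :: 'a \<Rightarrow> real)"
    using E by (rule integrable_indicator_real)
  have igE: "integrable M (\<lambda>x. indicator E x * g x)"
    using integrable_mult_indicator[OF E g] by simp
  let ?f = "\<lambda>x. c * indicator E x - indicator E x * g x"
  have int: "integrable M ?f" using iE igE by simp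
  have nn: "AE x in M. 0 \<le> ?f x"
    by (intro AE_I2) (auto simp: E_def indicator_def)
  have "integral\<^sup>L M ?f = c * measure M E - (\<integral>x. indicator E x * g x \<partial>M)"
    using iE igE E by simp
  also have "\<dots> \<le> 0" using ge[OF E] by (simp add: E_def)
  finally have "integral\<^sup>L M ?f = 0" using integral_nonneg_AE[OF nn] by simp
  then have "AE x in M. ?f x = 0" using integral_nonneg_eq_0_iff_AE[OF int nn] by simp
  with AE_space show ?thesis
    by eventually_elim (auto simp: E_def indicator_def split: if_splits)
qed

lemma (in finite_measure) additive_imp_measure:
  fixes \<nu> :: "'a set \<Rightarrow> real"
  assumes nonneg: "\<And>A. A \<in> sets M \<Longrightarrow> 0 \<le> \<nu> A"
    and le: "\<And>A. A \<in> sets M \<Longrightarrow> \<nu> A \<le> C * measure M A"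
    and add: "\<And>A B. A \<in> sets M \<Longrightarrow> B \<in> sets M \<Longrightarrow> A \<inter> B = {} \<Longrightarrow> \<nu> (A \<union> B) = \<nu> A + \<nu> B"
  obtains N where "sets N = sets M" "finite_measure N" "\<And>A. A \<in> sets M \<Longrightarrow> measure N A = \<nu> A"
proof -
  define N where "N = measure_of (space M) (sets M) (\<lambda>A. ennreal (\<nu> A))"
  have empty: "\<nu> {} = 0"
    using le[of "{}"] nonneg[of "{}"] by simp
  have ca: "countably_additive (sets M) (\<lambda>A. ennreal (\<nu> A))"
  proof (rule sets.empty_continuous_imp_countably_additive)
    show "positive (sets M) (\<lambda>A. ennreal (\<nu> A))"
      using empty by (simp add: positive_def)
    show "additive (sets M) (\<lambda>A. ennreal (\<nu> A))"
      using add nonneg by (auto simp: additive_def ennreal_plus)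
    fix A :: "nat \<Rightarrow> 'a set"
    assume A: "range A \<subseteq> sets M" "decseq A" "(\<Inter>i. A i) = {}"
    have "(\<lambda>i. measure M (A i)) \<longlonglongrightarrow> measure M (\<Inter>i. A i)"
      using A by (intro finite_Lim_measure_decseq) auto
    then have lim: "(\<lambda>i. C * measure M (A i)) \<longlonglongrightarrow> 0"
      using A by (auto intro: tendsto_mult_right_zero)
    have "(\<lambda>i. \<nu> (A i)) \<longlonglongrightarrow> 0"
      by (rule tendsto_sandwich[OF _ _ tendsto_const lim]) (use A nonneg le in auto)
    then show "(\<lambda>i. ennreal (\<nu> (A i))) \<longlonglongrightarrow> 0"
      using tendsto_ennrealI by fastforce
  qed auto
  have em: "emeasure N A = ennreal (\<nu> A)" if "A \<in> sets M" for A
    unfolding N_def using that ca empty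
    by (intro emeasure_measure_of_sigma) (auto simp: positive_def sets.sigma_algebra_axioms)
  show ?thesis
  proof
    show s: "sets N = sets M" by (simp add: N_def)
    show "finite_measure N"
      using em[of "space M"] s by (intro finite_measureI) (simp add: N_def)
    show "measure N A = \<nu> A" if "A \<in> sets M" for A
      using em[OF that] nonneg[OF that] by (simp add: measure_def)
  qed
qed

text \<open>Radon-Nikodym is applied to the nonnegative set function
  \<open>A \<mapsto> l (indicator A) + C * measure M A\<close>.\<close>

lemma (in finite_measure) L1_dual_density:
  fixes l :: "('a \<Rightarrow> real) \<Rightarrow> real"
  assumes add: "\<And>f g. integrable M f \<Longrightarrow> integrable M g \<Longrightarrow> l (\<lambda>x. f x + g x) = l f + l g"
    and scale: "\<And>c f. integrable M f \<Longrightarrow> l (\<lambda>x. c * f x) = c * l f"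
    and bound: "\<And>f. integrable M f \<Longrightarrow> \<bar>l f\<bar> \<le> C * (\<integral>x. \<bar>f x\<bar> \<partial>M)"
    and C: "0 \<le> C"
  obtains h where "h \<in> borel_measurable M" "\<And>x. \<bar>h x\<bar> \<le> C"
    "\<And>f. integrable M f \<Longrightarrow> l f = (\<integral>x. f x * h x \<partial>M)"
proof -
  define \<nu> where "\<nu> A = l (indicator A) + C * measure M A" for A
  note ind = integrable_indicator_real
  have lb: "\<bar>l (indicator A)\<bar> \<le> C * measure M A" if "A \<in> sets M" for A
    using bound[OF ind[OF that]] that by simp
  obtain N where N: "sets N = sets M" "finite_measure N"
    and meas: "\<And>A. A \<in> sets M \<Longrightarrow> measure N A = \<nu> A"
  proof (rule additive_imp_measure[of \<nu> "2 * C"])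
    show "0 \<le> \<nu> A" "\<nu> A \<le> 2 * C * measure M A" if "A \<in> sets M" for A
      using lb[OF that] by (auto simp: \<nu>_def abs_le_iff)
    fix A B assume AB: "A \<in> sets M" "B \<in> sets M" "A \<inter> B = {}"
    have "indicator (A \<union> B) = (\<lambda>x. indicator A x + indicator B x :: real)"
      using AB(3) by (auto simp: fun_eq_iff indicator_def)
    then have "l (indicator (A \<union> B)) = l (indicator A) + l (indicator B)"
      using add[OF ind[OF AB(1)] ind[OF AB(2)]] by simp
    then show "\<nu> (A \<union> B) = \<nu> A + \<nu> B"
      using finite_measure_Union[OF AB] by (simp add: \<nu>_def algebra_simps)
  qed auto
  interpret N: finite_measure N by fact
  have "absolutely_continuous M N"
    unfolding absolutely_continuous_def
  proof
    fix A assume A: "A \<in> null_sets M"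
    then have AM: "A \<in> sets M" by auto
    have "measure M A = 0" using A by (simp add: measure_def null_setsD1)
    then have "measure N A = 0"
      using lb[OF AM] meas[OF AM] by (simp add: \<nu>_def)
    then show "A \<in> null_sets N"
      using AM N(1) by (simp add: null_sets_def N.emeasure_eq_measure)
  qed
  then obtain D where D: "D \<in> borel_measurable M" "\<And>x. 0 \<le> D x"
    and RN: "AE x in M. RN_deriv M N x = ennreal (D x)"
    using real_RN_deriv[OF N(2) _ N(1)] by metis
  have "density M (RN_deriv M N) = N"
    by (rule density_RN_deriv) (use \<open>absolutely_continuous M N\<close> N(1) in auto)
  then have dens: "density M (\<lambda>x. ennreal (D x)) = N"
    using RN D(1) by (subst (asm) density_cong[OF _ _ RN]) auto
  have Dint: "integrable M D"
  proof (rule integrableI_nonneg)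
    have "(\<integral>\<^sup>+x. ennreal (D x) \<partial>M) = emeasure N (space M)"
      using D(1) by (subst dens[symmetric], subst emeasure_density)
        (auto intro!: nn_integral_cong split: split_indicator)
    then show "(\<integral>\<^sup>+x. ennreal (D x) \<partial>M) < \<infinity>"
      using N.emeasure_finite by (simp add: less_top[symmetric])
  qed (use D in auto)
  have Dset: "(\<integral>x. indicator A x * D x \<partial>M) = \<nu> A" if "A \<in> sets M" for A
  proof -
    have "measure N A = (\<integral>x. indicator A x \<partial>N)"
      using that N(1) by simp
    also have "\<dots> = (\<integral>x. D x * indicator A x \<partial>M)"
      using that D by (subst dens[symmetric], subst integral_density) auto
    finally show ?thesis using meas[OF that] by (simp add: mult.commute)
  qed
  define k where "k x = D x - C" for x
  have kint: "integrable M k"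
    unfolding k_def using Dint by auto
  have kset: "(\<integral>x. indicator A x * k x \<partial>M) = l (indicator A)" if A: "A \<in> sets M" for A
  proof -
    have "(\<integral>x. indicator A x * k x \<partial>M) = (\<integral>x. indicator A x * D x - indicator A x * C \<partial>M)"
      by (intro Bochner_Integration.integral_cong) (auto simp: k_def algebra_simps)
    also have "\<dots> = (\<integral>x. indicator A x * D x \<partial>M) - (\<integral>x. indicator A x * C \<partial>M)"
      using A ind[OF A] integrable_mult_indicator[OF A Dint]
      by (intro Bochner_Integration.integral_diff) auto
    finally show ?thesis using Dset[OF A] A by (simp add: \<nu>_def)
  qed
  have AEk: "AE x in M. \<bar>k x\<bar> \<le> C"
  proof -
    have "AE x in M. x \<in> space M \<longrightarrow> 0 \<le> C - k x"
    proof (rule AE_ge_if_set_integrals_ge)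
      show "integrable M (\<lambda>x. C - k x)" using kint by auto
      fix A assume A: "A \<in> sets M"
      have "(\<integral>x. indicator A x * (C - k x) \<partial>M) = (\<integral>x. indicator A x * C - indicator A x * k x \<partial>M)"
        by (intro Bochner_Integration.integral_cong) (auto simp: algebra_simps)
      also have "\<dots> = C * measure M A - l (indicator A)"
        using A ind[OF A] integrable_mult_indicator[OF A kint] kset[OF A]
        by (subst Bochner_Integration.integral_diff) auto
      finally show "0 * measure M A \<le> (\<integral>x. indicator A x * (C - k x) \<partial>M)"
        using lb[OF A] by (simp add: abs_le_iff)
    qed simp
    with AE_space have "AE x in M. 0 \<le> C - k x" by eventually_elim simp
    moreover have "AE x in M. 0 \<le> k x + C"
      using D by (simp add: k_def)
    ultimately show ?thesis by (auto simp: abs_le_iff)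
  qed
  define h where "h x = max (- C) (min C (k x))" for x
  have hk: "AE x in M. h x = k x"
    using AEk by (auto simp: h_def abs_le_iff)
  have hm: "h \<in> borel_measurable M"
    unfolding h_def k_def using D(1) by measurable
  have hb: "\<bar>h x\<bar> \<le> C" for x
    using C by (auto simp: h_def)
  have fh: "integrable M (\<lambda>x. f x * h x)" if "integrable M f" for f
  proof (rule Bochner_Integration.integrable_bound)
    show "integrable M (\<lambda>x. C * f x)" using that by simp
    show "AE x in M. norm (f x * h x) \<le> norm (C * f x)"
    proof (intro AE_I2)
      fix x
      show "norm (f x * h x) \<le> norm (C * f x)"
        using mult_right_mono[OF hb[of x], of "\<bar>f x\<bar>"] C by (simp add: abs_mult mult.commute)
    qed
  qed (use that hm in auto)
  have hset: "(\<integral>x. indicator A x * h x \<partial>M) = l (indicator A)" if "A \<in> sets M" for A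
    using kset[OF that] hk hm kint that
    by (subst integral_cong_AE[where g="\<lambda>x. indicator A x * k x"]) auto
  have "l f = (\<integral>x. f x * h x \<partial>M)" if "integrable M f" for f
    using that
  proof (induction rule: integrable_induct)
    case (base A c)
    have "l (\<lambda>x. indicator A x *\<^sub>R c) = c * l (indicator A)"
      using scale[OF ind[OF base(1)], of c] by (simp add: mult.commute)
    also have "\<dots> = (\<integral>x. c * (indicator A x * h x) \<partial>M)"
      using hset[OF base(1)] by simp
    finally show ?case by (simp add: ac_simps)
  next
    case (add f g)
    then show ?case
      using assms(1)[OF add(1,2)] Bochner_Integration.integral_add[OF fh[OF add(1)] fh[OF add(2)]]
      by (simp add: algebra_simps)
  next
    case (lim f s)
    have L1: "(\<lambda>i. \<integral>x. \<bar>s i x - f x\<bar> \<partial>M) \<longlonglongrightarrow> (\<integral>x. 0 \<partial>M)"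
    proof (rule integral_dominated_convergence)
      show "AE x in M. (\<lambda>i. \<bar>s i x - f x\<bar>) \<longlonglongrightarrow> 0"
        using lim(2) by (intro AE_I2 tendsto_rabs_zero LIM_zero) auto
      show "AE x in M. norm \<bar>s i x - f x\<bar> \<le> 3 * \<bar>f x\<bar>" for i
        using lim(3)[of _ i] by (intro AE_I2) (force simp: abs_if split: if_splits)
    qed (use lim in auto)
    have "(\<lambda>i. l (s i) - l f) \<longlonglongrightarrow> 0"
    proof (rule Lim_null_comparison)
      show "\<forall>\<^sub>F i in sequentially. norm (l (s i) - l f) \<le> C * (\<integral>x. \<bar>s i x - f x\<bar> \<partial>M)"
      proof (intro always_eventually allI)
        fix i
        have "l (\<lambda>x. s i x + (- 1) * f x) = l (s i) + (- 1) * l f"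
          using assms(1)[of "s i" "\<lambda>x. (-1) * f x"] scale[of f "-1"] lim by simp
        then show "norm (l (s i) - l f) \<le> C * (\<integral>x. \<bar>s i x - f x\<bar> \<partial>M)"
          using bound[of "\<lambda>x. s i x + (- 1) * f x"] lim by simp
      qed
      show "(\<lambda>i. C * (\<integral>x. \<bar>s i x - f x\<bar> \<partial>M)) \<longlonglongrightarrow> 0"
        using L1 by (auto intro: tendsto_mult_right_zero)
    qed
    then have 1: "(\<lambda>i. l (s i)) \<longlonglongrightarrow> l f" by (simp add: LIM_zero_iff)
    have "(\<lambda>i. \<integral>x. s i x * h x \<partial>M) \<longlonglongrightarrow> (\<integral>x. f x * h x \<partial>M)"
    proof (rule integral_dominated_convergence)
      show "integrable M (\<lambda>x. C * (2 * \<bar>f x\<bar>))" using lim by auto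
      show "AE x in M. (\<lambda>i. s i x * h x) \<longlonglongrightarrow> f x * h x"
        using lim(2) by (intro AE_I2 tendsto_intros) auto
      show "AE x in M. norm (s i x * h x) \<le> C * (2 * \<bar>f x\<bar>)" for i
      proof (intro AE_I2)
        fix x assume "x \<in> space M"
        then have "\<bar>h x\<bar> * \<bar>s i x\<bar> \<le> C * (2 * \<bar>f x\<bar>)"
          using lim(3)[of x i] hb C by (intro mult_mono) auto
        then show "norm (s i x * h x) \<le> C * (2 * \<bar>f x\<bar>)"
          by (simp add: abs_mult mult.commute)
      qed
    qed (use lim hm in auto)
    then show ?case
      using LIMSEQ_unique[OF 1] lim by simp
  qed
  then show ?thesis using hm hb that by blast
qed

section \<open>Vector measures on the space of coin tossings\<close>

lemma wRNP_over_inj: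
  fixes e :: "'b \<Rightarrow> 'o"
  assumes w: "wRNP_over TYPE('o) TYPE('x::real_normed_vector)" and e: "inj e"
  shows "wRNP_over TYPE('b) TYPE('x)"
  unfolding wRNP_over_def
proof (intro allI impI, elim conjE)
  fix M :: "'b measure" and m :: "'b set \<Rightarrow> 'x"
  assume fin: "finite_measure M" and comp: "complete_measure M"
    and vm: "vector_measure M m" and cont: "continuous_wrt M m" and bv: "has_bounded_variation M m"
  interpret finite_measure M by fact
  interpret complete_measure M by fact
  define N where "N = embed_measure M e"
  define k where "k E = m (e -` E)" for E
  have sp: "space N = e ` space M" by (simp add: N_def space_embed_measure)
  have sN: "sets N = (`) e ` sets M" by (simp add: N_def sets_embed_measure_alt[OF e])
  have emN: "emeasure N (e ` A) = emeasure M A" if "A \<in> sets M" for A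
    unfolding N_def using e that by (rule emeasure_embed_measure_image)
  have vim: "e -` e ` A = A" for A using e by (simp add: inj_vimage_image_eq)
  have pre: "e -` E \<in> sets M" "e ` (e -` E) = E" if "E \<in> sets N" for E
    using that by (auto simp: sN vim)
  have mN: "measure N E = measure M (e -` E)" if "E \<in> sets N" for E
    using emN[OF pre(1)[OF that]] pre(2)[OF that] by (simp add: measure_def)
  have finN: "finite_measure N"
    using emN[of "space M"] sp by (intro finite_measureI) simp
  have compN: "complete_measure N"
  proof
    fix A B assume "A \<subseteq> B" "B \<in> null_sets N"
    then have B: "B \<in> sets N" "emeasure N B = 0" by auto
    have "emeasure M (e -` B) = 0"
      using emN[OF pre(1)[OF B(1)]] pre(2)[OF B(1)] B(2) by simp
    then have "e -` B \<in> null_sets M"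
      using pre(1)[OF B(1)] by (rule null_setsI)
    then have "e -` A \<in> sets M"
      using vimage_mono[OF \<open>A \<subseteq> B\<close>, of e] by (rule complete[rotated])
    moreover have "A \<subseteq> range e"
      using pre(2)[OF B(1)] \<open>A \<subseteq> B\<close> by blast
    then have "e ` (e -` A) = A"
      by (simp add: image_vimage_eq Int_absorb2)
    ultimately show "A \<in> sets N" unfolding sN by (metis image_eqI)
  qed
  have vmN: "vector_measure N k"
    unfolding vector_measure_def
  proof (intro allI impI, elim conjE)
    fix A :: "nat \<Rightarrow> 'o set" assume A: "range A \<subseteq> sets N" "disjoint_family A"
    have "range (\<lambda>n. e -` A n) \<subseteq> sets M"
      using A(1) pre(1) by blast
    moreover have "e -` A i \<inter> e -` A j = {}" if "i \<noteq> j" for i j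
      using A(2) that unfolding disjoint_family_on_def by blast
    then have "disjoint_family (\<lambda>n. e -` A n)"
      unfolding disjoint_family_on_def by blast
    ultimately have "(\<lambda>n. m (e -` A n)) sums m (\<Union>n. e -` A n)"
      using vm unfolding vector_measure_def by blast
    then show "(\<lambda>n. k (A n)) sums k (\<Union>n. A n)" by (simp add: k_def vimage_UN)
  qed
  have contN: "continuous_wrt N k"
    unfolding continuous_wrt_def k_def
    using cont[unfolded continuous_wrt_def] mN pre(1) by metis
  have bvN: "has_bounded_variation N k"
  proof -
    obtain K where K: "\<And>P. finite P \<Longrightarrow> P \<subseteq> sets M \<Longrightarrow> partition_on (space M) P \<Longrightarrow> (\<Sum>E\<in>P. norm (m E)) \<le> K"
      using bv unfolding has_bounded_variation_def by blast
    have "(\<Sum>E\<in>P. norm (k E)) \<le> K" if P: "finite P" "P \<subseteq> sets N" "partition_on (space N) P" for P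
    proof -
      have inj: "inj_on ((-`) e) P"
        by (rule inj_on_inverseI[of _ "(`) e"]) (use pre(2) P(2) in blast)
      have "(\<Sum>E\<in>P. norm (k E)) = (\<Sum>E\<in>(-`) e ` P. norm (m E))"
        by (subst sum.reindex[OF inj]) (simp add: k_def)
      also have "\<dots> \<le> K"
      proof (rule K)
        show "partition_on (space M) ((-`) e ` P)"
        proof (rule partition_onI)
          have "\<Union>P = e ` space M" using P(3) sp by (simp add: partition_on_def)
          then have "e -` \<Union>P = space M" by (simp add: vim)
          then show "\<Union>((-`) e ` P) = space M" by blast
          show "{} \<notin> (-`) e ` P"
          proof
            assume "{} \<in> (-`) e ` P"
            then obtain q where "q \<in> P" "e -` q = {}" by auto
            moreover from this have "q = e ` {}" using pre(2) P(2) by (metis subsetD)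
            ultimately show False using P(3) by (simp add: partition_on_def)
          qed
          fix p p' assume "p \<in> (-`) e ` P" "p' \<in> (-`) e ` P" "p \<noteq> p'"
          then obtain q q' where "q \<in> P" "q' \<in> P" "q \<noteq> q'" "p = e -` q" "p' = e -` q'" by blast
          moreover have "q \<inter> q' = {}"
            using P(3) \<open>q \<in> P\<close> \<open>q' \<in> P\<close> \<open>q \<noteq> q'\<close> unfolding partition_on_def disjoint_def by blast
          ultimately show "disjnt p p'" by (auto simp: disjnt_def)
        qed
      qed (use P pre in auto)
      finally show ?thesis .
    qed
    then show ?thesis unfolding has_bounded_variation_def by blast
  qed
  obtain f where f: "\<And>E. E \<in> sets N \<Longrightarrow> has_Pettis_integral N E f (k E)"
    using w finN compN vmN contN bvN unfolding wRNP_over_def by blast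
  have dN: "N = distr M N e" unfolding N_def by (rule embed_measure_eq_distr[OF e])
  have em: "e \<in> measurable M N" unfolding N_def using e by (rule measurable_embed_measure2)
  have P: "has_Pettis_integral M E (\<lambda>t. f (e t)) (m E)" if E: "E \<in> sets M" for E
    unfolding has_Pettis_integral_def
  proof (intro allI)
    fix u :: "'x dual"
    have EN: "e ` E \<in> sets N" using E by (simp add: sN)
    let ?g = "\<lambda>w. indicator (e ` E) w *\<^sub>R u (f w)"
    have g: "integrable N ?g" "u (k (e ` E)) = integral\<^sup>L N ?g"
      using f[OF EN] unfolding has_Pettis_integral_def set_integrable_def set_lebesgue_integral_def by auto
    have ind: "indicator (e ` E) (e t) = (indicator E t :: real)" for t
      using e by (auto simp: indicator_def inj_image_mem_iff)
    have "integrable (distr M N e) ?g" using g(1) dN by simp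
    then have 1: "integrable M (\<lambda>t. ?g (e t))"
      using em by (rule integrable_distr[rotated])
    have "integral\<^sup>L (distr M N e) ?g = (\<integral>t. ?g (e t) \<partial>M)"
      using em g(1) by (intro integral_distr) auto
    then have 2: "integral\<^sup>L N ?g = (\<integral>t. ?g (e t) \<partial>M)" using dN by simp
    show "set_integrable M E (\<lambda>w. u (f (e w))) \<and> u (m E) = set_lebesgue_integral M E (\<lambda>w. u (f (e w)))"
      using 1 2 g(2) by (simp add: set_integrable_def set_lebesgue_integral_def ind k_def vim)
  qed
  then show "\<exists>f. Pettis_integrable M f \<and> (\<forall>E\<in>sets M. has_Pettis_integral M E f (m E))"
    unfolding Pettis_integrable_def by blast
qed

lemma (in finite_measure) dominated_additive_vector_measure:
  fixes m :: "'a set \<Rightarrow> 'x::real_normed_vector"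
  assumes add: "\<And>A B. A \<in> sets M \<Longrightarrow> B \<in> sets M \<Longrightarrow> A \<inter> B = {} \<Longrightarrow> m (A \<union> B) = m A + m B"
    and le: "\<And>A. A \<in> sets M \<Longrightarrow> norm (m A) \<le> C * measure M A"
  shows "vector_measure M m" "continuous_wrt M m" "has_bounded_variation M m"
proof -
  show "vector_measure M m"
    unfolding vector_measure_def
  proof (intro allI impI, elim conjE)
    fix A :: "nat \<Rightarrow> 'a set" assume A: "range A \<subseteq> sets M" "disjoint_family A"
    define T where "T n = (\<Union>i\<in>{n..}. A i)" for n
    have AM: "A i \<in> sets M" for i using A by auto
    have TM: "T n \<in> sets M" for n unfolding T_def using AM by blast
    have step: "(\<Sum>i<n. m (A i)) + m (T n) = m (\<Union>i. A i)" for n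
    proof (induction n)
      case 0
      then show ?case by (simp add: T_def atLeast_0)
    next
      case (Suc n)
      have "{n..} = insert n {Suc n..}" by auto
      then have "T n = A n \<union> T (Suc n)" by (simp add: T_def)
      moreover have "A n \<inter> A i = {}" if "Suc n \<le> i" for i
        using A(2) that unfolding disjoint_family_on_def by (metis UNIV_I Suc_n_not_le_n)
      then have "A n \<inter> T (Suc n) = {}"
        unfolding T_def by blast
      ultimately have "m (T n) = m (A n) + m (T (Suc n))" using add[OF AM TM] by simp
      then show ?case using Suc by (simp add: algebra_simps)
    qed
    have "decseq T" unfolding decseq_def T_def by (meson UN_mono atLeast_subset_iff order_refl)
    moreover have "(\<Inter>n. T n) = {}"
    proof (rule ccontr)
      assume "(\<Inter>n. T n) \<noteq> {}"
      then obtain x where x: "\<And>n. x \<in> T n" by blast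
      then obtain i where i: "x \<in> A i" by (auto simp: T_def)
      obtain j where "Suc i \<le> j" "x \<in> A j" using x[of "Suc i"] by (auto simp: T_def)
      then show False using i A(2) unfolding disjoint_family_on_def by (metis IntI UNIV_I empty_iff not_less_eq_eq order_refl)
    qed
    ultimately have "(\<lambda>n. measure M (T n)) \<longlonglongrightarrow> 0"
      using finite_Lim_measure_decseq[of T] TM by auto
    then have "(\<lambda>n. C * measure M (T n)) \<longlonglongrightarrow> 0" by (rule tendsto_mult_right_zero)
    then have "(\<lambda>n. m (T n)) \<longlonglongrightarrow> 0"
      by (rule Lim_null_comparison[rotated]) (use le[OF TM] in auto)
    then have "(\<lambda>n. m (\<Union>i. A i) - m (T n)) \<longlonglongrightarrow> m (\<Union>i. A i) - 0"
      by (intro tendsto_intros)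
    moreover have "m (\<Union>i. A i) - m (T n) = (\<Sum>i<n. m (A i))" for n
      using step[of n] by (simp add: algebra_simps)
    ultimately show "(\<lambda>n. m (A n)) sums m (\<Union>n. A n)"
      by (simp add: sums_def)
  qed
  have le': "norm (m A) \<le> (\<bar>C\<bar> + 1) * measure M A" if "A \<in> sets M" for A
  proof -
    have "C * measure M A \<le> (\<bar>C\<bar> + 1) * measure M A" by (intro mult_right_mono) auto
    then show ?thesis using le[OF that] by simp
  qed
  show "continuous_wrt M m"
    unfolding continuous_wrt_def
  proof (intro allI impI)
    fix e :: real assume e: "0 < e"
    show "\<exists>d>0. \<forall>E\<in>sets M. measure M E < d \<longrightarrow> norm (m E) < e"
    proof (intro exI[of _ "e / (\<bar>C\<bar> + 1)"] conjI ballI impI)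
      fix E assume E: "E \<in> sets M" "measure M E < e / (\<bar>C\<bar> + 1)"
      then have "(\<bar>C\<bar> + 1) * measure M E < e" by (simp add: field_simps add_pos_nonneg)
      then show "norm (m E) < e" using le'[OF E(1)] by simp
    qed (use e in \<open>simp add: add_nonneg_pos\<close>)
  qed
  show "has_bounded_variation M m"
    unfolding has_bounded_variation_def
  proof (intro exI allI impI, elim conjE)
    fix P assume P: "finite P" "P \<subseteq> sets M" "partition_on (space M) P"
    have "(\<Sum>E\<in>P. norm (m E)) \<le> (\<Sum>E\<in>P. C * measure M E)"
      using P(2) le by (intro sum_mono) auto
    also have "\<dots> = C * measure M (\<Union>E\<in>P. E)"
      using P unfolding sum_distrib_left[symmetric]
      by (subst finite_measure_finite_Union) (auto simp: partition_on_def disjoint_family_on_def disjoint_def)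
    also have "(\<Union>E\<in>P. E) = space M" using P(3) by (simp add: partition_on_def)
    finally show "(\<Sum>E\<in>P. norm (m E)) \<le> C * measure M (space M)" .
  qed
qed

definition coin0 :: "(nat \<Rightarrow> bool) measure" where
  "coin0 = PiM UNIV (\<lambda>_. uniform_count_measure UNIV)"

definition coin :: "(nat \<Rightarrow> bool) measure" where
  "coin = completion coin0"

definition cylinder :: "nat \<Rightarrow> nat set \<Rightarrow> (nat \<Rightarrow> bool) set" where
  "cylinder n A = {t. \<forall>i<n. t i = (i \<in> A)}"

definition level_set :: "nat \<Rightarrow> (nat \<Rightarrow> bool) set \<Rightarrow> bool" where
  "level_set n T \<longleftrightarrow> (\<forall>t s. (\<forall>i<n. t i = s i) \<longrightarrow> t \<in> T \<longrightarrow> s \<in> T)"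

lemma space_coin0 [simp]: "space coin0 = UNIV"
  by (simp add: coin0_def space_PiM PiE_UNIV_domain space_uniform_count_measure)

lemma space_coin [simp]: "space coin = UNIV"
  by (simp add: coin_def)

interpretation coin0: product_prob_space "\<lambda>_::nat. uniform_count_measure (UNIV::bool set)" UNIV
  by unfold_locales (auto intro!: prob_spaceI simp: emeasure_uniform_count_measure space_uniform_count_measure)

lemma prob_space_coin0: "prob_space coin0"
  unfolding coin0_def by (rule coin0.P.prob_space_axioms)

interpretation coin: prob_space coin
  unfolding coin_def using prob_space_coin0
  by (metis completion.complete_measure_axioms emeasure_completion main_part prob_space.emeasure_space_1 prob_spaceI sets.top sets_completionI_sets space_completion)

interpretation coin: complete_measure coin
  unfolding coin_def by (rule completion.complete_measure_axioms)

lemma sets_coin0_coin: "A \<in> sets coin0 \<Longrightarrow> A \<in> sets coin"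
  by (simp add: coin_def)

lemma measure_coin0_coin: "A \<in> sets coin0 \<Longrightarrow> measure coin A = measure coin0 A"
  by (simp add: coin_def)

lemma sets_coordinate: "{t. t i = b} \<in> sets coin0"
proof -
  have "{t\<in>space coin0. t i \<in> {b}} \<in> sets coin0"
    unfolding coin0_def by (rule measurable_sets_Collect) (auto simp: sets_uniform_count_measure)
  then show ?thesis by simp
qed

lemma cylinder_Suc:
  "cylinder (Suc n) A = cylinder n A \<inter> {t. t n = (n \<in> A)}"
  by (auto simp: cylinder_def less_Suc_eq)

lemma sets_cylinder: "cylinder n A \<in> sets coin0"
proof (induction n)
  case 0
  have "cylinder 0 A = space coin0" by (simp add: cylinder_def)
  then show ?case by (metis sets.top)
next
  case (Suc n)
  then show ?case unfolding cylinder_Suc using sets_coordinate by (rule sets.Int)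
qed

lemma measure_cylinder: "measure coin (cylinder n A) = (1/2) ^ n"
proof -
  let ?U = "uniform_count_measure (UNIV::bool set)"
  have "cylinder n A = {t\<in>space coin0. \<forall>i\<in>{..<n}. t i \<in> {i \<in> A}}"
    by (auto simp: cylinder_def)
  then have "emeasure coin0 (cylinder n A) = (\<Prod>i\<in>{..<n}. emeasure ?U {i \<in> A})"
    unfolding coin0_def by (simp only:) (rule coin0.emeasure_PiM_Collect; simp add: sets_uniform_count_measure)
  also have "\<dots> = (\<Prod>i\<in>{..<n}. ennreal (1/2))"
    by (simp add: emeasure_uniform_count_measure)
  also have "\<dots> = ennreal ((1/2) ^ n)"
    by (simp only: prod_constant card_lessThan) (rule ennreal_power, simp)
  finally show ?thesis
    using measure_coin0_coin[OF sets_cylinder, of n A] by (simp add: measure_def)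
qed

lemma cylinder_disjoint:
  assumes "A \<subseteq> {..<n}" "A' \<subseteq> {..<n}" "A \<noteq> A'"
  shows "cylinder n A \<inter> cylinder n A' = {}"
proof -
  obtain i where "i < n" "(i \<in> A) \<noteq> (i \<in> A')" using assms by blast
  then have "t \<notin> cylinder n A'" if "t \<in> cylinder n A" for t
    using that unfolding cylinder_def mem_Collect_eq by metis
  then show ?thesis by blast
qed

lemma sum_cylinder:
  assumes E: "E \<in> sets coin"
  shows "(\<Sum>A\<in>Pow {..<n}. measure coin (E \<inter> cylinder n A)) = measure coin E"
proof -
  have "(\<Union>A\<in>Pow {..<n}. E \<inter> cylinder n A) = E"
  proof (intro equalityI subsetI)
    fix t assume "t \<in> E"
    then have "t \<in> E \<inter> cylinder n {i. i < n \<and> t i}" by (auto simp: cylinder_def)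
    moreover have "{i. i < n \<and> t i} \<in> Pow {..<n}" by auto
    ultimately show "t \<in> (\<Union>A\<in>Pow {..<n}. E \<inter> cylinder n A)" by (rule UN_I[rotated])
  qed auto
  moreover have "measure coin (\<Union>A\<in>Pow {..<n}. E \<inter> cylinder n A)
      = (\<Sum>A\<in>Pow {..<n}. measure coin (E \<inter> cylinder n A))"
  proof (rule coin.finite_measure_finite_Union)
    show "(\<lambda>A. E \<inter> cylinder n A) ` Pow {..<n} \<subseteq> sets coin"
      using E sets_cylinder sets_coin0_coin by blast
    show "disjoint_family_on (\<lambda>A. E \<inter> cylinder n A) (Pow {..<n})"
      unfolding disjoint_family_on_def using cylinder_disjoint by blast
  qed simp
  ultimately show ?thesis by simp
qed

lemma level_setD: "level_set n T \<Longrightarrow> t \<in> T \<Longrightarrow> (\<And>i. i < n \<Longrightarrow> t i = s i) \<Longrightarrow> s \<in> T"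
  unfolding level_set_def by blast

lemma level_set_mono:
  assumes "level_set n T" "n \<le> k"
  shows "level_set k T"
  unfolding level_set_def
proof (intro allI impI)
  fix t s assume "\<forall>i<k. t i = s i" "t \<in> T"
  then show "s \<in> T" using level_setD[OF assms(1), of t s] assms(2) by simp
qed

lemma level_set_cylinder:
  assumes "level_set n T"
  shows "T \<inter> cylinder n A = {} \<or> T \<inter> cylinder n A = cylinder n A"
proof -
  have "s \<in> T" if "t \<in> T" "t \<in> cylinder n A" "s \<in> cylinder n A" for s t
    using that by (intro level_setD[OF assms that(1)]) (simp add: cylinder_def)
  then show ?thesis by blast
qed

lemma approx_level_set0:
  assumes "E \<in> sets coin0" "0 < e"
  shows "\<exists>n T. level_set n T \<and> T \<in> sets coin0 \<and> measure coin0 ((E - T) \<union> (T - E)) < e"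
proof -
  interpret P: prob_space coin0 by (rule prob_space_coin0)
  let ?G = "{{f \<in> \<Pi>\<^sub>E i\<in>UNIV. space (uniform_count_measure (UNIV::bool set)). f i \<in> A} |i A.
    i \<in> (UNIV::nat set) \<and> A \<in> sets (uniform_count_measure (UNIV::bool set))}"
  have sets: "sets coin0 = sigma_sets UNIV ?G"
    unfolding coin0_def sets_PiM_single by (simp add: space_uniform_count_measure PiE_UNIV_domain)
  have "E \<in> sigma_sets UNIV ?G" using assms(1) sets by simp
  then show ?thesis using assms(2)
  proof (induction arbitrary: e rule: sigma_sets.induct)
    case (Basic a)
    have "a \<in> sigma_sets UNIV ?G" by (rule sigma_sets.Basic[OF Basic(1)])
    then have a: "a \<in> sets coin0" using sets by simp
    obtain i A where "a = {f. f i \<in> A}"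
      using Basic(1) by (auto simp: space_uniform_count_measure PiE_UNIV_domain)
    then have "level_set (Suc i) a" by (auto simp: level_set_def)
    then show ?case using a Basic(2) by (intro exI[of _ "Suc i"] exI[of _ a]) simp
  next
    case Empty
    then show ?case by (intro exI[of _ 0] exI[of _ "{}"]) (simp add: level_set_def)
  next
    case (Compl a)
    obtain n T where T: "level_set n T" "T \<in> sets coin0" "measure coin0 ((a - T) \<union> (T - a)) < e"
      using Compl.IH[OF Compl.prems] by blast
    have "level_set n (UNIV - T)"
      using T(1) unfolding level_set_def by (metis DiffD2 DiffI UNIV_I)
    moreover have "UNIV - T \<in> sets coin0" using T(2) sets.compl_sets[of T coin0] by simp
    moreover have "((UNIV - a) - (UNIV - T)) \<union> ((UNIV - T) - (UNIV - a)) = (a - T) \<union> (T - a)" by blast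
    ultimately show ?case using T(3) by (intro exI[of _ n] exI[of _ "UNIV - T"]) simp
  next
    case (Union a)
    have a: "a i \<in> sets coin0" for i using Union.hyps sets by simp
    define S where "S n = (\<Union>i<n. a i)" for n
    have S: "S n \<in> sets coin0" for n unfolding S_def using a by blast
    have inc: "incseq S" unfolding S_def incseq_def by (meson UN_mono lessThan_subset_iff order_refl)
    have US: "(\<Union>n. S n) = (\<Union>i. a i)" unfolding S_def by blast
    have "(\<lambda>n. measure coin0 (S n)) \<longlonglongrightarrow> measure coin0 (\<Union>i. a i)"
      using P.finite_Lim_measure_incseq[of S] S inc US by auto
    then have "eventually (\<lambda>n. measure coin0 (\<Union>i. a i) - e / 2 < measure coin0 (S n)) sequentially"
      using Union.prems by (intro order_tendstoD(1)) auto
    then obtain N where N: "measure coin0 (\<Union>i. a i) - e / 2 < measure coin0 (S N)"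
      by (auto simp: eventually_sequentially)
    define d where "d = e / (2 * (real N + 1))"
    have d: "0 < d" using Union.prems by (simp add: d_def)
    obtain n T where T: "\<And>i. level_set (n i) (T i)" "\<And>i. T i \<in> sets coin0"
      "\<And>i. measure coin0 ((a i - T i) \<union> (T i - a i)) < d"
      using Union.IH[OF d] by metis
    define k where "k = (\<Sum>i<N. n i)"
    define R where "R = (\<Union>i<N. T i)"
    have R: "R \<in> sets coin0" unfolding R_def using T(2) by blast
    have "level_set k (T i)" if "i < N" for i
      using that by (intro level_set_mono[OF T(1)]) (auto simp: k_def intro!: member_le_sum)
    then have lev: "level_set k R"
      unfolding R_def level_set_def by (metis (no_types, lifting) UN_iff lessThan_iff)
    let ?U = "\<Union>i. a i"
    have U: "?U \<in> sets coin0" using a by blast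
    let ?D = "\<lambda>i. (a i - T i) \<union> (T i - a i)"
    have D: "?D i \<in> sets coin0" for i using a T(2) by blast
    have "(?U - R) \<union> (R - ?U) \<subseteq> (?U - S N) \<union> (\<Union>i<N. ?D i)"
      unfolding R_def S_def by blast
    then have "measure coin0 ((?U - R) \<union> (R - ?U)) \<le> measure coin0 ((?U - S N) \<union> (\<Union>i<N. ?D i))"
      using U S D by (intro P.finite_measure_mono) auto
    also have "\<dots> \<le> measure coin0 (?U - S N) + measure coin0 (\<Union>i<N. ?D i)"
      using U S D by (intro measure_Un_le) auto
    also have "measure coin0 (?U - S N) = measure coin0 ?U - measure coin0 (S N)"
      using U S US by (intro P.finite_measure_Diff) auto
    also have "measure coin0 (\<Union>i<N. ?D i) \<le> (\<Sum>i<N. measure coin0 (?D i))"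
      using D by (intro measure_UNION_le) auto
    also have "\<dots> \<le> (\<Sum>i<N. d)" using T(3) by (intro sum_mono less_imp_le) auto
    also have "\<dots> \<le> e / 2" using Union.prems by (simp add: d_def field_simps)
    finally have "measure coin0 ((?U - R) \<union> (R - ?U)) < e" using N by simp
    then show ?case using lev R by blast
  qed
qed

lemma approx_level_set:
  assumes "E \<in> sets coin" "0 < e"
  obtains n T where "level_set n T" "T \<in> sets coin" "measure coin ((E - T) \<union> (T - E)) < e"
proof -
  interpret P: prob_space coin0 by (rule prob_space_coin0)
  obtain S N N' where E: "E = S \<union> N" "N \<subseteq> N'" "N' \<in> null_sets coin0" "S \<in> sets coin0"
    using assms(1) unfolding coin_def by (rule sets_completionE)
  obtain n T where T: "level_set n T" "T \<in> sets coin0" "measure coin0 ((S - T) \<union> (T - S)) < e"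
    using approx_level_set0[OF E(4) assms(2)] by blast
  let ?D = "(S - T) \<union> (T - S)"
  have "?D \<in> sets coin0" "N' \<in> sets coin0" using E T by auto
  have "measure coin ((E - T) \<union> (T - E)) \<le> measure coin (?D \<union> N')"
    using E T by (intro coin.finite_measure_mono sets_coin0_coin) auto
  also have "\<dots> = measure coin0 (?D \<union> N')"
    using E T by (intro measure_coin0_coin) auto
  also have "\<dots> = measure coin0 ?D"
    using E T by (intro measure_Un_null_set) auto
  finally show ?thesis using that[OF T(1) sets_coin0_coin[OF T(2)]] T(3) by simp
qed

definition tree_sum :: "(nat \<Rightarrow> nat set \<Rightarrow> 'x::real_vector) \<Rightarrow> nat \<Rightarrow> (nat \<Rightarrow> bool) set \<Rightarrow> 'x" where
  "tree_sum W n E = (\<Sum>A\<in>Pow {..<n}. measure coin (E \<inter> cylinder n A) *\<^sub>R W n A)"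

lemma sets_coin_cylinder: "E \<in> sets coin \<Longrightarrow> E \<inter> cylinder n A \<in> sets coin"
  using sets_coin0_coin[OF sets_cylinder] by blast

lemma tree_sum_add:
  assumes "E \<in> sets coin" "F \<in> sets coin" "E \<inter> F = {}"
  shows "tree_sum W n (E \<union> F) = tree_sum W n E + tree_sum W n F"
proof -
  have "measure coin ((E \<union> F) \<inter> cylinder n A) = measure coin (E \<inter> cylinder n A) + measure coin (F \<inter> cylinder n A)" for A
    unfolding Int_Un_distrib2 using assms
    by (intro coin.finite_measure_Union sets_coin_cylinder) auto
  then show ?thesis by (simp add: tree_sum_def scaleR_add_left sum.distrib)
qed

lemma norm_tree_sum_le:
  assumes "E \<in> sets coin" "\<And>A. A \<subseteq> {..<n} \<Longrightarrow> norm (W n A) \<le> C"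
  shows "norm (tree_sum W n E) \<le> C * measure coin E"
proof -
  have "norm (tree_sum W n E) \<le> (\<Sum>A\<in>Pow {..<n}. measure coin (E \<inter> cylinder n A) * C)"
    unfolding tree_sum_def using assms(2) by (intro sum_norm_le) (auto intro!: mult_left_mono)
  also have "\<dots> = C * measure coin E"
    by (simp add: sum_cylinder[OF assms(1)] mult.commute flip: sum_distrib_left)
  finally show ?thesis .
qed

lemma tree_sum_diff_le:
  assumes ET: "E \<in> sets coin" "T \<in> sets coin" and W: "\<And>A. A \<subseteq> {..<n} \<Longrightarrow> norm (W n A) \<le> C"
  shows "norm (tree_sum W n E - tree_sum W n T) \<le> C * measure coin ((E - T) \<union> (T - E))"
proof -
  have "tree_sum W n E = tree_sum W n (E - T) + tree_sum W n (E \<inter> T)"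
    using ET by (subst tree_sum_add[symmetric]) (auto intro: arg_cong[where f="tree_sum W n"])
  moreover have "tree_sum W n T = tree_sum W n (T - E) + tree_sum W n (E \<inter> T)"
    using ET by (subst tree_sum_add[symmetric]) (auto intro: arg_cong[where f="tree_sum W n"])
  ultimately have "norm (tree_sum W n E - tree_sum W n T) = norm (tree_sum W n (E - T) - tree_sum W n (T - E))"
    by simp
  also have "\<dots> \<le> norm (tree_sum W n (E - T)) + norm (tree_sum W n (T - E))"
    by (rule norm_triangle_ineq4)
  also have "\<dots> \<le> C * measure coin (E - T) + C * measure coin (T - E)"
    using ET W by (intro add_mono norm_tree_sum_le) auto
  also have "\<dots> = C * measure coin ((E - T) \<union> (T - E))"
    using ET by (subst coin.finite_measure_Union) (auto simp: distrib_left)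
  finally show ?thesis .
qed

lemma sum_Pow_Suc:
  "(\<Sum>A\<in>Pow {..<Suc n}. g A) = (\<Sum>A\<in>Pow {..<n}. g A + g (insert n A))"
proof -
  have inj: "inj_on (insert n) (Pow {..<n})"
    by (rule inj_on_inverseI[of _ "\<lambda>A. A - {n}"]) auto
  have "(\<Sum>A\<in>Pow {..<Suc n}. g A) = (\<Sum>A\<in>Pow {..<n}. g A) + (\<Sum>A\<in>insert n ` Pow {..<n}. g A)"
    unfolding lessThan_Suc Pow_insert by (rule sum.union_disjoint) auto
  then show ?thesis by (simp add: sum.reindex[OF inj] sum.distrib)
qed

lemma tree_sum_level_set:
  assumes T: "T \<in> sets coin" "level_set n T"
    and mart: "\<And>A. A \<subseteq> {..<n} \<Longrightarrow> W n A = (1/2) *\<^sub>R (W (Suc n) (insert n A) + W (Suc n) A)"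
  shows "tree_sum W (Suc n) T = tree_sum W n T"
proof -
  have half: "measure coin (T \<inter> cylinder (Suc n) A') = measure coin (T \<inter> cylinder n A) / 2"
    if "A' = A \<or> A' = insert n A" "A \<subseteq> {..<n}" for A A'
  proof -
    have sub: "cylinder (Suc n) A' \<subseteq> cylinder n A" using that by (auto simp: cylinder_def)
    from level_set_cylinder[OF T(2), of A] show ?thesis
    proof
      assume e: "T \<inter> cylinder n A = {}"
      then have "T \<inter> cylinder (Suc n) A' = {}" using sub by blast
      then show ?thesis using e by simp
    next
      assume e: "T \<inter> cylinder n A = cylinder n A"
      then have "T \<inter> cylinder (Suc n) A' = cylinder (Suc n) A'" using sub by blast
      then show ?thesis using e by (simp add: measure_cylinder)
    qed
  qed
  have "tree_sum W (Suc n) T = (\<Sum>A\<in>Pow {..<n}. measure coin (T \<inter> cylinder (Suc n) A) *\<^sub>R W (Suc n) A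
      + measure coin (T \<inter> cylinder (Suc n) (insert n A)) *\<^sub>R W (Suc n) (insert n A))"
    unfolding tree_sum_def by (rule sum_Pow_Suc)
  also have "\<dots> = (\<Sum>A\<in>Pow {..<n}. measure coin (T \<inter> cylinder n A) *\<^sub>R W n A)"
  proof (rule sum.cong[OF refl])
    fix A assume "A \<in> Pow {..<n}"
    then have A: "A \<subseteq> {..<n}" by simp
    show "measure coin (T \<inter> cylinder (Suc n) A) *\<^sub>R W (Suc n) A
      + measure coin (T \<inter> cylinder (Suc n) (insert n A)) *\<^sub>R W (Suc n) (insert n A)
      = measure coin (T \<inter> cylinder n A) *\<^sub>R W n A"
      by (simp add: half[OF _ A, of A] half[OF _ A, of "insert n A"] mart[OF A] scaleR_add_right)
  qed
  finally show ?thesis by (simp add: tree_sum_def)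
qed

lemma tree_sum_convergent:
  fixes W :: "nat \<Rightarrow> nat set \<Rightarrow> 'x::banach"
  assumes mart: "\<And>n A. A \<subseteq> {..<n} \<Longrightarrow> W n A = (1/2) *\<^sub>R (W (Suc n) (insert n A) + W (Suc n) A)"
    and bd: "\<And>n A. A \<subseteq> {..<n} \<Longrightarrow> norm (W n A) \<le> C"
    and E: "E \<in> sets coin"
  shows "convergent (\<lambda>n. tree_sum W n E)"
proof (rule Cauchy_convergent, rule CauchyI)
  fix e :: real assume e: "0 < e"
  have C: "0 \<le> C" using bd[of "{}" 0] norm_ge_zero[of "W 0 {}"] by (simp del: norm_ge_zero)
  have "0 < e / (2 * (C + 1))" using e C by simp
  then obtain k T where T: "level_set k T" "T \<in> sets coin"
    and m: "measure coin ((E - T) \<union> (T - E)) < e / (2 * (C + 1))"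
    by (rule approx_level_set[OF E])
  have eqT: "tree_sum W n T = tree_sum W k T" if "k \<le> n" for n
    using that
  proof (induction rule: dec_induct)
    case (step n)
    then show ?case
      using tree_sum_level_set[OF T(2) level_set_mono[OF T(1)], of n W] mart by simp
  qed simp
  have d: "norm (tree_sum W n E - tree_sum W n T) < e / 2" for n
  proof -
    have "norm (tree_sum W n E - tree_sum W n T) \<le> C * measure coin ((E - T) \<union> (T - E))"
      by (rule tree_sum_diff_le[OF E T(2) bd])
    also have "\<dots> \<le> (C + 1) * measure coin ((E - T) \<union> (T - E))"
      by (intro mult_right_mono) auto
    also have "\<dots> < e / 2" using m C by (simp add: field_simps)
    finally show ?thesis .
  qed
  have s: "norm (tree_sum W n E - tree_sum W k T) < e / 2" if "k \<le> n" for n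
    unfolding eqT[OF that, symmetric] by (rule d)
  have "norm (tree_sum W m E - tree_sum W n E) < e" if "k \<le> m" "k \<le> n" for m n
    using norm_diff_triangle_less[OF s[OF that(1)], of "tree_sum W n E" "e / 2"] s[OF that(2)]
      norm_minus_commute[of "tree_sum W n E" "tree_sum W k T"]
    by simp
  then show "\<exists>k. \<forall>m\<ge>k. \<forall>n\<ge>k. norm (tree_sum W m E - tree_sum W n E) < e" by blast
qed

lemma wRNP_tree_density:
  fixes W :: "nat \<Rightarrow> nat set \<Rightarrow> 'x::banach"
  assumes w: "wRNP_over TYPE(nat \<Rightarrow> bool) TYPE('x)"
    and mart: "\<And>n A. A \<subseteq> {..<n} \<Longrightarrow> W n A = (1/2) *\<^sub>R (W (Suc n) (insert n A) + W (Suc n) A)"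
    and bd: "\<And>n A. A \<subseteq> {..<n} \<Longrightarrow> norm (W n A) \<le> C"
  shows "\<exists>f. \<forall>u :: 'x dual. integrable coin (\<lambda>t. u (f t)) \<and>
    (\<forall>E\<in>sets coin. (\<lambda>n. \<Sum>A\<in>Pow {..<n}. measure coin (E \<inter> cylinder n A) * u (W n A))
        \<longlonglongrightarrow> (\<integral>t. indicator E t * u (f t) \<partial>coin))"
proof -
  define m where "m E = lim (\<lambda>n. tree_sum W n E)" for E
  have lim: "(\<lambda>n. tree_sum W n E) \<longlonglongrightarrow> m E" if "E \<in> sets coin" for E
    using tree_sum_convergent[OF mart bd that] by (simp add: m_def convergent_LIMSEQ_iff)
  have add: "m (E \<union> F) = m E + m F" if "E \<in> sets coin" "F \<in> sets coin" "E \<inter> F = {}" for E F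
  proof (rule LIMSEQ_unique[OF lim])
    show "(\<lambda>n. tree_sum W n (E \<union> F)) \<longlonglongrightarrow> m E + m F"
      unfolding tree_sum_add[OF that] by (intro tendsto_add lim that)
  qed (use that in auto)
  have le: "norm (m E) \<le> C * measure coin E" if "E \<in> sets coin" for E
    by (rule LIMSEQ_le_const2[OF tendsto_norm[OF lim[OF that]]])
      (intro exI[of _ 0] allI impI norm_tree_sum_le[OF that] bd)
  obtain f where f: "\<And>E. E \<in> sets coin \<Longrightarrow> has_Pettis_integral coin E f (m E)"
    using w coin.finite_measure_axioms coin.complete_measure_axioms
      coin.dominated_additive_vector_measure[of m C, OF add le]
    unfolding wRNP_over_def by blast
  show ?thesis
  proof (intro exI[of _ f] allI conjI ballI)
    fix u :: "'x dual"
    have "set_integrable coin (space coin) (\<lambda>t. u (f t))"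
      using f[OF sets.top] unfolding has_Pettis_integral_def by blast
    then show "integrable coin (\<lambda>t. u (f t))" by (simp add: set_integrable_def)
    fix E assume E: "E \<in> sets coin"
    have "(\<lambda>n. u (tree_sum W n E)) \<longlonglongrightarrow> u (m E)"
      by (intro tendsto_intros lim E)
    moreover have "u (m E) = (\<integral>t. indicator E t * u (f t) \<partial>coin)"
      using f[OF E] unfolding has_Pettis_integral_def set_lebesgue_integral_def by simp
    ultimately show "(\<lambda>n. \<Sum>A\<in>Pow {..<n}. measure coin (E \<inter> cylinder n A) * u (W n A))
        \<longlonglongrightarrow> (\<integral>t. indicator E t * u (f t) \<partial>coin)"
      by (simp add: tree_sum_def blinfun.sum_right blinfun.scaleR_right)
  qed
qed

lemma bounded_functionals_cluster:
  fixes u :: "nat \<Rightarrow> 'x::real_normed_vector dual"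
  assumes u: "\<And>k. norm (u k) \<le> C" and F: "ultrafilter F"
  shows "\<exists>v :: 'x dual. \<forall>x. ((\<lambda>k. u k x) \<longlongrightarrow> v x) F"
proof -
  have ub: "\<bar>u k x\<bar> \<le> C * norm x" for k x
    using norm_blinfun[of "u k" x] mult_right_mono[OF u[of k], of "norm x"] by simp
  have "\<exists>L. ((\<lambda>k. u k x) \<longlongrightarrow> L) F \<and> \<bar>L\<bar> \<le> C * norm x" for x
    by (rule ultrafilter_bounded_limit[OF F, of "\<lambda>k. u k x" "C * norm x"]) (use ub in auto)
  then obtain l where l: "\<And>x. ((\<lambda>k. u k x) \<longlongrightarrow> l x) F" "\<And>x. \<bar>l x\<bar> \<le> C * norm x" by metis
  note unique = tendsto_unique[OF ultrafilter_not_bot[OF F]]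
  have "bounded_linear l"
  proof (rule bounded_linear_intro)
    show "l (x + y) = l x + l y" for x y
      using unique[OF l(1)[of "x + y"]] tendsto_add[OF l(1)[of x] l(1)[of y]] by (simp add: blinfun.add_right)
    show "l (r *\<^sub>R x) = r *\<^sub>R l x" for r x
      using unique[OF l(1)[of "r *\<^sub>R x"]] tendsto_mult_left[OF l(1)[of x], of r] by (simp add: blinfun.scaleR_right)
    show "norm (l x) \<le> norm x * C" for x using l(2)[of x] by (simp add: mult.commute)
  qed
  then show ?thesis using l(1) by (intro exI[of _ "Blinfun l"]) (simp add: bounded_linear_Blinfun_apply)
qed

text \<open>The separating functionals \<open>u k\<close> would behave like Rademacher functions along a weak
  density of the tree: bounded away from 0 pointwise, but with a weak* cluster point that
  vanishes almost everywhere.\<close>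

lemma wRNP_no_separated_tree:
  fixes W :: "nat \<Rightarrow> nat set \<Rightarrow> 'x::banach" and u :: "nat \<Rightarrow> 'x dual"
  assumes w: "wRNP_over TYPE(nat \<Rightarrow> bool) TYPE('x)"
    and mart: "\<And>n A. A \<subseteq> {..<n} \<Longrightarrow> W n A = (1/2) *\<^sub>R (W (Suc n) (insert n A) + W (Suc n) A)"
    and bd: "\<And>n A. A \<subseteq> {..<n} \<Longrightarrow> norm (W n A) \<le> C"
    and u: "\<And>k. norm (u k) \<le> 1" and c: "0 < c"
    and pos: "\<And>k n A. k < n \<Longrightarrow> A \<subseteq> {..<n} \<Longrightarrow> k \<in> A \<Longrightarrow> c \<le> u k (W n A)"
    and neg: "\<And>k n A. k < n \<Longrightarrow> A \<subseteq> {..<n} \<Longrightarrow> k \<notin> A \<Longrightarrow> u k (W n A) \<le> - c"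
    and null: "\<And>n A. A \<subseteq> {..<n} \<Longrightarrow> (\<lambda>k. u k (W n A)) \<longlonglongrightarrow> 0"
  shows False
proof -
  obtain f where int: "\<And>u :: 'x dual. integrable coin (\<lambda>t. u (f t))"
    and lim: "\<And>(u :: 'x dual) E. E \<in> sets coin \<Longrightarrow>
      (\<lambda>n. \<Sum>A\<in>Pow {..<n}. measure coin (E \<inter> cylinder n A) * u (W n A))
        \<longlonglongrightarrow> (\<integral>t. indicator E t * u (f t) \<partial>coin)"
    using wRNP_tree_density[OF w mart bd] by blast
  have sign: "c * measure coin E \<le> (\<integral>t. indicator E t * (s *\<^sub>R u k) (f t) \<partial>coin)"
    if E: "E \<in> sets coin" "E \<subseteq> {t. t k = b}" and s: "s = (if b then 1 else - 1)" for E k b s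
  proof (rule LIMSEQ_le_const[OF lim[OF E(1)]], intro exI[of _ "Suc k"] allI impI)
    fix n assume "Suc k \<le> n"
    then have n: "k < n" by simp
    have "c * measure coin E = (\<Sum>A\<in>Pow {..<n}. measure coin (E \<inter> cylinder n A) * c)"
      by (simp add: sum_cylinder[OF E(1)] mult.commute flip: sum_distrib_left)
    also have "\<dots> \<le> (\<Sum>A\<in>Pow {..<n}. measure coin (E \<inter> cylinder n A) * (s *\<^sub>R u k) (W n A))"
    proof (rule sum_mono)
      fix A assume "A \<in> Pow {..<n}"
      then have A: "A \<subseteq> {..<n}" by simp
      show "measure coin (E \<inter> cylinder n A) * c \<le> measure coin (E \<inter> cylinder n A) * (s *\<^sub>R u k) (W n A)"
      proof (cases "(k \<in> A) = b")
        case True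
        then have "c \<le> (s *\<^sub>R u k) (W n A)"
          using pos[OF n A] neg[OF n A] s by (auto simp: blinfun.scaleR_left blinfun.minus_left)
        then show ?thesis by (intro mult_left_mono) auto
      next
        case False
        then have "E \<inter> cylinder n A = {}"
          using E(2) n by (auto simp: cylinder_def)
        then show ?thesis by simp
      qed
    qed
    finally show "c * measure coin E \<le> (\<Sum>A\<in>Pow {..<n}. measure coin (E \<inter> cylinder n A) * (s *\<^sub>R u k) (W n A))" .
  qed
  have half: "{t. t k = b} \<in> sets coin" for k b by (intro sets_coin0_coin sets_coordinate)
  have "AE t in coin. c \<le> \<bar>u k (f t)\<bar>" for k
  proof -
    have "AE t in coin. t \<in> {t. t k = True} \<longrightarrow> c \<le> (1 *\<^sub>R u k) (f t)"
      by (intro coin.AE_ge_if_set_integrals_ge int half sign[where b=True]) auto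
    moreover have "AE t in coin. t \<in> {t. t k = False} \<longrightarrow> c \<le> ((-1) *\<^sub>R u k) (f t)"
      by (intro coin.AE_ge_if_set_integrals_ge int half sign[where b=False]) auto
    ultimately show ?thesis
      by eventually_elim (auto simp: blinfun.scaleR_left blinfun.minus_left)
  qed
  then have big: "AE t in coin. \<forall>k. c \<le> \<bar>u k (f t)\<bar>" by (simp add: AE_all_countable)
  obtain F :: "nat filter" where F: "F \<le> sequentially" "ultrafilter F"
    using ultrafilter_exists[OF sequentially_bot] by blast
  obtain v :: "'x dual" where v: "\<And>x. ((\<lambda>k. u k x) \<longlongrightarrow> v x) F"
    using bounded_functionals_cluster[of u 1 F, OF u F(2)] by blast
  have vW: "v (W n A) = 0" if "A \<subseteq> {..<n}" for n A
    using tendsto_unique[OF ultrafilter_not_bot[OF F(2)] v] tendsto_mono[OF F(1) null[OF that]] by blast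
  have v0: "(\<integral>t. indicator E t * (s *\<^sub>R v) (f t) \<partial>coin) = 0" if "E \<in> sets coin" for E s
  proof (rule LIMSEQ_unique[OF lim[OF that]])
    have "(\<Sum>A\<in>Pow {..<n}. measure coin (E \<inter> cylinder n A) * (s *\<^sub>R v) (W n A)) = 0" for n
      using vW by (intro sum.neutral) (auto simp: blinfun.scaleR_left blinfun.minus_left)
    then show "(\<lambda>n. \<Sum>A\<in>Pow {..<n}. measure coin (E \<inter> cylinder n A) * (s *\<^sub>R v) (W n A)) \<longlonglongrightarrow> 0"
      by simp
  qed
  have "AE t in coin. t \<in> UNIV \<longrightarrow> 0 \<le> (s *\<^sub>R v) (f t)" for s
    using v0 sets.top[of coin] by (intro coin.AE_ge_if_set_integrals_ge int) auto
  from this[of 1] this[of "-1"] big have "AE t in coin. False"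
  proof eventually_elim
    case (elim t)
    have "eventually (\<lambda>k. c \<le> \<bar>u k (f t)\<bar>) F" using elim by simp
    then have "c \<le> \<bar>v (f t)\<bar>"
      by (rule tendsto_lowerbound[OF tendsto_rabs[OF v] _ ultrafilter_not_bot[OF F(2)]])
    then show ?case using elim c by (simp add: blinfun.scaleR_left blinfun.minus_left)
  qed
  then show False by (simp add: coin.AE_False)
qed

section \<open>Weak p-norms\<close>

lemma conjugate_exponent_cases:
  assumes "1 \<le> p"
  obtains (one) "p = 1" "conjugate_exponent p = \<infinity>"
    | (gt) q where "1 < p" "1 < q" "conjugate_exponent p = ereal q" "1 / p + 1 / q = 1" "q * (p - 1) = p"
proof (cases "p = 1")
  case True
  then show ?thesis using one by (simp add: conjugate_exponent_def)
next
  case False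
  then have p: "1 < p" using assms by simp
  show ?thesis
  proof (rule gt[of "p / (p - 1)"])
    show "1 < p / (p - 1)" "p / (p - 1) * (p - 1) = p" using p by (simp_all add: field_simps)
    show "1 / p + 1 / (p / (p - 1)) = 1" using p by (simp add: field_simps)
  qed (use p in \<open>simp_all add: conjugate_exponent_def\<close>)
qed

lemma powr_le_powr_iff:
  fixes x y a :: real
  assumes "0 \<le> x" "0 \<le> y" "0 < a"
  shows "x powr a \<le> y powr a \<longleftrightarrow> x \<le> y"
  using assms powr_mono2[of a x y] powr_less_mono2[of a y x] by (meson less_imp_le not_less)

lemma lq_norm_infinity_le_1_iff: "lq_norm \<infinity> n a \<le> 1 \<longleftrightarrow> (\<forall>i<n. \<bar>a i\<bar> \<le> 1)"
  by (auto simp: lq_norm_def)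

lemma lq_norm_ereal_le_1_iff:
  assumes "1 < q"
  shows "lq_norm (ereal q) n a \<le> 1 \<longleftrightarrow> (\<Sum>i<n. \<bar>a i\<bar> powr q) \<le> 1"
proof -
  have "0 \<le> (\<Sum>i<n. \<bar>a i\<bar> powr q)" by (simp add: sum_nonneg)
  then have "(\<Sum>i<n. \<bar>a i\<bar> powr q) powr (1 / q) \<le> 1 powr (1 / q) \<longleftrightarrow> (\<Sum>i<n. \<bar>a i\<bar> powr q) \<le> 1"
    using assms by (intro powr_le_powr_iff) auto
  then show ?thesis by (simp add: lq_norm_def)
qed

lemma lq_norm_le_1_imp_abs_le_1:
  assumes p: "1 \<le> p" and a: "lq_norm (conjugate_exponent p) n a \<le> 1" and i: "i < n"
  shows "\<bar>a i\<bar> \<le> 1"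
  using p
proof (cases rule: conjugate_exponent_cases)
  case one
  then show ?thesis using a i by (simp add: lq_norm_infinity_le_1_iff)
next
  case (gt q)
  have "\<bar>a i\<bar> powr q \<le> (\<Sum>i<n. \<bar>a i\<bar> powr q)" using i by (intro member_le_sum) auto
  also have "\<dots> \<le> 1" using a gt by (simp add: lq_norm_ereal_le_1_iff)
  finally have "\<bar>a i\<bar> powr q \<le> 1 powr q" by simp
  then show ?thesis using gt by (subst (asm) powr_le_powr_iff) auto
qed

lemma Holder_lq_norm:
  assumes p: "1 \<le> p" and a: "lq_norm (conjugate_exponent p) n a \<le> 1"
    and t: "(\<Sum>i<n. \<bar>t i\<bar> powr p) \<le> T"
  shows "(\<Sum>i<n. a i * t i) \<le> T powr (1 / p)"
proof -
  have "0 \<le> (\<Sum>i<n. \<bar>t i\<bar> powr p)" by (simp add: sum_nonneg)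
  with t have T0: "0 \<le> T" by (rule order_trans[rotated])
  show ?thesis
    using p
  proof (cases rule: conjugate_exponent_cases)
    case one
    have "(\<Sum>i<n. a i * t i) \<le> (\<Sum>i<n. \<bar>t i\<bar>)"
    proof (rule sum_mono)
      fix i assume "i \<in> {..<n}"
      then have "\<bar>a i\<bar> * \<bar>t i\<bar> \<le> 1 * \<bar>t i\<bar>"
        using lq_norm_le_1_imp_abs_le_1[OF p a] by (intro mult_right_mono) auto
      then show "a i * t i \<le> \<bar>t i\<bar>" using abs_ge_self[of "a i * t i"] by (simp add: abs_mult)
    qed
    then show ?thesis using t one T0 by simp
  next
    case (gt q)
    show ?thesis
    proof (cases "T = 0")
      case True
      have "t i = 0" if "i < n" for i
      proof -
        have "\<bar>t i\<bar> powr p \<le> (\<Sum>i<n. \<bar>t i\<bar> powr p)" using that by (intro member_le_sum) auto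
        then have "\<bar>t i\<bar> powr p = 0" using t True powr_ge_zero[of "\<bar>t i\<bar>" p] by linarith
        then show ?thesis by simp
      qed
      then show ?thesis using True by simp
    next
      case False
      define N where "N = T powr (1 / p)"
      have N: "0 < N" "N powr p = T" using False T0 gt by (auto simp: N_def powr_powr)
      have "(\<Sum>i<n. a i * t i) / N = (\<Sum>i<n. a i * (t i / N))" by (simp add: sum_divide_distrib)
      also have "\<dots> \<le> (\<Sum>i<n. \<bar>t i / N\<bar> powr p / p + \<bar>a i\<bar> powr q / q)"
      proof (rule sum_mono)
        fix i
        have "a i * (t i / N) \<le> \<bar>t i / N\<bar> * \<bar>a i\<bar>"
          by (metis abs_ge_self abs_mult mult.commute)
        also have "\<dots> \<le> \<bar>t i / N\<bar> powr p / p + \<bar>a i\<bar> powr q / q"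
          using gt by (intro Youngs_inequality) auto
        finally show "a i * (t i / N) \<le> \<bar>t i / N\<bar> powr p / p + \<bar>a i\<bar> powr q / q" .
      qed
      also have "\<dots> = (\<Sum>i<n. \<bar>t i\<bar> powr p) / T / p + (\<Sum>i<n. \<bar>a i\<bar> powr q) / q"
        using N by (simp add: sum.distrib sum_divide_distrib powr_divide abs_divide)
      also have "\<dots> \<le> 1 / p + 1 / q"
      proof (intro add_mono divide_right_mono)
        show "(\<Sum>i<n. \<bar>t i\<bar> powr p) / T \<le> 1" using t False T0 by (simp add: field_simps)
        show "(\<Sum>i<n. \<bar>a i\<bar> powr q) \<le> 1" using a gt by (simp add: lq_norm_ereal_le_1_iff)
      qed (use gt in auto)
      finally have "(\<Sum>i<n. a i * t i) / N \<le> 1" using gt by simp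
      then show ?thesis using N by (simp add: N_def field_simps)
    qed
  qed
qed

lemma Holder_lq_norm_attained:
  assumes p: "1 \<le> p"
  obtains a where "lq_norm (conjugate_exponent p) n a \<le> 1"
    "(\<Sum>i<n. a i * t i) = (\<Sum>i<n. \<bar>t i\<bar> powr p) powr (1 / p)"
proof -
  define T where "T = (\<Sum>i<n. \<bar>t i\<bar> powr p)"
  have T0: "0 \<le> T" by (simp add: T_def sum_nonneg)
  show ?thesis
    using p
  proof (cases rule: conjugate_exponent_cases)
    case one
    show ?thesis
    proof (rule that[of "\<lambda>i. sgn (t i)"])
      show "lq_norm (conjugate_exponent p) n (\<lambda>i. sgn (t i)) \<le> 1"
        using one by (simp add: lq_norm_infinity_le_1_iff abs_sgn_eq)
      show "(\<Sum>i<n. sgn (t i) * t i) = (\<Sum>i<n. \<bar>t i\<bar> powr p) powr (1 / p)"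
      proof -
        have "sgn (t i) * t i = \<bar>t i\<bar>" for i by (simp add: abs_sgn mult.commute)
        then show ?thesis using one by (simp add: sum_nonneg)
      qed
    qed
  next
    case (gt q)
    show ?thesis
    proof (cases "T = 0")
      case True
      then show ?thesis
        using gt by (intro that[of "\<lambda>_. 0"]) (simp_all add: lq_norm_ereal_le_1_iff T_def)
    next
      case False
      define c where "c = T powr (- (1 / q))"
      define a where "a i = c * (sgn (t i) * \<bar>t i\<bar> powr (p - 1))" for i
      have "c powr q = T powr (- (1 / q) * q)" unfolding c_def by (rule powr_powr)
      also have "- (1 / q) * q = - 1" using gt by simp
      also have "T powr (- 1) = 1 / T" using T0 False by (simp add: powr_minus_divide)
      finally have cq: "c powr q = 1 / T" .
      have "\<bar>a i\<bar> powr q = \<bar>t i\<bar> powr p / T" for i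
      proof (cases "t i = 0")
        case False
        then have "\<bar>a i\<bar> = c * \<bar>t i\<bar> powr (p - 1)"
          by (simp add: a_def abs_mult abs_sgn_eq c_def)
        then have "\<bar>a i\<bar> powr q = c powr q * \<bar>t i\<bar> powr ((p - 1) * q)"
          by (simp add: powr_mult powr_powr c_def)
        then show ?thesis using gt cq by (simp add: mult.commute)
      qed (simp add: a_def)
      then have 1: "(\<Sum>i<n. \<bar>a i\<bar> powr q) = 1"
        using False by (simp add: T_def flip: sum_divide_distrib)
      have "a i * t i = c * \<bar>t i\<bar> powr p" for i
      proof (cases "t i = 0")
        case False
        have "sgn (t i) * t i = \<bar>t i\<bar> powr 1" by (simp add: sgn_if)
        then have "a i * t i = c * (\<bar>t i\<bar> powr (p - 1) * \<bar>t i\<bar> powr 1)"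
          by (simp add: a_def mult_ac)
        also have "\<bar>t i\<bar> powr (p - 1) * \<bar>t i\<bar> powr 1 = \<bar>t i\<bar> powr (p - 1 + 1)"
          by (rule powr_add[symmetric])
        finally show ?thesis by simp
      qed (simp add: a_def)
      then have "(\<Sum>i<n. a i * t i) = c * T" by (simp add: T_def sum_distrib_left)
      also have "\<dots> = T powr (- (1 / q)) * T powr 1"
        using T0 by (simp add: c_def)
      also have "\<dots> = T powr (- (1 / q) + 1)"
        by (rule powr_add[symmetric])
      also have "- (1 / q) + 1 = 1 / p" using gt by simp
      finally show ?thesis
        using 1 gt by (intro that[of a]) (simp_all add: lq_norm_ereal_le_1_iff T_def)
    qed
  qed
qed

lemma weak_norm_bdd:
  assumes "1 \<le> p"
  shows "bdd_above {norm (\<Sum>i<n. a i *\<^sub>R z i) | a. lq_norm (conjugate_exponent p) n a \<le> 1}"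
proof (rule bdd_aboveI)
  fix x assume "x \<in> {norm (\<Sum>i<n. a i *\<^sub>R z i) | a. lq_norm (conjugate_exponent p) n a \<le> 1}"
  then obtain a where x: "x = norm (\<Sum>i<n. a i *\<^sub>R z i)" and a: "lq_norm (conjugate_exponent p) n a \<le> 1" by blast
  have "norm (a i *\<^sub>R z i) \<le> norm (z i)" if "i < n" for i
    using lq_norm_le_1_imp_abs_le_1[OF assms a that] by (simp add: mult_left_le_one_le)
  then show "x \<le> (\<Sum>i<n. norm (z i))" unfolding x by (intro sum_norm_le) auto
qed

lemma lq_norm_zero_le_1: "lq_norm (conjugate_exponent p) n (\<lambda>_. 0) \<le> 1"
proof -
  have "(\<lambda>i. \<bar>0::real\<bar>) ` {..<n} \<subseteq> {0}" by auto
  then have "insert 0 ((\<lambda>i. \<bar>0::real\<bar>) ` {..<n}) = {0}" by blast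
  then show ?thesis by (simp add: lq_norm_def conjugate_exponent_def)
qed

lemma norm_sum_le_weak_norm:
  assumes "1 \<le> p" "lq_norm (conjugate_exponent p) n a \<le> 1"
  shows "norm (\<Sum>i<n. a i *\<^sub>R z i) \<le> weak_norm p n z"
  unfolding weak_norm_def using assms(2) by (intro cSup_upper weak_norm_bdd[OF assms(1)]) blast

lemma weak_norm_nonneg:
  assumes "1 \<le> p"
  shows "0 \<le> weak_norm p n z"
  using norm_sum_le_weak_norm[OF assms lq_norm_zero_le_1] norm_ge_zero order_trans by blast

lemma weak_norm_dual_le:
  fixes u :: "nat \<Rightarrow> 'x::real_normed_vector dual"
  assumes p: "1 \<le> p" and T: "\<And>x. norm x \<le> 1 \<Longrightarrow> (\<Sum>i<n. \<bar>u i x\<bar> powr p) \<le> T"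
  shows "weak_norm p n u \<le> T powr (1 / p)"
  unfolding weak_norm_def
proof (rule cSup_least)
  show "{norm (\<Sum>i<n. a i *\<^sub>R u i) |a. lq_norm (conjugate_exponent p) n a \<le> 1} \<noteq> {}"
    using lq_norm_zero_le_1 by blast
  fix y assume "y \<in> {norm (\<Sum>i<n. a i *\<^sub>R u i) |a. lq_norm (conjugate_exponent p) n a \<le> 1}"
  then obtain a where y: "y = norm (\<Sum>i<n. a i *\<^sub>R u i)" and a: "lq_norm (conjugate_exponent p) n a \<le> 1" by blast
  let ?v = "\<Sum>i<n. a i *\<^sub>R u i"
  have le: "?v x \<le> T powr (1 / p)" if "norm x \<le> 1" for x
    using Holder_lq_norm[OF p a T[OF that]] by (simp add: blinfun.sum_left blinfun.scaleR_left)
  have "norm ?v \<le> T powr (1 / p)"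
  proof (rule norm_blinfun_bound)
    fix x
    show "norm (?v x) \<le> T powr (1 / p) * norm x"
    proof (cases "x = 0")
      case False
      have "\<bar>?v (x /\<^sub>R norm x)\<bar> \<le> T powr (1 / p)"
        using le[of "x /\<^sub>R norm x"] le[of "- (x /\<^sub>R norm x)"] False
        by (simp add: blinfun.minus_right abs_le_iff)
      then have "\<bar>?v (x /\<^sub>R norm x)\<bar> * norm x \<le> T powr (1 / p) * norm x"
        by (intro mult_right_mono) auto
      moreover have "\<bar>?v (x /\<^sub>R norm x)\<bar> * norm x = \<bar>?v x\<bar>"
        using False unfolding blinfun.scaleR_right by (simp add: abs_mult)
      ultimately show ?thesis by simp
    qed (simp add: blinfun.zero_right)
  qed simp
  then show "y \<le> T powr (1 / p)" by (simp add: y)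
qed

lemma sum_powr_le_weak_norm:
  assumes p: "1 \<le> p" and t: "\<And>a. (\<Sum>i<n. a i * t i) \<le> norm (\<Sum>i<n. a i *\<^sub>R z i)"
  shows "(\<Sum>i<n. \<bar>t i\<bar> powr p) \<le> weak_norm p n z powr p"
proof -
  obtain a where a: "lq_norm (conjugate_exponent p) n a \<le> 1"
    "(\<Sum>i<n. a i * t i) = (\<Sum>i<n. \<bar>t i\<bar> powr p) powr (1 / p)"
    using Holder_lq_norm_attained[OF p] by blast
  have "(\<Sum>i<n. \<bar>t i\<bar> powr p) powr (1 / p) \<le> weak_norm p n z"
    using t[of a] norm_sum_le_weak_norm[OF p a(1), of z] a(2) by simp
  then have "((\<Sum>i<n. \<bar>t i\<bar> powr p) powr (1 / p)) powr p \<le> weak_norm p n z powr p"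
    using p by (intro powr_mono2) auto
  then show ?thesis using p by (simp add: powr_powr sum_nonneg)
qed

lemma sum_le_norm_of_rational:
  fixes z :: "nat \<Rightarrow> 'z::real_normed_vector"
  assumes r: "\<And>l :: rat list. (\<Sum>i<n. of_rat (l ! i) * t i) \<le> norm (\<Sum>i<n. of_rat (l ! i) *\<^sub>R z i)"
  shows "(\<Sum>i<n. a i * t i) \<le> norm (\<Sum>i<n. a i *\<^sub>R z i)"
proof -
  have "\<exists>r. a i < of_rat r \<and> of_rat r < a i + 1 / real (Suc m)" for i m
    using of_rat_dense[of "a i" "a i + 1 / real (Suc m)"] by simp
  then obtain r where r1: "\<And>i m. a i < of_rat (r i m)" "\<And>i m. of_rat (r i m) < a i + 1 / real (Suc m)"
    by metis
  have lim: "(\<lambda>m. of_rat (r i m)) \<longlonglongrightarrow> a i" for i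
  proof (rule tendsto_sandwich[OF _ _ tendsto_const])
    show "\<forall>\<^sub>F m in sequentially. a i \<le> of_rat (r i m)" using r1(1) by (simp add: less_imp_le)
    show "\<forall>\<^sub>F m in sequentially. of_rat (r i m) \<le> a i + 1 / real (Suc m)"
      using r1(2) by (intro always_eventually allI less_imp_le)
    have "(\<lambda>m. a i + 1 / real (Suc m)) \<longlonglongrightarrow> a i + 0"
      by (intro tendsto_add tendsto_const LIMSEQ_Suc lim_1_over_n)
    then show "(\<lambda>m. a i + 1 / real (Suc m)) \<longlonglongrightarrow> a i" by simp
  qed
  have le: "(\<Sum>i<n. of_rat (r i m) * t i) \<le> norm (\<Sum>i<n. of_rat (r i m) *\<^sub>R z i)" for m
    using r[of "map (\<lambda>i. r i m) [0..<n]"] by simp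
  show ?thesis
    by (rule LIMSEQ_le[of "\<lambda>m. \<Sum>i<n. of_rat (r i m) * t i" _ "\<lambda>m. norm (\<Sum>i<n. of_rat (r i m) *\<^sub>R z i)"])
      (use le in \<open>auto intro!: tendsto_intros lim\<close>)
qed

lemma abs_powr_diff_le:
  fixes x y R p :: real
  assumes p: "1 \<le> p" and x: "\<bar>x\<bar> \<le> R" and y: "\<bar>y\<bar> \<le> R"
  shows "\<bar>\<bar>x\<bar> powr p - \<bar>y\<bar> powr p\<bar> \<le> p * R powr (p - 1) * \<bar>x - y\<bar>"
proof -
  have *: "b powr p - a powr p \<le> p * R powr (p - 1) * (b - a)" if "0 \<le> a" "a < b" "b \<le> R" for a b
  proof (cases "a = 0")
    case True
    have "b powr p = b powr (p - 1) * b" using that powr_add[of b "p - 1" 1] by simp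
    also have "\<dots> \<le> R powr (p - 1) * b" using that p by (intro mult_right_mono powr_mono2) auto
    also have "\<dots> \<le> p * (R powr (p - 1) * b)"
      using that p mult_right_mono[of 1 p "R powr (p - 1) * b"] by simp
    finally show ?thesis using True p by (simp add: mult.assoc)
  next
    case False
    then have a: "0 < a" using that by simp
    have "\<exists>c>a. c < b \<and> b powr p - a powr p = (b - a) * (p * c powr (p - 1))"
      using that a by (intro MVT2) (auto intro!: has_real_derivative_powr)
    then obtain c where c: "a < c" "c < b" "b powr p - a powr p = (b - a) * (p * c powr (p - 1))"
      by blast
    have "c powr (p - 1) \<le> R powr (p - 1)" using a c that p by (intro powr_mono2) auto
    then have "(b - a) * (p * c powr (p - 1)) \<le> (b - a) * (p * R powr (p - 1))"
      using that p by (intro mult_left_mono) auto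
    then show ?thesis using c(3) by (simp add: mult_ac)
  qed
  have mono: "a powr p \<le> b powr p" if "0 \<le> a" "a \<le> b" for a b :: real
    using that p by (intro powr_mono2) auto
  have p0: "0 \<le> p * R powr (p - 1)" using p by simp
  have "\<bar>\<bar>x\<bar> powr p - \<bar>y\<bar> powr p\<bar> \<le> p * R powr (p - 1) * \<bar>\<bar>x\<bar> - \<bar>y\<bar>\<bar>"
    using *[of "\<bar>x\<bar>" "\<bar>y\<bar>"] *[of "\<bar>y\<bar>" "\<bar>x\<bar>"] mono[of "\<bar>x\<bar>" "\<bar>y\<bar>"] mono[of "\<bar>y\<bar>" "\<bar>x\<bar>"] x y
    by (cases "\<bar>x\<bar>" "\<bar>y\<bar>" rule: linorder_cases) auto
  also have "\<dots> \<le> p * R powr (p - 1) * \<bar>x - y\<bar>"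
    by (intro mult_left_mono p0 abs_triangle_ineq3)
  finally show ?thesis .
qed

section \<open>Riesz products and weak densities\<close>

locale weak_densities = finite_measure M for M :: "'w measure" +
  fixes V :: "('w \<Rightarrow> real) \<Rightarrow> 'x::banach" and h :: "'x dual \<Rightarrow> 'w \<Rightarrow> real"
  assumes V_add: "\<And>\<phi> \<psi>. integrable M \<phi> \<Longrightarrow> integrable M \<psi> \<Longrightarrow> V (\<lambda>w. \<phi> w + \<psi> w) = V \<phi> + V \<psi>"
    and V_scale: "\<And>c \<phi>. integrable M \<phi> \<Longrightarrow> V (\<lambda>w. c * \<phi> w) = c *\<^sub>R V \<phi>"
    and V_norm: "\<And>\<phi>. integrable M \<phi> \<Longrightarrow> norm (V \<phi>) \<le> (\<integral>w. \<bar>\<phi> w\<bar> \<partial>M)"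
    and h_measurable [measurable]: "\<And>u. h u \<in> borel_measurable M"
    and h_le: "\<And>u w. \<bar>h u w\<bar> \<le> norm u"
    and h_integral: "\<And>\<phi> u. integrable M \<phi> \<Longrightarrow> blinfun_apply u (V \<phi>) = (\<integral>w. \<phi> w * h u w \<partial>M)"
begin

lemma integrable_mult_bounded:
  fixes \<phi> g :: "'w \<Rightarrow> real"
  assumes phi: "integrable M \<phi>" and g: "g \<in> borel_measurable M" "\<And>w. \<bar>g w\<bar> \<le> C"
  shows "integrable M (\<lambda>w. \<phi> w * g w)"
proof (rule Bochner_Integration.integrable_bound)
  show "integrable M (\<lambda>w. C * \<phi> w)" using phi by simp
  show "AE w in M. norm (\<phi> w * g w) \<le> norm (C * \<phi> w)"
  proof (intro AE_I2)
    fix w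
    have "0 \<le> C" using g(2)[of w] by linarith
    then show "norm (\<phi> w * g w) \<le> norm (C * \<phi> w)"
      using mult_right_mono[OF g(2)[of w], of "\<bar>\<phi> w\<bar>"] by (simp add: abs_mult mult.commute)
  qed
qed (use phi g in auto)

lemma integrable_mult_h: "integrable M \<phi> \<Longrightarrow> integrable M (\<lambda>w. \<phi> w * h u w)"
  using integrable_mult_bounded[OF _ h_measurable h_le] .

lemma integrable_mult_h2: "integrable M \<phi> \<Longrightarrow> integrable M (\<lambda>w. \<phi> w * (h u w)\<^sup>2)"
  using integrable_mult_h[OF integrable_mult_h, of \<phi> u u] by (simp add: power2_eq_square mult.assoc)

lemma integral_mult_h2_le:
  assumes phi: "integrable M \<phi>" and u: "norm u \<le> 1"
  shows "\<bar>\<integral>w. \<phi> w * (h u w)\<^sup>2 \<partial>M\<bar> \<le> (\<integral>w. \<bar>\<phi> w\<bar> \<partial>M)"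
proof -
  have "\<bar>\<integral>w. \<phi> w * (h u w)\<^sup>2 \<partial>M\<bar> \<le> (\<integral>w. \<bar>\<phi> w * (h u w)\<^sup>2\<bar> \<partial>M)"
    by (rule integral_abs_bound)
  also have "\<dots> \<le> (\<integral>w. \<bar>\<phi> w\<bar> \<partial>M)"
  proof (rule integral_mono)
    fix w
    have "\<bar>h u w\<bar> \<le> 1" using h_le[of u w] u by simp
    then have "(h u w)\<^sup>2 \<le> 1" by (simp add: abs_square_le_1)
    then show "\<bar>\<phi> w * (h u w)\<^sup>2\<bar> \<le> \<bar>\<phi> w\<bar>"
      by (simp add: abs_mult mult_left_le)
  qed (use phi integrable_mult_h2[OF phi] in auto)
  finally show ?thesis .
qed

lemma limit_square_density:
  assumes U: "ultrafilter U" and U1: "eventually (\<lambda>u. norm u \<le> 1) U"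
  shows "\<exists>q\<in>borel_measurable M. (\<forall>w. \<bar>q w\<bar> \<le> 1) \<and>
    (\<forall>\<phi>. integrable M \<phi> \<longrightarrow> ((\<lambda>u. \<integral>w. \<phi> w * (h u w)\<^sup>2 \<partial>M) \<longlongrightarrow> (\<integral>w. \<phi> w * q w \<partial>M)) U)"
proof -
  define l where "l \<phi> = Lim U (\<lambda>u. \<integral>w. \<phi> w * (h u w)\<^sup>2 \<partial>M)" for \<phi> :: "'w \<Rightarrow> real"
  have Ub: "U \<noteq> bot" using U by (rule ultrafilter_not_bot)
  have l: "((\<lambda>u. \<integral>w. \<phi> w * (h u w)\<^sup>2 \<partial>M) \<longlongrightarrow> l \<phi>) U" "\<bar>l \<phi>\<bar> \<le> (\<integral>w. \<bar>\<phi> w\<bar> \<partial>M)" if phi: "integrable M \<phi>" for \<phi> :: "'w \<Rightarrow> real"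
  proof -
    have "eventually (\<lambda>u. \<bar>\<integral>w. \<phi> w * (h u w)\<^sup>2 \<partial>M\<bar> \<le> (\<integral>w. \<bar>\<phi> w\<bar> \<partial>M)) U"
      using U1 by eventually_elim (rule integral_mult_h2_le[OF phi])
    from ultrafilter_bounded_limit[OF U this] obtain L where
      L: "((\<lambda>u. \<integral>w. \<phi> w * (h u w)\<^sup>2 \<partial>M) \<longlongrightarrow> L) U" "\<bar>L\<bar> \<le> (\<integral>w. \<bar>\<phi> w\<bar> \<partial>M)" .
    moreover have "l \<phi> = L" unfolding l_def using Ub L(1) by (rule tendsto_Lim)
    ultimately show "((\<lambda>u. \<integral>w. \<phi> w * (h u w)\<^sup>2 \<partial>M) \<longlongrightarrow> l \<phi>) U" "\<bar>l \<phi>\<bar> \<le> (\<integral>w. \<bar>\<phi> w\<bar> \<partial>M)" by auto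
  qed
  obtain q where "q \<in> borel_measurable M" "\<And>w. \<bar>q w\<bar> \<le> 1"
    and q: "\<And>\<phi>. integrable M \<phi> \<Longrightarrow> l \<phi> = (\<integral>w. \<phi> w * q w \<partial>M)"
  proof (rule L1_dual_density[of l 1])
    fix \<phi> \<psi> :: "'w \<Rightarrow> real" assume phi: "integrable M \<phi>" and psi: "integrable M \<psi>"
    have "((\<lambda>u. (\<integral>w. \<phi> w * (h u w)\<^sup>2 \<partial>M) + (\<integral>w. \<psi> w * (h u w)\<^sup>2 \<partial>M)) \<longlongrightarrow> l \<phi> + l \<psi>) U"
      by (intro tendsto_add l phi psi)
    moreover have "(\<integral>w. \<phi> w * (h u w)\<^sup>2 \<partial>M) + (\<integral>w. \<psi> w * (h u w)\<^sup>2 \<partial>M) = (\<integral>w. (\<phi> w + \<psi> w) * (h u w)\<^sup>2 \<partial>M)" for u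
      using integrable_mult_h2[OF phi] integrable_mult_h2[OF psi] by (simp add: distrib_right)
    ultimately show "l (\<lambda>w. \<phi> w + \<psi> w) = l \<phi> + l \<psi>"
      using l(1)[of "\<lambda>w. \<phi> w + \<psi> w"] phi psi by (intro tendsto_unique[OF Ub]) auto
  next
    fix c and \<phi> :: "'w \<Rightarrow> real" assume phi: "integrable M \<phi>"
    have "((\<lambda>u. c * (\<integral>w. \<phi> w * (h u w)\<^sup>2 \<partial>M)) \<longlongrightarrow> c * l \<phi>) U"
      by (intro tendsto_mult_left l phi)
    moreover have "c * (\<integral>w. \<phi> w * (h u w)\<^sup>2 \<partial>M) = (\<integral>w. (c * \<phi> w) * (h u w)\<^sup>2 \<partial>M)" for u
      by (simp add: mult.assoc)
    ultimately show "l (\<lambda>w. c * \<phi> w) = c * l \<phi>"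
      using l(1)[of "\<lambda>w. c * \<phi> w"] phi by (intro tendsto_unique[OF Ub]) auto
  qed (use l in auto)
  then show ?thesis using l(1) by (intro bexI[of _ q]) simp_all
qed

definition branch_sign :: "nat set \<Rightarrow> nat \<Rightarrow> real" where
  "branch_sign A k = (if k \<in> A then 1 else - 1)"

definition riesz :: "'w set \<Rightarrow> (nat \<Rightarrow> 'x dual) \<Rightarrow> nat \<Rightarrow> nat set \<Rightarrow> 'w \<Rightarrow> real" where
  "riesz B v n A w = indicator B w * (\<Prod>k<n. 1 + branch_sign A k * h (v k) w)"

lemma riesz_Suc:
  "riesz B v (Suc n) A w =
     riesz B v n A w + branch_sign A n * (riesz B v n A w * h (v n) w)"
  by (simp add: riesz_def algebra_simps)

lemma riesz_cong:
  assumes "\<And>k. k < n \<Longrightarrow> v k = v' k" "A \<inter> {..<n} = A' \<inter> {..<n}"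
  shows "riesz B v n A = riesz B v' n A'"
proof -
  have "branch_sign A k = branch_sign A' k" if "k < n" for k
    using assms(2) that by (auto simp: branch_sign_def)
  then show ?thesis using assms(1) by (auto simp: riesz_def fun_eq_iff intro!: arg_cong2[where f="(*)"] prod.cong)
qed

lemma riesz_Int: "riesz B v n (A \<inter> {..<n}) = riesz B v n A"
  by (rule riesz_cong) auto

lemma riesz_nonneg:
  assumes "\<And>k. k < n \<Longrightarrow> norm (v k) \<le> 1"
  shows "0 \<le> riesz B v n A w"
proof -
  have "0 \<le> 1 + branch_sign A k * h (v k) w" if "k < n" for k
    using h_le[of "v k" w] assms[OF that] by (auto simp: branch_sign_def abs_le_iff)
  then show ?thesis by (auto simp: riesz_def intro!: mult_nonneg_nonneg prod_nonneg)
qed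

lemma riesz_integrable:
  assumes "B \<in> sets M"
  shows "integrable M (riesz B v n A)"
proof (induction n)
  case 0
  have "integrable M (indicator B :: 'w \<Rightarrow> real)"
    using assms by (rule integrable_indicator_real)
  then show ?case by (simp add: riesz_def[abs_def])
next
  case (Suc n)
  then have "integrable M (\<lambda>w. riesz B v n A w + branch_sign A n * (riesz B v n A w * h (v n) w))"
    by (intro Bochner_Integration.integrable_add integrable_mult_right integrable_mult_h)
  then show ?case by (simp add: riesz_Suc[abs_def])
qed

definition lacunary :: "'w set \<Rightarrow> real \<Rightarrow> (nat \<Rightarrow> real) \<Rightarrow> (nat \<Rightarrow> 'x dual) \<Rightarrow> bool" where
  "lacunary B c d v \<longleftrightarrow> (\<forall>k. norm (v k) \<le> 1) \<and>
    (\<forall>k A. \<forall>n\<le>k. \<bar>\<integral>w. riesz B v n A w * h (v k) w \<partial>M\<bar> \<le> d k) \<and>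
    (\<forall>k A. c * (\<integral>w. riesz B v k A w \<partial>M) \<le> (\<integral>w. riesz B v k A w * (h (v k) w)\<^sup>2 \<partial>M)) \<and>
    (\<forall>k A. \<forall>j<k. \<bar>\<integral>w. riesz B v k A w * h (v j) w * h (v k) w \<partial>M\<bar> \<le> d k)"

lemma lacunaryD:
  assumes "lacunary B c d v"
  shows "norm (v k) \<le> 1"
    "n \<le> k \<Longrightarrow> \<bar>\<integral>w. riesz B v n A w * h (v k) w \<partial>M\<bar> \<le> d k"
    "c * (\<integral>w. riesz B v k A w \<partial>M) \<le> (\<integral>w. riesz B v k A w * (h (v k) w)\<^sup>2 \<partial>M)"
    "j < k \<Longrightarrow> \<bar>\<integral>w. riesz B v k A w * h (v j) w * h (v k) w \<partial>M\<bar> \<le> d k"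
  using assms unfolding lacunary_def by auto

lemma exists_lacunary_sequence:
  assumes U: "ultrafilter U" and U1: "eventually (\<lambda>u. norm u \<le> 1) U"
    and U0: "\<And>x. ((\<lambda>u. blinfun_apply u x) \<longlongrightarrow> 0) U"
    and B: "B \<in> sets M" and d: "\<And>k. 0 < d k" and c: "0 < c"
    and sq: "\<forall>\<phi>. integrable M \<phi> \<longrightarrow> (\<forall>w. 0 \<le> \<phi> w) \<longrightarrow> (\<forall>w. w \<notin> B \<longrightarrow> \<phi> w = 0) \<longrightarrow> 0 < (\<integral>w. \<phi> w \<partial>M) \<longrightarrow>
      eventually (\<lambda>u. c * (\<integral>w. \<phi> w \<partial>M) \<le> (\<integral>w. \<phi> w * (h u w)\<^sup>2 \<partial>M)) U"
  shows "\<exists>v. lacunary B c d v"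
proof -
  define Q where "Q v k u \<longleftrightarrow> norm u \<le> 1 \<and>
      (\<forall>n\<in>{..k}. \<forall>A\<in>Pow {..<n}. \<bar>\<integral>w. riesz B v n A w * h u w \<partial>M\<bar> \<le> d k) \<and>
      (\<forall>A\<in>Pow {..<k}. c * (\<integral>w. riesz B v k A w \<partial>M) \<le> (\<integral>w. riesz B v k A w * (h u w)\<^sup>2 \<partial>M)) \<and>
      (\<forall>j\<in>{..<k}. \<forall>A\<in>Pow {..<k}. \<bar>\<integral>w. riesz B v k A w * h (v j) w * h u w \<partial>M\<bar> \<le> d k)" for v k u
  have int: "integrable M (riesz B v n A)" for v n A
    by (rule riesz_integrable[OF B])
  have small: "eventually (\<lambda>u. \<bar>\<integral>w. \<phi> w * h u w \<partial>M\<bar> \<le> d k) U" if phi: "integrable M \<phi>" for \<phi> k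
  proof -
    have "((\<lambda>u. \<bar>blinfun_apply u (V \<phi>)\<bar>) \<longlongrightarrow> 0) U" using U0 by (intro tendsto_rabs_zero)
    then have "eventually (\<lambda>u. \<bar>blinfun_apply u (V \<phi>)\<bar> < d k) U" using d[of k] by (rule order_tendstoD)
    then show ?thesis by eventually_elim (simp add: h_integral[OF phi])
  qed
  have "\<exists>v. \<forall>k. Q v k (v k)"
  proof (rule dependent_wellorder_choice)
    fix r :: "'x dual" and f g :: "nat \<Rightarrow> 'x dual" and k assume fg: "\<And>y. y < k \<Longrightarrow> f y = g y"
    have "riesz B f n A = riesz B g n A" if "n \<le> k" for n A
      using fg that by (intro riesz_cong) auto
    then show "Q f k r = Q g k r" using fg unfolding Q_def by simp
  next
    fix k and v :: "nat \<Rightarrow> 'x dual" assume v: "\<And>y. y < k \<Longrightarrow> Q v y (v y)"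
    then have v1: "norm (v y) \<le> 1" if "y < k" for y using that by (simp add: Q_def)
    have nn: "0 \<le> riesz B v k A w" for A w
      using v1 by (rule riesz_nonneg)
    have sq': "eventually (\<lambda>u. c * (\<integral>w. riesz B v k A w \<partial>M) \<le> (\<integral>w. riesz B v k A w * (h u w)\<^sup>2 \<partial>M)) U" for A
    proof (cases "0 < (\<integral>w. riesz B v k A w \<partial>M)")
      case True
      then show ?thesis
        by (intro sq[rule_format] int nn True) (simp add: riesz_def)
    next
      case False
      then have "c * (\<integral>w. riesz B v k A w \<partial>M) \<le> 0"
        using c by (simp add: mult_nonneg_nonpos not_less)
      moreover have "0 \<le> (\<integral>w. riesz B v k A w * (h u w)\<^sup>2 \<partial>M)" for u
        using nn by (intro Bochner_Integration.integral_nonneg) auto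
      ultimately have "c * (\<integral>w. riesz B v k A w \<partial>M) \<le> (\<integral>w. riesz B v k A w * (h u w)\<^sup>2 \<partial>M)" for u
        by (rule order_trans)
      then show ?thesis by simp
    qed
    have "eventually (\<lambda>u. Q v k u) U"
      unfolding Q_def
      by (intro eventually_conj U1 eventually_ball_finite ballI small int sq' integrable_mult_h)
        (auto intro: finite_subset)
    then show "\<exists>r. Q v k r"
      using eventually_happens'[OF ultrafilter_not_bot[OF U]] by blast
  qed
  then obtain v where Q: "\<And>k. Q v k (v k)" by blast
  note R = riesz_Int[of B v, symmetric]
  show ?thesis
    unfolding lacunary_def
  proof (intro exI[of _ v] conjI allI impI)
    show "norm (v k) \<le> 1" for k using Q[of k] by (simp add: Q_def)
    show "\<bar>\<integral>w. riesz B v n A w * h (v k) w \<partial>M\<bar> \<le> d k" if "n \<le> k" for k n A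
      using Q[of k] that by (subst R) (simp add: Q_def)
    show "c * (\<integral>w. riesz B v k A w \<partial>M) \<le> (\<integral>w. riesz B v k A w * (h (v k) w)\<^sup>2 \<partial>M)" for k A
      using Q[of k] by (subst (1 2) R) (simp add: Q_def)
    show "\<bar>\<integral>w. riesz B v k A w * h (v j) w * h (v k) w \<partial>M\<bar> \<le> d k" if "j < k" for j k A
      using Q[of k] that by (subst R) (simp add: Q_def)
  qed
qed

end

context weak_densities begin

lemma integral_riesz_le:
  assumes B: "B \<in> sets M" and lac: "lacunary B c d v"
  shows "\<bar>(\<integral>w. riesz B v n A w \<partial>M) - measure M B\<bar> \<le> (\<Sum>k<n. d k)"
proof (induction n)
  case 0
  then show ?case using B by (simp add: riesz_def)
next
  case (Suc n)
  note int = riesz_integrable[OF B, of v]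
  have "(\<integral>w. riesz B v (Suc n) A w \<partial>M) =
      (\<integral>w. riesz B v n A w \<partial>M) + branch_sign A n * (\<integral>w. riesz B v n A w * h (v n) w \<partial>M)"
    unfolding riesz_Suc
    by (subst Bochner_Integration.integral_add)
      (simp_all add: int integrable_mult_h)
  moreover have "\<bar>branch_sign A n * (\<integral>w. riesz B v n A w * h (v n) w \<partial>M)\<bar> \<le> d n"
    using lacunaryD(2)[OF lac, of n n] by (simp add: abs_mult branch_sign_def)
  ultimately show ?case using Suc by (simp add: abs_le_iff)
qed

lemma riesz_correlation:
  assumes B: "B \<in> sets M" and lac: "lacunary B c d v" and k: "k < n"
  shows "c * (\<integral>w. riesz B v k A w \<partial>M) - (\<Sum>j\<in>{k..<n}. d j)
    \<le> branch_sign A k * (\<integral>w. riesz B v n A w * h (v k) w \<partial>M)"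
proof -
  note int = riesz_integrable[OF B, of v]
  have sgn2: "branch_sign A k * (branch_sign A k * x) = x" for k x
    by (simp add: branch_sign_def)
  have sgn_abs: "\<bar>branch_sign A k * x\<bar> = \<bar>x\<bar>" for k x
    by (simp add: branch_sign_def abs_mult)
  have expand: "(\<integral>w. riesz B v (Suc n) A w * h (v k) w \<partial>M) = (\<integral>w. riesz B v n A w * h (v k) w \<partial>M)
      + branch_sign A n * (\<integral>w. riesz B v n A w * h (v k) w * h (v n) w \<partial>M)" for n
  proof -
    have "(\<integral>w. riesz B v (Suc n) A w * h (v k) w \<partial>M) = (\<integral>w. riesz B v n A w * h (v k) w
      + branch_sign A n * (riesz B v n A w * h (v k) w * h (v n) w) \<partial>M)"
      by (intro Bochner_Integration.integral_cong) (simp_all add: riesz_Suc algebra_simps)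
    also have "\<dots> = (\<integral>w. riesz B v n A w * h (v k) w \<partial>M)
      + branch_sign A n * (\<integral>w. riesz B v n A w * h (v k) w * h (v n) w \<partial>M)"
      by (subst Bochner_Integration.integral_add) (simp_all add: int integrable_mult_h)
    finally show ?thesis .
  qed
  have "Suc k \<le> n" using k by simp
  then show ?thesis
  proof (induction rule: dec_induct)
    case base
    have "branch_sign A k * (\<integral>w. riesz B v (Suc k) A w * h (v k) w \<partial>M)
      = branch_sign A k * (\<integral>w. riesz B v k A w * h (v k) w \<partial>M) + (\<integral>w. riesz B v k A w * (h (v k) w)\<^sup>2 \<partial>M)"
      unfolding expand distrib_left sgn2 by (simp add: power2_eq_square mult.assoc)
    moreover have "\<bar>branch_sign A k * (\<integral>w. riesz B v k A w * h (v k) w \<partial>M)\<bar> \<le> d k"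
      unfolding sgn_abs using lac by (rule lacunaryD) simp
    ultimately show ?case using lacunaryD(3)[OF lac, of k A] by (simp add: abs_le_iff)
  next
    case (step n)
    have "branch_sign A k * (\<integral>w. riesz B v (Suc n) A w * h (v k) w \<partial>M)
      = branch_sign A k * (\<integral>w. riesz B v n A w * h (v k) w \<partial>M)
      + branch_sign A k * (branch_sign A n * (\<integral>w. riesz B v n A w * h (v k) w * h (v n) w \<partial>M))"
      unfolding expand distrib_left ..
    moreover have "\<bar>branch_sign A k * (branch_sign A n * (\<integral>w. riesz B v n A w * h (v k) w * h (v n) w \<partial>M))\<bar> \<le> d n"
      unfolding sgn_abs using lac by (rule lacunaryD) (use step in simp)
    moreover have "(\<Sum>j\<in>{k..<Suc n}. d j) = (\<Sum>j\<in>{k..<n}. d j) + d n"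
      using step by simp
    ultimately show ?case using step.IH by (simp add: abs_le_iff)
  qed
qed

theorem square_integrals_tendsto_zero:
  assumes w: "wRNP_over TYPE(nat \<Rightarrow> bool) TYPE('x)"
    and U: "ultrafilter U" and U1: "eventually (\<lambda>u. norm u \<le> 1) U"
    and U0: "\<And>x. ((\<lambda>u. blinfun_apply u x) \<longlongrightarrow> 0) U"
  shows "((\<lambda>u. \<integral>w. (h u w)\<^sup>2 \<partial>M) \<longlongrightarrow> 0) U"
proof -
  obtain q where q: "q \<in> borel_measurable M" "\<And>w. \<bar>q w\<bar> \<le> 1"
    and lim: "\<And>\<phi>. integrable M \<phi> \<Longrightarrow> ((\<lambda>u. \<integral>w. \<phi> w * (h u w)\<^sup>2 \<partial>M) \<longlongrightarrow> (\<integral>w. \<phi> w * q w \<partial>M)) U"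
    using limit_square_density[OF U U1] by blast
  define L where "L = (\<integral>w. q w \<partial>M)"
  have L: "((\<lambda>u. \<integral>w. (h u w)\<^sup>2 \<partial>M) \<longlongrightarrow> L) U"
    using lim[of "\<lambda>_. 1"] by (simp add: L_def)
  have "0 \<le> L"
    by (rule tendsto_lowerbound[OF L _ ultrafilter_not_bot[OF U]]) simp
  moreover have False if "0 < L"
  proof -
    have qint: "integrable M q"
      using q by (intro integrable_const_bound[of _ 1]) auto
    define c where "c = L / (4 * (measure M (space M) + 1))"
    have m0: "0 < measure M (space M) + 1" using measure_nonneg[of M "space M"] by linarith
    have c: "0 < c" using that m0 by (simp add: c_def)
    have cL: "2 * c * measure M (space M) < L"
    proof -
      have "c * (4 * (measure M (space M) + 1)) = L"
        using m0 by (simp add: c_def)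
      then have "L = 4 * (c * measure M (space M)) + 4 * c"
        by (simp add: algebra_simps)
      moreover have "0 \<le> c * measure M (space M)" using c by simp
      ultimately show ?thesis using c unfolding mult.assoc by linarith
    qed
    have "L \<le> (\<integral>w. 1 \<partial>M)"
      unfolding L_def using q(2) by (intro integral_mono qint) (auto simp: abs_le_iff)
    then have c1: "c \<le> 1" using m0 by (simp add: c_def field_simps)
    define B where "B = {w\<in>space M. 2 * c < q w}"
    have B: "B \<in> sets M" unfolding B_def using q(1) by measurable
    have b: "0 < measure M B"
    proof (rule ccontr)
      assume "\<not> 0 < measure M B"
      then have "measure M B = 0" using measure_nonneg[of M B] by linarith
      then have "AE w in M. w \<notin> B"
        using B by (intro AE_not_in) (simp add: null_sets_def emeasure_eq_measure)
      with AE_space have "AE w in M. q w \<le> 2 * c"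
        by eventually_elim (auto simp: B_def)
      then have "L \<le> (\<integral>w. 2 * c \<partial>M)"
        unfolding L_def by (intro integral_mono_AE qint) auto
      then show False using cL by (simp add: mult.commute)
    qed
    define \<eta> where "\<eta> = c * measure M B / 8"
    define d where "d k = \<eta> / 2 ^ Suc k" for k
    have eta: "0 < \<eta>" using c b by (simp add: \<eta>_def)
    then have d: "0 < d k" for k by (simp add: d_def)
    have "(\<Sum>k<n. d k) = \<eta> * (1 - (1/2) ^ n)" for n
      by (induction n) (simp_all add: d_def field_simps)
    then have dsum0: "(\<Sum>k<n. d k) \<le> \<eta>" for n using eta by simp
    have dsum: "(\<Sum>j\<in>{k..<n}. d j) \<le> \<eta>" for k n
    proof -
      have "(\<Sum>j\<in>{k..<n}. d j) \<le> (\<Sum>j<n. d j)"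
        using d by (intro sum_mono2) (auto intro: less_imp_le)
      then show ?thesis using dsum0[of n] by simp
    qed
    have sq: "\<forall>\<phi>. integrable M \<phi> \<longrightarrow> (\<forall>w. 0 \<le> \<phi> w) \<longrightarrow> (\<forall>w. w \<notin> B \<longrightarrow> \<phi> w = 0) \<longrightarrow> 0 < (\<integral>w. \<phi> w \<partial>M) \<longrightarrow>
      eventually (\<lambda>u. c * (\<integral>w. \<phi> w \<partial>M) \<le> (\<integral>w. \<phi> w * (h u w)\<^sup>2 \<partial>M)) U"
    proof (intro allI impI)
      fix \<phi> :: "'w \<Rightarrow> real"
      assume phi: "integrable M \<phi>" "\<forall>w. 0 \<le> \<phi> w" "\<forall>w. w \<notin> B \<longrightarrow> \<phi> w = 0" "0 < (\<integral>w. \<phi> w \<partial>M)"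
      have "2 * c * (\<integral>w. \<phi> w \<partial>M) = (\<integral>w. \<phi> w * (2 * c) \<partial>M)" by simp
      also have "\<dots> \<le> (\<integral>w. \<phi> w * q w \<partial>M)"
      proof (rule integral_mono)
        show "integrable M (\<lambda>w. \<phi> w * q w)" using integrable_mult_bounded[OF phi(1) q] .
        show "\<phi> w * (2 * c) \<le> \<phi> w * q w" for w
          using phi(2,3) by (cases "w \<in> B") (auto simp: B_def intro!: mult_left_mono)
      qed (use phi in simp)
      finally have "c * (\<integral>w. \<phi> w \<partial>M) < (\<integral>w. \<phi> w * q w \<partial>M)"
        using mult_pos_pos[OF c phi(4)] by linarith
      then have "eventually (\<lambda>u. c * (\<integral>w. \<phi> w \<partial>M) < (\<integral>w. \<phi> w * (h u w)\<^sup>2 \<partial>M)) U"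
        by (rule order_tendstoD(1)[OF lim[OF phi(1)]])
      then show "eventually (\<lambda>u. c * (\<integral>w. \<phi> w \<partial>M) \<le> (\<integral>w. \<phi> w * (h u w)\<^sup>2 \<partial>M)) U"
        by eventually_elim simp
    qed
    obtain v where lac: "lacunary B c d v"
      using exists_lacunary_sequence[of U B d c, OF U U1 U0 B d c sq] by blast
    note v = lacunaryD(1)[OF lac]
    define W where "W n A = V (riesz B v n A)" for n A
    note int = riesz_integrable[OF B, of v]
    have nn: "0 \<le> riesz B v n A w" for n A w by (rule riesz_nonneg) (rule v)
    have a: "\<bar>(\<integral>w. riesz B v n A w \<partial>M) - measure M B\<bar> \<le> \<eta>" for n A
      using integral_riesz_le[OF B lac, of n A] dsum0[of n] by (rule order_trans)
    have vW: "v k (W n A) = (\<integral>w. riesz B v n A w * h (v k) w \<partial>M)" for k n A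
      unfolding W_def by (rule h_integral[OF int])
    have corr: "c * measure M B / 2 \<le> branch_sign A k * v k (W n A)" if "k < n" for k n A
    proof -
      have "c * (measure M B - \<eta>) \<le> c * (\<integral>w. riesz B v k A w \<partial>M)"
        using a[of k A] c by (intro mult_left_mono) (auto simp: abs_le_iff)
      then have "c * (measure M B - \<eta>) - \<eta> \<le> branch_sign A k * v k (W n A)"
        using riesz_correlation[OF B lac that, of A] dsum[of k n]
        unfolding vW by linarith
      moreover have "c * \<eta> \<le> \<eta>" using c1 eta by (simp add: mult_left_le_one_le)
      then have "c * measure M B / 2 \<le> c * (measure M B - \<eta>) - \<eta>"
        using eta unfolding right_diff_distrib by (simp add: \<eta>_def)
      ultimately show ?thesis by linarith
    qed
    show False
    proof (rule wRNP_no_separated_tree[OF w, of W "measure M B + \<eta>" v "c * measure M B / 2"])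
      fix n and A :: "nat set" assume A: "A \<subseteq> {..<n}"
      then have "n \<notin> A" by auto
      have eq: "riesz B v n (insert n A) = riesz B v n A"
        by (rule riesz_cong) auto
      have half: "riesz B v n A = (\<lambda>w. (1/2) * (riesz B v (Suc n) (insert n A) w + riesz B v (Suc n) A w))"
        using \<open>n \<notin> A\<close> by (simp add: fun_eq_iff riesz_Suc eq branch_sign_def)
      show "W n A = (1/2) *\<^sub>R (W (Suc n) (insert n A) + W (Suc n) A)"
        unfolding W_def half V_scale[OF Bochner_Integration.integrable_add[OF int int]] V_add[OF int int] ..
      have "norm (W n A) \<le> (\<integral>w. \<bar>riesz B v n A w\<bar> \<partial>M)"
        unfolding W_def by (rule V_norm[OF int])
      also have "\<dots> \<le> measure M B + \<eta>" using a[of n A] nn by (simp add: abs_le_iff)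
      finally show "norm (W n A) \<le> measure M B + \<eta>" .
      have "(\<lambda>k. \<eta> / 2 * (1/2) ^ k) \<longlonglongrightarrow> \<eta> / 2 * 0"
        by (intro tendsto_mult_left LIMSEQ_power_zero) simp
      then have d0: "d \<longlonglongrightarrow> 0" by (simp add: d_def[abs_def] power_divide)
      show "(\<lambda>k. v k (W n A)) \<longlonglongrightarrow> 0"
        by (rule Lim_null_comparison[OF _ d0])
          (use lacunaryD(2)[OF lac] in \<open>auto simp: vW eventually_sequentially intro!: exI[of _ n]\<close>)
    next
      fix k n :: nat and A :: "nat set" assume k: "k < n"
      show "c * measure M B / 2 \<le> v k (W n A)" if "k \<in> A"
        using corr[OF k, of A] that by (simp add: branch_sign_def)
      show "v k (W n A) \<le> - (c * measure M B / 2)" if "k \<notin> A"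
        using corr[OF k, of A] that by (simp add: branch_sign_def)
    qed (use v c b in auto)
  qed
  ultimately show ?thesis using L by (cases "L = 0") auto
qed

end

lemma wRNP_over_coin:
  assumes w: "wRNP TYPE('x::banach)" and ex: "\<exists>u :: 'x dual. u \<noteq> 0"
  shows "wRNP_over TYPE(nat \<Rightarrow> bool) TYPE('x)"
proof -
  obtain u :: "'x dual" where "u \<noteq> 0" using ex by blast
  then obtain x where x: "u x \<noteq> 0" by (metis blinfun_eqI zero_blinfun.rep_eq)
  define w0 :: "'x dual dual" where "w0 = Blinfun (\<lambda>v. blinfun_apply v x)"
  have "w0 u = u x"
    unfolding w0_def by (subst bounded_linear_Blinfun_apply) (rule blinfun.bounded_linear_left, rule refl)
  then have w0: "w0 \<noteq> 0" using x by auto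
  obtain g :: "nat set \<Rightarrow> real" where g: "bij g"
    using nat_sets_eqpoll_reals unfolding eqpoll_def by blast
  have "inj (\<lambda>t. g {i. t i} *\<^sub>R w0)"
  proof (rule injI)
    fix s t assume "g {i. s i} *\<^sub>R w0 = g {i. t i} *\<^sub>R w0"
    then have "{i. s i} = {i. t i}" using w0 bij_is_inj[OF g] by (simp add: inj_eq)
    then show "s = t" by (auto simp: fun_eq_iff set_eq_iff)
  qed
  then show ?thesis
    using wRNP_over_inj[where 'o="'x dual dual" and 'b="nat \<Rightarrow> bool" and 'x='x] w unfolding wRNP_def by blast
qed

context weak_densities begin

lemma h_unique:
  assumes g: "integrable M g" and eq: "\<And>E. E \<in> sets M \<Longrightarrow> blinfun_apply u (V (indicator E)) = (\<integral>w. indicator E w * g w \<partial>M)"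
  shows "AE w in M. h u w = g w"
proof (rule density_unique_real)
  show "integrable M (h u)"
    using integrable_mult_h[of "\<lambda>_. 1" u] by simp
  fix E assume E: "E \<in> sets M"
  show "(\<integral>w\<in>E. h u w \<partial>M) = (\<integral>w\<in>E. g w \<partial>M)"
    using eq[OF E] h_integral[OF integrable_indicator_real[OF E], of u] by (simp add: set_lebesgue_integral_def)
qed (rule g)

lemma integrable_h: "integrable M (h u)"
  using integrable_mult_h[of "\<lambda>_. 1" u] by simp

lemma h_sum: "AE w in M. h (\<Sum>i\<in>I. a i *\<^sub>R u i) w = (\<Sum>i\<in>I. a i * h (u i) w)"
proof (rule h_unique)
  show "integrable M (\<lambda>w. \<Sum>i\<in>I. a i * h (u i) w)" using integrable_h by simp
  fix E assume E: "E \<in> sets M"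
  note ind = integrable_indicator_real[OF E]
  have "blinfun_apply (\<Sum>i\<in>I. a i *\<^sub>R u i) (V (indicator E)) = (\<Sum>i\<in>I. a i * (\<integral>w. indicator E w * h (u i) w \<partial>M))"
    unfolding blinfun.sum_left blinfun.scaleR_left by (simp add: h_integral[OF ind])
  also have "\<dots> = (\<integral>w. (\<Sum>i\<in>I. a i * (indicator E w * h (u i) w)) \<partial>M)"
    using integrable_mult_h[OF ind] by (subst Bochner_Integration.integral_sum) auto
  finally show "blinfun_apply (\<Sum>i\<in>I. a i *\<^sub>R u i) (V (indicator E)) = (\<integral>w. indicator E w * (\<Sum>i\<in>I. a i * h (u i) w) \<partial>M)"
    by (simp add: sum_distrib_left mult_ac)
qed

lemma h_scale: "AE w in M. h (c *\<^sub>R u) w = c * h u w"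
  using h_sum[where I="{()}" and a="\<lambda>_. c" and u="\<lambda>_. u"] by simp

lemma h_diff: "AE w in M. h (u - v) w = h u w - h v w"
proof -
  have "(\<Sum>b\<in>UNIV. (if b then 1 else - 1) *\<^sub>R (if b then u else v)) = u - v"
    by (simp add: UNIV_bool)
  then show ?thesis
    using h_sum[where I=UNIV and a="\<lambda>b. if b then 1 else - 1" and u="\<lambda>b. if b then u else v"]
    by (simp add: UNIV_bool)
qed

lemma integrable_h_powr: "0 \<le> p \<Longrightarrow> integrable M (\<lambda>w. \<bar>h u w\<bar> powr p)"
  using h_le by (intro integrable_const_bound[of _ "norm u powr p"]) (auto intro!: powr_mono2)

lemma sum_powr_h_le:
  assumes p: "1 \<le> p"
  shows "AE w in M. (\<Sum>i<n. \<bar>h (u i) w\<bar> powr p) \<le> weak_norm p n u powr p"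
proof -
  have "AE w in M. (\<Sum>i<n. of_rat (l ! i) * h (u i) w) \<le> norm (\<Sum>i<n. of_rat (l ! i) *\<^sub>R u i)" for l :: "rat list"
    using h_sum[where I="{..<n}" and a="\<lambda>i. of_rat (l ! i)" and u=u]
  proof eventually_elim
    case (elim w)
    then show ?case using h_le[of "\<Sum>i<n. of_rat (l ! i) *\<^sub>R u i" w] by (simp add: abs_le_iff)
  qed
  then have "AE w in M. \<forall>l :: rat list. (\<Sum>i<n. of_rat (l ! i) * h (u i) w) \<le> norm (\<Sum>i<n. of_rat (l ! i) *\<^sub>R u i)"
    by (simp add: AE_all_countable)
  then show ?thesis
  proof eventually_elim
    case (elim w)
    show ?case
      by (rule sum_powr_le_weak_norm[OF p], rule sum_le_norm_of_rational) (use elim in blast)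
  qed
qed

lemma square_integrals_tendsto_zero_bounded:
  assumes w: "wRNP TYPE('x)"
    and b: "eventually (\<lambda>u. norm u \<le> R) F" and F0: "\<And>x. ((\<lambda>u. blinfun_apply u x) \<longlongrightarrow> 0) F"
  shows "((\<lambda>u. \<integral>w. (h u w)\<^sup>2 \<partial>M) \<longlongrightarrow> 0) F"
proof (cases "\<exists>u :: 'x dual. u \<noteq> 0")
  case False
  then have nz: "norm u = 0" for u :: "'x dual" by simp
  have "h u w = 0" for u w using h_le[of u w] unfolding nz by simp
  then show ?thesis by simp
next
  case True
  define r where "r = \<bar>R\<bar> + 1"
  have r: "0 < r" by (simp add: r_def)
  show ?thesis
  proof (rule tendsto_if_ultrafilters)
    fix U :: "'x dual filter" assume U: "ultrafilter U" "U \<le> F"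
    let ?G = "filtermap (\<lambda>u. (1 / r) *\<^sub>R u) U"
    have "((\<lambda>u. \<integral>w. (h u w)\<^sup>2 \<partial>M) \<longlongrightarrow> 0) ?G"
    proof (rule square_integrals_tendsto_zero[OF wRNP_over_coin[OF w True] ultrafilter_filtermap[OF U(1)]])
      have "eventually (\<lambda>u. norm u \<le> R) U" using b U(2) by (simp add: le_filter_def)
      then show "eventually (\<lambda>u. norm u \<le> 1) ?G"
        unfolding eventually_filtermap by eventually_elim (use r in \<open>simp add: r_def field_simps\<close>)
      fix x
      have "((\<lambda>u. (1 / r) * blinfun_apply u x) \<longlongrightarrow> (1 / r) * 0) U"
        by (intro tendsto_mult_left tendsto_mono[OF U(2) F0])
      then show "((\<lambda>u. blinfun_apply u x) \<longlongrightarrow> 0) ?G"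
        by (simp add: filterlim_filtermap blinfun.scaleR_left)
    qed
    then have "((\<lambda>u. r\<^sup>2 * (\<integral>w. (h ((1 / r) *\<^sub>R u) w)\<^sup>2 \<partial>M)) \<longlongrightarrow> r\<^sup>2 * 0) U"
      unfolding filterlim_filtermap by (intro tendsto_mult_left)
    moreover have "r\<^sup>2 * (\<integral>w. (h ((1 / r) *\<^sub>R u) w)\<^sup>2 \<partial>M) = (\<integral>w. (h u w)\<^sup>2 \<partial>M)" for u
    proof -
      have "(\<integral>w. (h ((1 / r) *\<^sub>R u) w)\<^sup>2 \<partial>M) = (\<integral>w. (1 / r)\<^sup>2 * (h u w)\<^sup>2 \<partial>M)"
      proof (rule integral_cong_AE)
        show "AE w in M. (h ((1 / r) *\<^sub>R u) w)\<^sup>2 = (1 / r)\<^sup>2 * (h u w)\<^sup>2"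
          using h_scale[of "1 / r" u] by eventually_elim (simp add: power_divide)
      qed auto
      then show ?thesis using r by (simp add: power_divide)
    qed
    ultimately show "((\<lambda>u. \<integral>w. (h u w)\<^sup>2 \<partial>M) \<longlongrightarrow> 0) U" by simp
  qed
qed

lemma powr_integrals_tendsto:
  assumes w: "wRNP TYPE('x)" and p: "1 \<le> p"
    and b: "eventually (\<lambda>u. norm u \<le> R) F"
    and F: "\<And>x. ((\<lambda>u. blinfun_apply u x) \<longlongrightarrow> blinfun_apply u0 x) F"
  shows "((\<lambda>u. \<integral>w. \<bar>h u w\<bar> powr p \<partial>M) \<longlongrightarrow> (\<integral>w. \<bar>h u0 w\<bar> powr p \<partial>M)) F"
proof -
  let ?G = "filtermap (\<lambda>u. u - u0) F"
  have G: "((\<lambda>u. \<integral>w. (h u w)\<^sup>2 \<partial>M) \<longlongrightarrow> 0) ?G"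
  proof (rule square_integrals_tendsto_zero_bounded[OF w])
    show "eventually (\<lambda>u. norm u \<le> R + norm u0) ?G"
      unfolding eventually_filtermap using b
    proof eventually_elim
      case (elim u)
      then show ?case using norm_triangle_ineq4[of u u0] by linarith
    qed
    fix x
    have "((\<lambda>u. blinfun_apply u x - blinfun_apply u0 x) \<longlongrightarrow> blinfun_apply u0 x - blinfun_apply u0 x) F"
      by (intro tendsto_diff F tendsto_const)
    then show "((\<lambda>u. blinfun_apply u x) \<longlongrightarrow> 0) ?G"
      by (simp add: filterlim_filtermap blinfun.diff_left)
  qed
  define Q where "Q = max R (norm u0)"
  define C where "C = p * Q powr (p - 1)"
  have C: "0 \<le> C" using p by (simp add: C_def)
  define m where "m = measure M (space M)"
  define N where "N u = (\<integral>w. (h (u - u0) w)\<^sup>2 \<partial>M)" for u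
  have N: "(N \<longlongrightarrow> 0) F" using G unfolding N_def filterlim_filtermap .
  have le: "\<bar>(\<integral>w. \<bar>h u w\<bar> powr p \<partial>M) - (\<integral>w. \<bar>h u0 w\<bar> powr p \<partial>M)\<bar> \<le> C * (d * m + N u / d)"
    if u: "norm u \<le> R" and d: "0 < d" for u d
  proof -
    have i: "integrable M (\<lambda>w. (h v w)\<^sup>2)" for v
      using integrable_mult_h2[of "\<lambda>_. 1" v] by simp
    have "\<bar>(\<integral>w. \<bar>h u w\<bar> powr p \<partial>M) - (\<integral>w. \<bar>h u0 w\<bar> powr p \<partial>M)\<bar>
        = \<bar>\<integral>w. \<bar>h u w\<bar> powr p - \<bar>h u0 w\<bar> powr p \<partial>M\<bar>"
      using p by (subst Bochner_Integration.integral_diff) (auto intro!: integrable_h_powr)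
    also have "\<dots> \<le> (\<integral>w. \<bar>\<bar>h u w\<bar> powr p - \<bar>h u0 w\<bar> powr p\<bar> \<partial>M)"
      by (rule integral_abs_bound)
    also have "\<dots> \<le> (\<integral>w. C * (d + (h (u - u0) w)\<^sup>2 / d) \<partial>M)"
    proof (rule integral_mono_AE)
      show "integrable M (\<lambda>w. \<bar>\<bar>h u w\<bar> powr p - \<bar>h u0 w\<bar> powr p\<bar>)"
        using p by (intro integrable_abs Bochner_Integration.integrable_diff integrable_h_powr) auto
      show "integrable M (\<lambda>w. C * (d + (h (u - u0) w)\<^sup>2 / d))"
        using i by auto
      show "AE w in M. \<bar>\<bar>h u w\<bar> powr p - \<bar>h u0 w\<bar> powr p\<bar> \<le> C * (d + (h (u - u0) w)\<^sup>2 / d)"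
        using h_diff[of u u0]
      proof eventually_elim
        case (elim w)
        have "\<bar>h u w\<bar> \<le> Q" "\<bar>h u0 w\<bar> \<le> Q"
          using h_le[of u w] h_le[of u0 w] u by (simp_all add: Q_def le_max_iff_disj)
        then have "\<bar>\<bar>h u w\<bar> powr p - \<bar>h u0 w\<bar> powr p\<bar> \<le> C * \<bar>h (u - u0) w\<bar>"
          unfolding elim C_def by (rule abs_powr_diff_le[OF p])
        also have "\<bar>h (u - u0) w\<bar> \<le> d + (h (u - u0) w)\<^sup>2 / d"
        proof (cases "\<bar>h (u - u0) w\<bar> \<le> d")
          case True
          have "0 \<le> (h (u - u0) w)\<^sup>2 / d" using d by simp
          then show ?thesis using True by linarith
        next
          case False
          then have "d * \<bar>h (u - u0) w\<bar> \<le> \<bar>h (u - u0) w\<bar> * \<bar>h (u - u0) w\<bar>" by (intro mult_right_mono) auto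
          then have "\<bar>h (u - u0) w\<bar> \<le> (h (u - u0) w)\<^sup>2 / d" using d by (simp add: field_simps power2_eq_square)
          then show ?thesis using d by linarith
        qed
        then have "C * \<bar>h (u - u0) w\<bar> \<le> C * (d + (h (u - u0) w)\<^sup>2 / d)"
          using C by (rule mult_left_mono)
        finally show ?case .
      qed
    qed
    also have "\<dots> = C * (d * m + N u / d)"
      using i by (simp add: N_def m_def mult.commute)
    finally show ?thesis .
  qed
  show ?thesis
  proof (rule tendstoI)
    fix e :: real assume e: "0 < e"
    have m: "0 \<le> m" by (simp add: m_def)
    define d where "d = e / (2 * (C * m + 1))"
    have Cm: "0 < C * m + 1" using C m by (simp add: add_nonneg_pos)
    have d: "0 < d" using e Cm by (simp add: d_def)
    have "((\<lambda>u. C * (d * m + N u / d)) \<longlongrightarrow> C * (d * m + 0 / d)) F"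
      by (intro tendsto_intros N) (use d in simp)
    moreover have "C * (d * m + 0 / d) < e"
    proof -
      have "C * (d * m + 0 / d) = d * (C * m)" by simp
      also have "\<dots> \<le> d * (C * m + 1)" using d by (intro mult_left_mono) auto
      also have "\<dots> = e / 2" using Cm by (simp add: d_def field_simps)
      also have "\<dots> < e" using e by simp
      finally show ?thesis .
    qed
    ultimately have "eventually (\<lambda>u. C * (d * m + N u / d) < e) F" by (rule order_tendstoD(2))
    with b show "eventually (\<lambda>u. dist (\<integral>w. \<bar>h u w\<bar> powr p \<partial>M) (\<integral>w. \<bar>h u0 w\<bar> powr p \<partial>M) < e) F"
    proof eventually_elim
      case (elim u)
      then show ?case using le[OF elim(1) d] by (simp add: dist_real_def)
    qed
  qed
qed

end

section \<open>The dominating function\<close>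

definition predual_eval :: "('x::real_normed_vector \<Rightarrow> 'y::real_normed_vector dual) \<Rightarrow> 'y \<Rightarrow> 'x dual" where
  "predual_eval J y = Blinfun (\<lambda>x. J x y)"

lemma predual_eval_apply:
  assumes J: "linear J" "\<And>x. norm (J x) = norm x"
  shows "predual_eval J y x = J x y"
proof -
  have "bounded_linear (\<lambda>x. J x y)"
  proof (rule bounded_linear_intro)
    show "norm (J x y) \<le> norm x * norm y" for x using norm_blinfun[of "J x" y] by (simp add: J(2))
  qed (simp_all add: linear_add[OF J(1)] linear_scale[OF J(1)] blinfun.add_left blinfun.scaleR_left)
  then show ?thesis by (simp add: predual_eval_def bounded_linear_Blinfun_apply)
qed

lemma predual_eval_scale:
  assumes J: "linear J" "\<And>x. norm (J x) = norm x"
  shows "predual_eval J (c *\<^sub>R y) = c *\<^sub>R predual_eval J y"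
  by (rule blinfun_eqI) (simp add: predual_eval_apply[OF J] blinfun.scaleR_right blinfun.scaleR_left)

lemma norm_predual_eval_le:
  assumes J: "linear J" "\<And>x. norm (J x) = norm x"
  shows "norm (predual_eval J y) \<le> norm y"
proof (rule norm_blinfun_bound)
  show "norm (predual_eval J y x) \<le> norm y * norm x" for x
    using norm_blinfun[of "J x" y] by (simp add: predual_eval_apply[OF J] J(2) mult.commute)
qed simp

text \<open>The dominating measure lives on the Stone space of the discrete unit ball, so that no Radon
  measures on a weak* compact ball are needed.\<close>

lemma Pietsch_measure:
  fixes J :: "'x::real_normed_vector \<Rightarrow> 'y::real_normed_vector dual" and f :: "'i \<Rightarrow> 'x dual \<Rightarrow> real"
  assumes J: "linear J" "\<And>x. norm (J x) = norm x"
    and p: "1 \<le> p" and S: "0 \<le> S" and I: "I \<noteq> {}"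
    and dir: "\<And>i j. i \<in> I \<Longrightarrow> j \<in> I \<Longrightarrow> \<exists>k\<in>I. f i \<le> f k \<and> f j \<le> f k"
    and nonneg: "\<And>i u. i \<in> I \<Longrightarrow> 0 \<le> f i u"
    and hom: "\<And>i c u. i \<in> I \<Longrightarrow> 0 \<le> c \<Longrightarrow> f i (c *\<^sub>R u) = c * f i u"
    and bound: "\<And>i n u. i \<in> I \<Longrightarrow> (\<Sum>j<n. \<bar>f i (u j)\<bar> powr p) powr (1 / p) \<le> S * weak_norm p n u"
  shows "\<exists>M :: 'x filter measure. space M = stone_space (cball 0 1) \<and> prob_space M \<and>
    (\<forall>A\<subseteq>cball 0 1. stone_set (cball 0 1) A \<in> sets M) \<and>
    (\<forall>i\<in>I. \<forall>y. f i (predual_eval J y) powr p \<le> S powr p * (\<integral>F. \<bar>Lim F (\<lambda>x. J x y)\<bar> powr p \<partial>M))"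
proof -
  let ?B = "cball 0 1 :: 'x set"
  let ?e = "predual_eval J"
  note V = subspace_bounded_functions[of ?B]
  define G where "G yi x = S powr p * \<bar>J x (fst yi)\<bar> powr p - f (snd yi) (?e (fst yi)) powr p" for yi x
  define \<kappa> where "\<kappa> l = (\<lambda>x. \<Sum>yi\<leftarrow>l. G yi x)" for l
  define K where "K = \<kappa> ` {l. set l \<subseteq> UNIV \<times> I}"
  have Jle: "\<bar>J x y\<bar> \<le> norm y" if "x \<in> ?B" for x y
    using norm_blinfun[of "J x" y] mult_right_mono[of "norm x" 1 "norm y"] that by (simp add: J(2))
  have Jp: "\<bar>J x y\<bar> powr p \<le> norm y powr p" if "x \<in> ?B" for x y
    using Jle[OF that] p by (intro powr_mono2) auto
  have phiV: "(\<lambda>x. \<bar>J x y\<bar> powr p) \<in> bounded_functions ?B" for y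
    using Jp by (intro bounded_functionsI[of _ _ "norm y powr p"]) auto
  have constV: "(\<lambda>x. c) \<in> bounded_functions ?B" for c :: real
    by (rule bounded_functionsI[of _ _ "\<bar>c\<bar>"]) simp
  have Geq: "G (y, i) = (S powr p) *\<^sub>R (\<lambda>x. \<bar>J x y\<bar> powr p) + (- (f i (?e y) powr p)) *\<^sub>R (\<lambda>x. 1)" for y i
    by (simp add: G_def[abs_def] scaleR_fun_def fun_eq_iff)
  have GV: "G yi \<in> bounded_functions ?B" for yi
    by (cases yi) (simp only: Geq, intro subspace_add[OF V] subspace_scale[OF V] phiV constV)
  have kV: "\<kappa> l \<in> bounded_functions ?B" for l
  proof (induction l)
    case Nil
    then show ?case using constV[of 0] by (simp add: \<kappa>_def)
  next
    case (Cons a l)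
    have "\<kappa> (a # l) = G a + \<kappa> l" by (simp add: \<kappa>_def fun_eq_iff)
    then show ?case using subspace_add[OF V GV Cons] by (simp only:)
  qed
  have Gscale: "c * G (y, i) x = G ((c powr (1 / p)) *\<^sub>R y, i) x" if "0 \<le> c" "i \<in> I" for c y i x
  proof -
    have "\<bar>J x ((c powr (1 / p)) *\<^sub>R y)\<bar> powr p = c * \<bar>J x y\<bar> powr p"
      using that p by (simp add: blinfun.scaleR_right abs_mult powr_mult powr_powr)
    moreover have "f i (?e ((c powr (1 / p)) *\<^sub>R y)) powr p = c * f i (?e y) powr p"
      using that p nonneg[OF that(2)] by (simp add: predual_eval_scale[OF J] hom powr_mult powr_powr)
    ultimately show ?thesis by (simp add: G_def algebra_simps)
  qed
  have "\<exists>L. mean_on ?B L \<and> (\<forall>\<phi>\<in>K. 0 \<le> L \<phi>)"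
  proof (rule exists_mean)
    show "?B \<noteq> {}" by auto
    show "K \<subseteq> bounded_functions ?B" using kV by (auto simp: K_def)
    show "0 \<in> K" unfolding K_def by (rule image_eqI[of _ _ "[]"]) (auto simp: \<kappa>_def)
    fix \<phi> \<psi> assume "\<phi> \<in> K" "\<psi> \<in> K"
    then obtain l l' where l: "set l \<subseteq> UNIV \<times> I" "set l' \<subseteq> UNIV \<times> I" "\<phi> = \<kappa> l" "\<psi> = \<kappa> l'"
      by (auto simp: K_def)
    then have "\<phi> + \<psi> = \<kappa> (l @ l')" by (simp add: \<kappa>_def fun_eq_iff)
    then show "\<phi> + \<psi> \<in> K" unfolding K_def using l by (intro image_eqI[of _ _ "l @ l'"]) auto
  next
    fix c \<phi> assume c: "(0::real) \<le> c" and "\<phi> \<in> K"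
    then obtain l where l: "set l \<subseteq> UNIV \<times> I" "\<phi> = \<kappa> l" by (auto simp: K_def)
    let ?m = "map (\<lambda>yi. ((c powr (1 / p)) *\<^sub>R fst yi, snd yi)) l"
    have "c * \<kappa> l x = \<kappa> ?m x" for x
      using l(1) by (induction l) (auto simp: \<kappa>_def distrib_left Gscale[OF c])
    then have "c *\<^sub>R \<phi> = \<kappa> ?m" by (simp add: l(2) scaleR_fun_def fun_eq_iff)
    moreover have "set ?m \<subseteq> UNIV \<times> I" using l(1) by auto
    ultimately show "c *\<^sub>R \<phi> \<in> K" unfolding K_def by blast
  next
    fix \<phi> assume "\<phi> \<in> K"
    then obtain l where l: "set l \<subseteq> UNIV \<times> I" "\<phi> = \<kappa> l" by (auto simp: K_def)
    define s where "s = (SUP x\<in>?B. \<phi> x)"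
    have s: "\<phi> x \<le> s" if "x \<in> ?B" for x
      unfolding s_def using that kV[of l] l(2) by (intro cSUP_upper bounded_functions_bdd) auto
    have "\<exists>k\<in>I. \<forall>yi\<in>set l. f (snd yi) \<le> f k"
      using l(1)
    proof (induction l)
      case Nil
      then show ?case using I by auto
    next
      case (Cons a l)
      then obtain k where k: "k \<in> I" "\<forall>yi\<in>set l. f (snd yi) \<le> f k" by auto
      moreover have "snd a \<in> I" using Cons.prems by auto
      ultimately obtain k' where "k' \<in> I" "f k \<le> f k'" "f (snd a) \<le> f k'" using dir by metis
      then show ?case using k(2) by (metis order_trans set_ConsD)
    qed
    then obtain k where k: "k \<in> I" "\<And>yi. yi \<in> set l \<Longrightarrow> f (snd yi) \<le> f k" by blast
    let ?n = "length l"
    define u where "u j = ?e (fst (l ! j))" for j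
    define Z where "Z = (\<Sum>j<?n. f (snd (l ! j)) (u j) powr p)"
    have phi: "\<phi> x = S powr p * (\<Sum>j<?n. \<bar>u j x\<bar> powr p) - Z" for x
      by (simp add: l(2) \<kappa>_def G_def sum_list_sum_nth Z_def u_def predual_eval_apply[OF J]
          sum_subtractf sum_distrib_left atLeast0LessThan)
    have "Z \<le> (\<Sum>j<?n. \<bar>f k (u j)\<bar> powr p)"
      unfolding Z_def
    proof (rule sum_mono)
      fix j assume "j \<in> {..<?n}"
      then have m: "l ! j \<in> set l" by simp
      then have "snd (l ! j) \<in> I" using l(1) by auto
      then show "f (snd (l ! j)) (u j) powr p \<le> \<bar>f k (u j)\<bar> powr p"
        using k(2)[OF m] nonneg p by (intro powr_mono2) (auto simp: le_fun_def intro: order_trans[OF _ abs_ge_self])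
    qed
    also have "\<dots> = ((\<Sum>j<?n. \<bar>f k (u j)\<bar> powr p) powr (1 / p)) powr p"
      using p by (simp add: powr_powr sum_nonneg)
    also have "\<dots> \<le> (S * weak_norm p ?n u) powr p"
      using p bound[OF k(1)] by (intro powr_mono2) auto
    also have "\<dots> = S powr p * weak_norm p ?n u powr p"
      using S weak_norm_nonneg[OF p] by (simp add: powr_mult)
    finally have Zle: "Z \<le> S powr p * weak_norm p ?n u powr p" .
    show "0 \<le> (SUP x\<in>?B. \<phi> x)"
    proof (cases "S = 0")
      case True
      then show ?thesis using Zle s[of 0] phi[of 0] by (simp add: s_def)
    next
      case False
      then have Sp: "0 < S powr p" by simp
      define T where "T = (s + Z) / S powr p"
      have T: "(\<Sum>j<?n. \<bar>u j x\<bar> powr p) \<le> T" if "norm x \<le> 1" for x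
        using s[of x] phi[of x] Sp that by (simp add: T_def field_simps)
      have T0: "0 \<le> T" using T[of 0] order_trans[OF sum_nonneg] by (simp add: blinfun.zero_right)
      have "weak_norm p ?n u powr p \<le> (T powr (1 / p)) powr p"
        using p weak_norm_nonneg[OF p] weak_norm_dual_le[OF p T] by (intro powr_mono2) auto
      also have "\<dots> = T" using p T0 by (simp add: powr_powr)
      finally have "Z \<le> S powr p * T" using Zle Sp by (meson mult_left_mono less_imp_le order_trans)
      also have "\<dots> = s + Z" using Sp by (simp add: T_def)
      finally show ?thesis by (simp add: s_def)
    qed
  qed
  then obtain L where mean: "mean_on ?B L" and LK: "\<And>\<phi>. \<phi> \<in> K \<Longrightarrow> 0 \<le> L \<phi>" by blast
  note L = mean_onD[OF mean]
  obtain M :: "'x filter measure" where M: "space M = stone_space ?B" "prob_space M"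
    "\<forall>A\<subseteq>?B. stone_set ?B A \<in> sets M"
    and LM: "\<forall>\<phi> C. (\<forall>x\<in>?B. 0 \<le> \<phi> x \<and> \<phi> x \<le> C) \<longrightarrow> L \<phi> \<le> (\<integral>F. Lim F \<phi> \<partial>M)"
    using mean_stone_measure[OF mean] by (elim exE conjE)
  show ?thesis
  proof (intro exI[of _ M] conjI M ballI allI)
    fix i y assume i: "i \<in> I"
    have 1: "1 \<le> - L (\<lambda>x. - 1)"
      using L(3)[OF constV, of "- 1" "- 1"] by simp
    have "G (y, i) \<in> K" unfolding K_def using i by (intro image_eqI[of _ _ "[(y, i)]"]) (auto simp: \<kappa>_def)
    then have "0 \<le> L (G (y, i))" by (rule LK)
    also have "\<dots> = S powr p * L (\<lambda>x. \<bar>J x y\<bar> powr p) - f i (?e y) powr p * L (\<lambda>x. 1)"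
      unfolding Geq L(1)[OF subspace_scale[OF V phiV] subspace_scale[OF V constV]] L(2)[OF phiV] L(2)[OF constV] by simp
    finally have "f i (?e y) powr p * L (\<lambda>x. 1) \<le> S powr p * L (\<lambda>x. \<bar>J x y\<bar> powr p)" by simp
    moreover have "1 \<le> L (\<lambda>x. 1)"
      using 1 L(2)[OF constV, of "-1" 1] by (simp add: scaleR_fun_def)
    then have "f i (?e y) powr p * 1 \<le> f i (?e y) powr p * L (\<lambda>x. 1)" by (intro mult_left_mono) auto
    moreover have "L (\<lambda>x. \<bar>J x y\<bar> powr p) \<le> (\<integral>F. Lim F (\<lambda>x. \<bar>J x y\<bar> powr p) \<partial>M)"
      using Jp by (intro LM[rule_format, of _ "norm y powr p"]) auto
    moreover have "(\<integral>F. Lim F (\<lambda>x. \<bar>J x y\<bar> powr p) \<partial>M) = (\<integral>F. \<bar>Lim F (\<lambda>x. J x y)\<bar> powr p \<partial>M)"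
    proof (intro Bochner_Integration.integral_cong refl)
      fix F assume "F \<in> space M"
      then have F: "F \<in> stone_space ?B" using M(1) by simp
      have "((\<lambda>x. J x y) \<longlongrightarrow> Lim F (\<lambda>x. J x y)) F"
        using stone_limit_exists(1)[of ?B "\<lambda>x. J x y" "norm y", OF Jle F] .
      then have "((\<lambda>x. \<bar>J x y\<bar> powr p) \<longlongrightarrow> \<bar>Lim F (\<lambda>x. J x y)\<bar> powr p) F"
        using p by (intro tendsto_powr' tendsto_rabs tendsto_const) auto
      then show "Lim F (\<lambda>x. \<bar>J x y\<bar> powr p) = \<bar>Lim F (\<lambda>x. J x y)\<bar> powr p"
        using F by (intro tendsto_Lim) (auto simp: stone_space_def dest: ultrafilter_not_bot)
    qed
    ultimately show "f i (?e y) powr p \<le> S powr p * (\<integral>F. \<bar>Lim F (\<lambda>x. J x y)\<bar> powr p \<partial>M)"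
      using mult_left_mono[of "L (\<lambda>x. \<bar>J x y\<bar> powr p)" "\<integral>F. \<bar>Lim F (\<lambda>x. J x y)\<bar> powr p \<partial>M" "S powr p"] by simp
  qed
qed

lemma weak_star_open_nbhd:
  fixes u :: "'x::real_normed_vector dual"
  assumes W: "openin weak_star_topology (W :: 'x dual set)" "u \<in> W"
  shows "\<exists>F. finite F \<and> (\<exists>e>0. \<forall>v :: 'x dual. (\<forall>x\<in>F. \<bar>blinfun_apply u x - blinfun_apply v x\<bar> < e) \<longrightarrow> v \<in> W)"
proof -
  obtain O' where O': "open O'" "W = blinfun_apply -` O'"
    using W(1) unfolding strong_operator_topology_def openin_pullback_topology by auto
  have "openin (product_topology (\<lambda>i. euclidean) UNIV) O'"
    using O'(1) by (simp add: open_fun_def)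
  from product_topology_open_contains_basis[OF this, of "blinfun_apply u"]
  obtain X where X: "\<And>i. u i \<in> X i" "\<And>i. open (X i)" "finite {i. X i \<noteq> UNIV}"
    "(\<Pi>\<^sub>E i\<in>UNIV. X i) \<subseteq> O'"
    using W(2) O'(2) by (auto simp: PiE_UNIV_domain Pi_iff)
  have "\<exists>e>0. \<forall>r. \<bar>u i - r\<bar> < e \<longrightarrow> r \<in> X i" for i
    using openE[OF X(2) X(1), of i] by (auto simp: subset_iff dist_real_def mem_ball)
  then obtain e where e: "\<And>i. 0 < e i" "\<And>i r. \<bar>u i - r\<bar> < e i \<Longrightarrow> r \<in> X i" by metis
  let ?F = "{i. X i \<noteq> UNIV}"
  show ?thesis
  proof (intro exI[of _ ?F] exI[of _ "Min (insert 1 (e ` ?F))"] conjI allI impI)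
    show "0 < Min (insert 1 (e ` ?F))" using X(3) e(1) by (subst Min_gr_iff) auto
    fix v :: "'x dual" assume v: "\<forall>x\<in>?F. \<bar>u x - v x\<bar> < Min (insert 1 (e ` ?F))"
    have "v i \<in> X i" for i
    proof (cases "i \<in> ?F")
      case True
      then have "Min (insert 1 (e ` ?F)) \<le> e i" using X(3) by (intro Min_le) auto
      then show ?thesis using bspec[OF v True] e(2)[of i "v i"] by linarith
    qed auto
    then have "blinfun_apply v \<in> O'" using X(4) by (auto simp: PiE_UNIV_domain)
    then show "v \<in> W" using O'(2) by simp
  qed (rule X(3))
qed

lemma le_if_le_on_predual:
  fixes J :: "'x::real_normed_vector \<Rightarrow> 'y::real_normed_vector dual" and f g :: "'x dual \<Rightarrow> real"
  assumes J: "linear J" "\<And>x. norm (J x) = norm x"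
    and f: "\<And>B. bounded B \<Longrightarrow> continuous_map (subtopology weak_star_topology B) euclideanreal f"
    and g: "\<And>B. bounded B \<Longrightarrow> continuous_map (subtopology weak_star_topology B) euclideanreal g"
    and le: "\<And>y. f (predual_eval J y) \<le> g (predual_eval J y)"
  shows "f u \<le> g u"
proof (rule ccontr)
  assume no: "\<not> f u \<le> g u"
  let ?D = "cball 0 (norm u + 1) :: 'x dual set"
  let ?T = "subtopology weak_star_topology ?D"
  have "continuous_map ?T euclideanreal (\<lambda>v. f v - g v)"
    by (intro continuous_map_diff f g) auto
  then have "openin ?T {v \<in> topspace ?T. f v - g v \<in> {0<..}}"
    by (rule openin_continuous_map_preimage) simp
  then obtain W where W: "openin weak_star_topology W" "{v \<in> topspace ?T. f v - g v \<in> {0<..}} = W \<inter> ?D"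
    by (auto simp: openin_subtopology)
  have "u \<in> W \<inter> ?D" unfolding W(2)[symmetric] using no by (simp add: strong_operator_topology_topspace)
  then obtain F e where F: "finite F" "0 < e" "\<And>v :: 'x dual. \<forall>x\<in>F. \<bar>blinfun_apply u x - blinfun_apply v x\<bar> < e \<Longrightarrow> v \<in> W"
    using weak_star_open_nbhd[OF W(1), of u] by blast
  obtain y where y: "norm y \<le> norm u + 1" "\<And>x. x \<in> F \<Longrightarrow> \<bar>u x - J x y\<bar> < e"
    using Goldstine_finite[OF J F(1,2), of u] by blast
  have "predual_eval J y \<in> W" by (rule F(3)) (simp add: predual_eval_apply[OF J] y(2))
  moreover have "predual_eval J y \<in> ?D" using norm_predual_eval_le[OF J, of y] y(1) by simp
  ultimately have "predual_eval J y \<in> {v \<in> topspace ?T. f v - g v \<in> {0<..}}" using W(2) by blast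
  then show False using le[of y] by simp
qed

lemma Hp_norm_in_p_bounds:
  assumes p: "1 \<le> p" and ne: "p_bounds p f \<noteq> {}"
  shows "Hp_norm p f \<in> p_bounds p f"
proof -
  have "0 \<le> Hp_norm p f"
    unfolding Hp_norm_def using ne by (intro cInf_greatest) (auto simp: p_bounds_def)
  moreover have "(\<Sum>i<n. \<bar>f (u i)\<bar> powr p) powr (1 / p) \<le> Hp_norm p f * weak_norm p n u" for n u
  proof -
    have "(\<Sum>i<n. \<bar>f (u i)\<bar> powr p) powr (1 / p) \<le> weak_norm p n u * (INF C\<in>p_bounds p f. C)"
      using ne weak_norm_nonneg[OF p] by (intro le_scaled_cINF) (auto simp: p_bounds_def mult.commute)
    then show ?thesis by (simp add: Hp_norm_def mult.commute)
  qed
  ultimately show ?thesis by (simp add: p_bounds_def)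
qed

lemma p_bounds_mono:
  assumes "1 \<le> p" "C \<in> p_bounds p f" "C \<le> D"
  shows "D \<in> p_bounds p f"
proof -
  have "C * weak_norm p n u \<le> D * weak_norm p n u" for n and u :: "nat \<Rightarrow> 'a dual"
    using assms(3) weak_norm_nonneg[OF assms(1)] by (rule mult_right_mono)
  then show ?thesis using assms(2,3) unfolding p_bounds_def by (fastforce intro: order_trans)
qed

lemma Hp_norm_le:
  assumes "C \<in> p_bounds p f"
  shows "Hp_norm p f \<le> C"
  unfolding Hp_norm_def by (rule cInf_lower[OF assms]) (auto simp: p_bounds_def intro: bdd_belowI[of _ 0])

text \<open>The barycentre \<open>V \<phi>\<close> is first a functional on \<open>'y\<close>; it belongs to \<open>'x\<close> because
  \<open>'x\<close> is the dual of \<open>'y\<close>.\<close>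

lemma stone_weak_densities:
  fixes J :: "'x::banach \<Rightarrow> 'y::banach dual" and M :: "'x filter measure"
  assumes J: "linear J" "\<And>x. norm (J x) = norm x" "surj J"
    and M: "space M = stone_space (cball 0 1)" "prob_space M"
      "\<And>A. A \<subseteq> cball 0 1 \<Longrightarrow> stone_set (cball 0 1) A \<in> sets M"
  shows "\<exists>V h. weak_densities M V h \<and>
    (\<forall>y. (\<lambda>F. Lim F (\<lambda>x. J x y)) \<in> borel_measurable M \<and> (AE F in M. h (predual_eval J y) F = Lim F (\<lambda>x. J x y)))"
proof -
  interpret prob_space M by fact
  define e where "e y F = Lim F (\<lambda>x. J x y)" for y F
  have Jle: "\<bar>J x y\<bar> \<le> norm y" if "x \<in> cball 0 1" for x y
    using norm_blinfun[of "J x" y] mult_right_mono[of "norm x" 1 "norm y"] that by (simp add: J(2))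
  have e_lim: "((\<lambda>x. J x y) \<longlongrightarrow> e y F) F" and e_le: "\<bar>e y F\<bar> \<le> norm y" if "F \<in> space M" for y F
    using stone_limit_exists[of "cball 0 1" "\<lambda>x. J x y" "norm y" F, OF Jle] that M(1) by (auto simp: e_def)
  have e_meas [measurable]: "e y \<in> borel_measurable M" for y
    unfolding e_def[abs_def] by (rule stone_limit_measurable[OF M(1,3) Jle])
  have nb: "F \<noteq> bot" if "F \<in> space M" for F
    using that M(1) by (auto simp: stone_space_def dest: ultrafilter_not_bot)
  have e_add: "e (y + y') F = e y F + e y' F" if "F \<in> space M" for y y' F
    using tendsto_unique[OF nb[OF that] e_lim[OF that, of "y + y'"]]
      tendsto_add[OF e_lim[OF that, of y] e_lim[OF that, of y']] by (simp add: blinfun.add_right)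
  have e_scale: "e (c *\<^sub>R y) F = c * e y F" if "F \<in> space M" for c y F
    using tendsto_unique[OF nb[OF that] e_lim[OF that, of "c *\<^sub>R y"]]
      tendsto_mult_left[OF e_lim[OF that, of y], of c] by (simp add: blinfun.scaleR_right)
  have int_e: "integrable M (\<lambda>F. \<phi> F * e y F)" if phi: "integrable M \<phi>" for \<phi> y
  proof (rule Bochner_Integration.integrable_bound)
    show "integrable M (\<lambda>F. norm y * \<phi> F)" using phi by simp
    show "AE F in M. norm (\<phi> F * e y F) \<le> norm (norm y * \<phi> F)"
    proof (intro AE_I2)
      fix F assume "F \<in> space M"
      then show "norm (\<phi> F * e y F) \<le> norm (norm y * \<phi> F)"
        using mult_right_mono[OF e_le, of F "\<bar>\<phi> F\<bar>" y] by (simp add: abs_mult mult.commute)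
    qed
  qed (use phi in auto)
  define V where "V \<phi> = inv J (Blinfun (\<lambda>y. \<integral>F. \<phi> F * e y F \<partial>M))" for \<phi>
  have JV: "J (V \<phi>) y = (\<integral>F. \<phi> F * e y F \<partial>M)" and V_norm: "norm (V \<phi>) \<le> (\<integral>F. \<bar>\<phi> F\<bar> \<partial>M)"
    if phi: "integrable M \<phi>" for \<phi> y
  proof -
    have le: "norm (\<integral>F. \<phi> F * e y F \<partial>M) \<le> (\<integral>F. \<bar>\<phi> F\<bar> \<partial>M) * norm y" for y
    proof -
      have "norm (\<integral>F. \<phi> F * e y F \<partial>M) \<le> (\<integral>F. norm (\<phi> F * e y F) \<partial>M)" by (rule integral_norm_bound)
      also have "\<dots> \<le> (\<integral>F. \<bar>\<phi> F\<bar> * norm y \<partial>M)"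
      proof (rule integral_mono)
        show "integrable M (\<lambda>F. norm (\<phi> F * e y F))" by (rule integrable_norm[OF int_e[OF phi]])
        show "norm (\<phi> F * e y F) \<le> \<bar>\<phi> F\<bar> * norm y" if "F \<in> space M" for F
          using e_le[OF that] by (simp add: abs_mult mult_left_mono)
      qed (use phi in simp)
      finally show ?thesis by simp
    qed
    have bl: "bounded_linear (\<lambda>y. \<integral>F. \<phi> F * e y F \<partial>M)"
    proof (rule bounded_linear_intro)
      fix y y' and c :: real
      have "(\<integral>F. \<phi> F * e (y + y') F \<partial>M) = (\<integral>F. \<phi> F * e y F + \<phi> F * e y' F \<partial>M)"
        by (intro Bochner_Integration.integral_cong) (auto simp: e_add algebra_simps)
      then show "(\<integral>F. \<phi> F * e (y + y') F \<partial>M) = (\<integral>F. \<phi> F * e y F \<partial>M) + (\<integral>F. \<phi> F * e y' F \<partial>M)"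
        using int_e[OF phi] by simp
      have "(\<integral>F. \<phi> F * e (c *\<^sub>R y) F \<partial>M) = (\<integral>F. c * (\<phi> F * e y F) \<partial>M)"
        by (intro Bochner_Integration.integral_cong) (auto simp: e_scale)
      then show "(\<integral>F. \<phi> F * e (c *\<^sub>R y) F \<partial>M) = c *\<^sub>R (\<integral>F. \<phi> F * e y F \<partial>M)" by simp
      show "norm (\<integral>F. \<phi> F * e y F \<partial>M) \<le> norm y * (\<integral>F. \<bar>\<phi> F\<bar> \<partial>M)"
        using le[of y] by (simp add: mult.commute)
    qed
    have "J (V \<phi>) = Blinfun (\<lambda>y. \<integral>F. \<phi> F * e y F \<partial>M)"
      unfolding V_def by (rule surj_f_inv_f[OF J(3)])
    then show JV: "J (V \<phi>) y = (\<integral>F. \<phi> F * e y F \<partial>M)" for y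
      by (simp add: bounded_linear_Blinfun_apply[OF bl])
    have "norm (J (V \<phi>)) \<le> (\<integral>F. \<bar>\<phi> F\<bar> \<partial>M)"
      using le JV by (intro norm_blinfun_bound) auto
    then show "norm (V \<phi>) \<le> (\<integral>F. \<bar>\<phi> F\<bar> \<partial>M)" by (simp add: J(2))
  qed
  have J_inj: "a = b" if "\<And>y. J a y = J b y" for a b
  proof -
    have "J a = J b" using that by (rule blinfun_eqI)
    then have "norm (a - b) = 0" using J(2)[of "a - b"] by (simp add: linear_diff[OF J(1)])
    then show ?thesis by simp
  qed
  have V_add: "V (\<lambda>F. \<phi> F + \<psi> F) = V \<phi> + V \<psi>" if "integrable M \<phi>" "integrable M \<psi>" for \<phi> \<psi>
    using that int_e by (intro J_inj) (simp add: JV linear_add[OF J(1)] blinfun.add_left distrib_right)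
  have V_scale: "V (\<lambda>F. c * \<phi> F) = c *\<^sub>R V \<phi>" if "integrable M \<phi>" for c \<phi>
    using that by (intro J_inj) (simp add: JV linear_scale[OF J(1)] blinfun.scaleR_left mult.assoc)
  have "\<exists>h\<in>borel_measurable M. (\<forall>F. \<bar>h F\<bar> \<le> norm u) \<and>
      (\<forall>\<phi>. integrable M \<phi> \<longrightarrow> u (V \<phi>) = (\<integral>F. \<phi> F * h F \<partial>M))" for u :: "'x dual"
  proof -
    have "\<bar>u (V \<phi>)\<bar> \<le> norm u * (\<integral>F. \<bar>\<phi> F\<bar> \<partial>M)" if "integrable M \<phi>" for \<phi>
      using norm_blinfun[of u "V \<phi>"] mult_left_mono[OF V_norm[OF that], of "norm u"] by simp
    then obtain k where "k \<in> borel_measurable M" "\<And>F. \<bar>k F\<bar> \<le> norm u"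
      "\<And>\<phi>. integrable M \<phi> \<Longrightarrow> u (V \<phi>) = (\<integral>F. \<phi> F * k F \<partial>M)"
      by (rule L1_dual_density[of "\<lambda>\<phi>. u (V \<phi>)" "norm u", rotated 2])
        (auto simp: V_add V_scale blinfun.add_right blinfun.scaleR_right)
    then show ?thesis by (intro bexI[of _ k]) auto
  qed
  then obtain h where h: "\<And>u. h u \<in> borel_measurable M" "\<And>u F. \<bar>h u F\<bar> \<le> norm u"
    "\<And>u \<phi>. integrable M \<phi> \<Longrightarrow> blinfun_apply u (V \<phi>) = (\<integral>F. \<phi> F * h u F \<partial>M)" by metis
  interpret weak_densities M V h
    by unfold_locales (use V_add V_scale V_norm h in auto)
  have he: "AE F in M. h (predual_eval J y) F = e y F" for y
  proof (rule h_unique)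
    show "integrable M (e y)" using int_e[of "\<lambda>_. 1" y] by simp
    fix E assume "E \<in> sets M"
    then show "blinfun_apply (predual_eval J y) (V (indicator E)) = (\<integral>F. indicator E F * e y F \<partial>M)"
      by (simp add: predual_eval_apply[OF J(1,2)] JV integrable_indicator_real)
  qed
  show ?thesis
    by (intro exI[of _ V] exI[of _ h] conjI allI weak_densities_axioms
        e_meas[unfolded e_def[abs_def]] he[unfolded e_def])
qed

definition (in weak_densities) Lp_seminorm :: "real \<Rightarrow> real \<Rightarrow> 'x dual \<Rightarrow> real" where
  "Lp_seminorm S p u = S * (\<integral>w. \<bar>h u w\<bar> powr p \<partial>M) powr (1 / p)"

lemma (in weak_densities) Lp_seminorm_in_H_wstar:
  assumes w: "wRNP TYPE('x)" and p: "1 \<le> p"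
  shows "Lp_seminorm S p \<in> H_wstar"
proof -
  let ?g = "Lp_seminorm S p"
  have nn: "0 \<le> (\<integral>w. \<bar>h u w\<bar> powr p \<partial>M)" for u by simp
  have "?g (c *\<^sub>R u) = c * ?g u" if c: "0 \<le> c" for c u
  proof -
    have "(\<integral>w. \<bar>h (c *\<^sub>R u) w\<bar> powr p \<partial>M) = (\<integral>w. c powr p * \<bar>h u w\<bar> powr p \<partial>M)"
    proof (rule integral_cong_AE)
      show "AE w in M. \<bar>h (c *\<^sub>R u) w\<bar> powr p = c powr p * \<bar>h u w\<bar> powr p"
        using h_scale[of c u] by eventually_elim (use c in \<open>simp add: abs_mult powr_mult\<close>)
    qed auto
    then show ?thesis using c p nn[of u] by (simp add: Lp_seminorm_def powr_mult powr_powr)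
  qed
  moreover have "continuous_map (subtopology weak_star_topology B) euclideanreal ?g" if B: "bounded B" for B
    unfolding continuous_map_atin
  proof
    let ?T = "subtopology weak_star_topology B"
    fix u0 assume u0: "u0 \<in> topspace ?T"
    obtain R where R: "\<And>v. v \<in> B \<Longrightarrow> norm v \<le> R" using B by (auto simp: bounded_iff)
    have "eventually (\<lambda>v. norm v \<le> R) (atin ?T u0)"
      unfolding eventually_atin
      by (intro disjI2 exI[of _ "topspace ?T"] conjI openin_topspace u0 ballI R) auto
    moreover have "((\<lambda>v. blinfun_apply v x) \<longlongrightarrow> blinfun_apply u0 x) (atin ?T u0)" for x
    proof -
      have "continuous_map ?T euclidean (\<lambda>v. blinfun_apply v x)"
        by (rule continuous_map_from_subtopology[OF strong_operator_topology_continuous_evaluation])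
      then show ?thesis using u0 by (simp add: continuous_map_atin)
    qed
    ultimately have "((\<lambda>u. \<integral>w. \<bar>h u w\<bar> powr p \<partial>M) \<longlongrightarrow> (\<integral>w. \<bar>h u0 w\<bar> powr p \<partial>M)) (atin ?T u0)"
      by (rule powr_integrals_tendsto[OF w p])
    then have "(?g \<longlongrightarrow> ?g u0) (atin ?T u0)"
      unfolding Lp_seminorm_def[abs_def] using p nn by (intro tendsto_mult tendsto_const tendsto_powr') auto
    then show "limitin euclideanreal ?g (?g u0) (atin ?T u0)" by simp
  qed
  ultimately show ?thesis unfolding H_wstar_def by blast
qed

lemma (in weak_densities) Lp_seminorm_p_bound:
  assumes p: "1 \<le> p" and S: "0 \<le> S" and M: "prob_space M"
  shows "S \<in> p_bounds p (Lp_seminorm S p)"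
proof -
  interpret prob_space M by fact
  have "(\<Sum>i<n. \<bar>Lp_seminorm S p (u i)\<bar> powr p) powr (1 / p) \<le> S * weak_norm p n u" for n u
  proof -
    have "(\<Sum>i<n. \<bar>Lp_seminorm S p (u i)\<bar> powr p) = S powr p * (\<Sum>i<n. \<integral>w. \<bar>h (u i) w\<bar> powr p \<partial>M)"
      using p S by (simp add: Lp_seminorm_def abs_mult powr_mult powr_powr sum_distrib_left)
    also have "(\<Sum>i<n. \<integral>w. \<bar>h (u i) w\<bar> powr p \<partial>M) = (\<integral>w. (\<Sum>i<n. \<bar>h (u i) w\<bar> powr p) \<partial>M)"
      using p by (intro Bochner_Integration.integral_sum[symmetric] integrable_h_powr) simp
    also have "\<dots> \<le> weak_norm p n u powr p"
      using p by (intro integral_le_const sum_powr_h_le Bochner_Integration.integrable_sum integrable_h_powr) auto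
    finally have "(\<Sum>i<n. \<bar>Lp_seminorm S p (u i)\<bar> powr p) \<le> S powr p * weak_norm p n u powr p"
      by (simp add: mult_left_mono)
    then have "(\<Sum>i<n. \<bar>Lp_seminorm S p (u i)\<bar> powr p) powr (1 / p) \<le> (S powr p * weak_norm p n u powr p) powr (1 / p)"
      using p by (intro powr_mono2) (auto intro: sum_nonneg)
    also have "\<dots> = S * weak_norm p n u"
      using p S weak_norm_nonneg[OF p, of n u] by (simp add: powr_mult powr_powr)
    finally show ?thesis .
  qed
  then show ?thesis using S by (simp add: p_bounds_def)
qed

theorem theorem4p1:
  fixes p :: real
    and J :: "'x::banach \<Rightarrow> 'y::banach dual"
  assumes "1 \<le> p"
    and "isometric_isomorphism J"
    and "wRNP TYPE('x)"
  shows "monotonically_bounded TYPE('i) 1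
           (Hp_wstar p :: ('x dual \<Rightarrow> real) set) (Hp_norm p)"
  unfolding monotonically_bounded_def
proof (intro conjI allI impI, rule order_refl, elim conjE)
  fix I :: "'i set" and le and z :: "'i \<Rightarrow> 'x dual \<Rightarrow> real"
  assume dir: "directed_preorder I le" and z: "\<forall>i\<in>I. z i \<in> Hp_wstar p \<and> 0 \<le> z i"
    and mono: "\<forall>i\<in>I. \<forall>j\<in>I. le i j \<longrightarrow> z i \<le> z j" and bdd: "bdd_above ((\<lambda>i. Hp_norm p (z i)) ` I)"
  have J: "linear J" "\<And>x. norm (J x) = norm x" "surj J"
    using assms(2) by (auto simp: isometric_isomorphism_def)
  note p = assms(1)
  have I: "I \<noteq> {}" using dir by (simp add: directed_preorder_def)
  define S where "S = (SUP i\<in>I. Hp_norm p (z i))"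
  have S_bound: "S \<in> p_bounds p (z i)" if i: "i \<in> I" for i
  proof (rule p_bounds_mono[OF p])
    show "Hp_norm p (z i) \<in> p_bounds p (z i)"
      using z i by (intro Hp_norm_in_p_bounds[OF p]) (auto simp: Hp_wstar_def)
    show "Hp_norm p (z i) \<le> S" unfolding S_def by (rule cSUP_upper[OF i bdd])
  qed
  have S: "0 \<le> S" using I S_bound by (auto simp: p_bounds_def)
  have H: "z i \<in> H_wstar" if "i \<in> I" for i using z that by (simp add: Hp_wstar_def)
  have zdir: "\<exists>k\<in>I. z i \<le> z k \<and> z j \<le> z k" if "i \<in> I" "j \<in> I" for i j
    using dir mono that unfolding directed_preorder_def by metis
  have znn: "0 \<le> z i u" if "i \<in> I" for i u
    using z that by (auto simp: le_fun_def)
  obtain M :: "'x filter measure" where M: "space M = stone_space (cball 0 1)" "prob_space M"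
    "\<forall>A\<subseteq>cball 0 1. stone_set (cball 0 1) A \<in> sets M"
    and dom: "\<forall>i\<in>I. \<forall>y. z i (predual_eval J y) powr p \<le> S powr p * (\<integral>F. \<bar>Lim F (\<lambda>x. J x y)\<bar> powr p \<partial>M)"
    using Pietsch_measure[OF J(1,2) p S I zdir znn] H S_bound
    by (simp add: H_wstar_def p_bounds_def) blast
  obtain V h where "weak_densities M V h"
    and Lim_meas: "\<And>y. (\<lambda>F. Lim F (\<lambda>x. J x y)) \<in> borel_measurable M"
    and he: "\<And>y. AE F in M. h (predual_eval J y) F = Lim F (\<lambda>x. J x y)"
    using stone_weak_densities[OF J M(1,2)] M(3) by blast
  then interpret weak_densities M V h by simp
  define g where "g = Lp_seminorm S p"
  have gH: "g \<in> H_wstar"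
    unfolding g_def by (rule Lp_seminorm_in_H_wstar[OF assms(3) p])
  have gS: "S \<in> p_bounds p g"
    unfolding g_def by (rule Lp_seminorm_p_bound[OF p S M(2)])
  have "z i \<le> g" if i: "i \<in> I" for i
  proof (rule le_funI, rule le_if_le_on_predual[OF J(1,2)])
    fix y
    have eq: "(\<integral>F. \<bar>Lim F (\<lambda>x. J x y)\<bar> powr p \<partial>M) = (\<integral>w. \<bar>h (predual_eval J y) w\<bar> powr p \<partial>M)"
    proof (rule integral_cong_AE)
      show "(\<lambda>F. \<bar>Lim F (\<lambda>x. J x y)\<bar> powr p) \<in> borel_measurable M"
        using Lim_meas[of y] by measurable
      show "AE F in M. \<bar>Lim F (\<lambda>x. J x y)\<bar> powr p = \<bar>h (predual_eval J y) F\<bar> powr p"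
        using he[of y] by eventually_elim simp
    qed simp
    have "z i (predual_eval J y) powr p \<le> S powr p * (\<integral>w. \<bar>h (predual_eval J y) w\<bar> powr p \<partial>M)"
      using dom[rule_format, OF i, of y] unfolding eq .
    then have "(z i (predual_eval J y) powr p) powr (1 / p) \<le> (S powr p * (\<integral>w. \<bar>h (predual_eval J y) w\<bar> powr p \<partial>M)) powr (1 / p)"
      using p by (intro powr_mono2) auto
    then show "z i (predual_eval J y) \<le> g (predual_eval J y)"
      using p S znn[OF i] by (simp add: g_def Lp_seminorm_def powr_mult powr_powr)
  qed (use H[OF i] gH in \<open>auto simp: H_wstar_def\<close>)
  then show "\<exists>z0\<in>Hp_wstar p. (\<forall>i\<in>I. z i \<le> z0) \<and> Hp_norm p z0 \<le> 1 * (SUP i\<in>I. Hp_norm p (z i))"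
    using gH gS Hp_norm_le[OF gS] by (intro bexI[of _ g]) (auto simp: S_def Hp_wstar_def)
qed

end
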